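(* Let $C:f=0$ be a reduced plane curve of degree $d$ in $\mathbb{P}^2$ (over $\mathbb{C}$), let $r=\mathrm{mdr}(f)$ (equivalently $r=d_1$, the smallest exponent of $C$), and assume that $r\ge d/2$ and that $C$ is a maximal Tjurina curve. Then the Hilbert vector of the Jacobian module $N(f)$ is given by $$n(f)_j=\begin{cases} 3(d')^2-(j-3d'+2)(j-3d'+1)-\tau(C) & \text{if } d=2d'+1 \text{ is odd},\\ 3(d')^2-3d'+1-(j-3d'+3)^2-\tau(C) & \text{if } d=2d' \text{ is even},\end{cases}$$ for all integers $j$ with $2d-3-r\le j\le d-3+r$, and $n(f)_j=0$ for all other $j$.
   Context: Let $S=\mathbb{C}[x,y,z]$ with its standard grading and maximal ideal $\mathbf m=(x,y,z)$. For a reduced curve $C:f=0$ of degree $d$ in the complex projective plane $\mathbb{P}^2$, with $f\in S$ homogeneous of degree $d$, let $J_f=(f_x,f_y,f_z)\subset S$ be the ideal generated by the partial derivatives of $f$, and let $\hat J_f$ be the saturation of $J_f$ with respect to $\mathbf m$. The Jacobian module is the graded $S$-module $N(f)=\hat J_f/J_f$; put $n(f)_j=\dim_{\mathbb{C}} N(f)_j$. The global Tjurina number $\tau(C)$ is the degree of the $0$-dimensional subscheme of $\mathbb{P}^2$ defined by $J_f$ (the singular subscheme of $C$). The graded module of Jacobian syzygies is $\mathrm{Syz}(J_f)=\{(a,b,c)\in S^3: af_x+bf_y+cf_z=0\}$, where $(a,b,c)$ has degree $k$ if $a,b,c\in S_k$. Set $\mathrm{mdr}(f)=\min\{k:\mathrm{Syz}(J_f)_k\ne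 0\}$; this is the smallest degree $d_1$ in a minimal set of homogeneous generators of $\mathrm{Syz}(J_f)$. A reduced plane curve $C:f=0$ of degree $d$ with $r=\mathrm{mdr}(f)\ge d/2$ is called a maximal Tjurina curve if $$\tau(C)=(d-1)(d-r-1)+r^2-\binom{2r-d+2}{2}.$$ *)

theory Defs
  imports
    Complex_Main
    "HOL-Library.Poly_Mapping"
    "HOL-Library.Numeral_Type"
    "HOL-Computational_Algebra.Polynomial"
    "HOL-Computational_Algebra.Squarefree"
begin

text \<open>
  The ring S = C[x,y,z]: a monomial is its exponent function on the index type \<^typ>\<open>3\<close>, and a
  polynomial is the finitely supported function assigning to each monomial its coefficient.
  The indices 0, 1, 2 stand for x, y, z.
\<close>

type_synonym mono3 = "3 \<Rightarrow>\<^sub>0 nat"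
type_synonym poly3 = "mono3 \<Rightarrow>\<^sub>0 complex"

definition var :: "3 \<Rightarrow> poly3" where
  "var i = Poly_Mapping.single (Poly_Mapping.single i 1) 1"

definition scal :: "complex \<Rightarrow> poly3 \<Rightarrow> poly3" where
  "scal c p = Poly_Mapping.single 0 c * p"

definition mono_degree :: "mono3 \<Rightarrow> nat" where
  "mono_degree m = (\<Sum>i\<in>UNIV. Poly_Mapping.lookup m i)"

text \<open>The graded pieces are indexed by integers; those of negative degree are \<open>{0}\<close>.\<close>

definition homog :: "int \<Rightarrow> poly3 set" where
  "homog k = {p. \<forall>m\<in>Poly_Mapping.keys p. int (mono_degree m) = k}"

text \<open>
  In the partial derivative, a monomial m not involving the variable i has exponent
  \<open>lookup m i = 0\<close>, so that the truncated subtraction is harmless.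
\<close>

definition pdiff :: "3 \<Rightarrow> poly3 \<Rightarrow> poly3" where
  "pdiff i p = (\<Sum>m\<in>Poly_Mapping.keys p.
     Poly_Mapping.single (m - Poly_Mapping.single i 1)
       (of_nat (Poly_Mapping.lookup m i) * Poly_Mapping.lookup p m))"

lemma module_mult: "module ((*) :: 'a::comm_ring_1 \<Rightarrow> 'a \<Rightarrow> 'a)"
  by unfold_locales (simp_all add: algebra_simps)

definition ideal_gen :: "poly3 set \<Rightarrow> poly3 set" where
  "ideal_gen B = module.span (*) B"

fun ideal_pow :: "poly3 set \<Rightarrow> nat \<Rightarrow> poly3 set" where
  "ideal_pow I 0 = UNIV"
| "ideal_pow I (Suc k) = ideal_gen {a * b | a b. a \<in> I \<and> b \<in> ideal_pow I k}"

definition max_ideal :: "poly3 set" where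
  "max_ideal = ideal_gen {var 0, var 1, var 2}"

definition saturation :: "poly3 set \<Rightarrow> poly3 set" where
  "saturation I = {p. \<exists>k. \<forall>q\<in>ideal_pow max_ideal k. q * p \<in> I}"

text \<open>
  The complex dimension of the quotient U/W of linear subspaces, where W is contained in U and U/W
  is finite-dimensional: the number of elements of U whose classes form a basis of U/W.
\<close>

definition quot_dim :: "poly3 set \<Rightarrow> poly3 set \<Rightarrow> nat" where
  "quot_dim U W = (THE n. \<exists>B. B \<subseteq> U \<and> finite B \<and> card B = n \<and>
     (\<forall>c. (\<Sum>b\<in>B. scal (c b) b) \<in> W \<longrightarrow> (\<forall>b\<in>B. c b = 0)) \<and>
     (\<forall>u\<in>U. \<exists>c. u - (\<Sum>b\<in>B. scal (c b) b) \<in> W))"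

text \<open>
  For a homogeneous ideal I, the closed subscheme of the projective plane defined by I has as
  degree \<open>e!\<close> times the leading coefficient of the Hilbert polynomial of S/I, where e is the
  degree of that polynomial. If the subscheme is 0-dimensional, the Hilbert polynomial is a
  constant, which is the degree; if it is empty, the degree is 0.
\<close>

definition hilbert_fun :: "poly3 set \<Rightarrow> int \<Rightarrow> nat" where
  "hilbert_fun I k = quot_dim (homog k) (I \<inter> homog k)"

definition hilbert_poly :: "poly3 set \<Rightarrow> rat poly" where
  "hilbert_poly I = (THE P. \<forall>\<^sub>F k in sequentially. poly P (of_nat k) = of_nat (hilbert_fun I (int k)))"

definition subscheme_degree :: "poly3 set \<Rightarrow> rat" where
  "subscheme_degree I = fact (degree (hilbert_poly I)) * lead_coeff (hilbert_poly I)"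

definition reduced_curve :: "poly3 \<Rightarrow> nat \<Rightarrow> bool" where
  "reduced_curve f d \<longleftrightarrow> d \<ge> 1 \<and> f \<noteq> 0 \<and> f \<in> homog (int d) \<and> squarefree f"

definition jac_ideal :: "poly3 \<Rightarrow> poly3 set" where
  "jac_ideal f = ideal_gen {pdiff 0 f, pdiff 1 f, pdiff 2 f}"

text \<open>
  The Jacobian module N(f) is the quotient of the saturation of the Jacobian ideal by that ideal;
  its piece of degree j is the quotient of the pieces of degree j.
\<close>

definition jac_module_dim :: "poly3 \<Rightarrow> int \<Rightarrow> nat" where
  "jac_module_dim f j = quot_dim (saturation (jac_ideal f) \<inter> homog j) (jac_ideal f \<inter> homog j)"

definition tjurina :: "poly3 \<Rightarrow> rat" where
  "tjurina f = subscheme_degree (jac_ideal f)"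

definition jac_syz :: "poly3 \<Rightarrow> (poly3 \<times> poly3 \<times> poly3) set" where
  "jac_syz f = {(a, b, c). a * pdiff 0 f + b * pdiff 1 f + c * pdiff 2 f = 0}"

definition jac_syz_deg :: "poly3 \<Rightarrow> nat \<Rightarrow> (poly3 \<times> poly3 \<times> poly3) set" where
  "jac_syz_deg f k = jac_syz f \<inter> homog (int k) \<times> homog (int k) \<times> homog (int k)"

definition mdr :: "poly3 \<Rightarrow> nat" where
  "mdr f = (LEAST k. jac_syz_deg f k \<noteq> {(0, 0, 0)})"

definition maximal_tjurina :: "poly3 \<Rightarrow> nat \<Rightarrow> bool" where
  "maximal_tjurina f d \<longleftrightarrow> reduced_curve f d \<and> d \<le> 2 * mdr f \<and>
     tjurina f = (of_nat d - 1) * (of_nat d - of_nat (mdr f) - 1) + of_nat (mdr f) ^ 2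
                 - of_nat ((2 * mdr f - d + 2) choose 2)"

end

theory Submission
  imports
    Defs
    "HOL-Computational_Algebra.Polynomial_Factorial"
    "HOL-Computational_Algebra.Field_as_Ring"
begin

text \<open>
  Put \<open>e = d - 1\<close>. For a suitable line \<open>l = 0\<close> there are two forms \<open>g1\<close>, \<open>g2\<close> in the span of the partial
  derivatives, spanning it together with a third one \<open>g3\<close>, such that \<open>l\<close>, \<open>g1\<close>, \<open>g2\<close> have no common
  zero in the plane. Let \<open>K = (g1, g2)\<close>, let \<open>J\<close> be the Jacobian ideal, \<open>S\<close> its saturation and
  \<open>I = K : g3\<close> the residual ideal. The elements of \<open>I\<close> are the last components of Jacobian syzygies,
  so \<open>I\<close> vanishes in degrees below \<open>r\<close>.

  The algebra \<open>A\<close> obtained by dividing by \<open>l\<close>, \<open>g1\<close>, \<open>g2\<close> is Gorenstein with socle degree \<open>2e - 2\<close>,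
  and the images of \<open>S\<close> and \<open>I\<close> in it annihilate each other. Comparing dimensions in the pairing of
  \<open>A\<close>, the vanishing of \<open>I\<close> below \<open>r\<close> forces the Hilbert function of the quotient by \<open>S\<close> to equal the
  Tjurina number from degree \<open>2e - 2 - r\<close> on. The quotient by \<open>J\<close> has an explicit Hilbert function up to
  degree \<open>e + r - 1\<close>, because there are no syzygies of degree below \<open>r\<close>. This function is symmetric under
  exchanging \<open>j\<close> and \<open>3e - 3 - j\<close>, and the curve is maximal Tjurina iff its value at \<open>e + r - 1\<close> is the
  Tjurina number. Hence \<open>S\<close> and \<open>J\<close> agree in the degrees \<open>e + r - 1\<close> and \<open>2e - 2 - r\<close>. The agreement
  spreads upwards since \<open>S\<close> has no new generators there, and downwards since there are no syzygies.
\<close>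

section \<open>Relative bases and dimensions\<close>

locale fin_vector_space = vector_space
begin

definition fin_dim :: "'b set \<Rightarrow> bool" where
  "fin_dim V \<longleftrightarrow> subspace V \<and> (\<exists>B. finite B \<and> V \<subseteq> span B)"

text \<open>The condition inside \<open>quot_dim\<close>: the classes of \<open>B\<close> form a
  basis of \<open>U\<close> modulo \<open>W\<close>. Keeping the same shape lets
  \<open>quot_dim\<close> be evaluated by unfolding.\<close>

definition rel_basis :: "'b set \<Rightarrow> 'b set \<Rightarrow> 'b set \<Rightarrow> bool" where
  "rel_basis W U B \<longleftrightarrow> B \<subseteq> U \<and> finite B \<and>
     (\<forall>c. (\<Sum>b\<in>B. c b *s b) \<in> W \<longrightarrow> (\<forall>b\<in>B. c b = 0)) \<and>
     (\<forall>u\<in>U. \<exists>c. u - (\<Sum>b\<in>B. c b *s b) \<in> W)"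

lemma rel_basisD:
  assumes "rel_basis W U B" "u \<in> U"
  obtains c where "u - (\<Sum>b\<in>B. c b *s b) \<in> W"
  using assms unfolding rel_basis_def by blast

lemma fin_dim_subspace: "fin_dim V \<Longrightarrow> subspace V"
  by (simp add: fin_dim_def)

lemma subspace_sum_scale: "subspace W \<Longrightarrow> B \<subseteq> W \<Longrightarrow> (\<Sum>b\<in>B. c b *s b) \<in> W"
  by (intro subspace_sum subspace_scale) auto

lemma fin_dim_subset: "fin_dim V \<Longrightarrow> subspace W \<Longrightarrow> W \<subseteq> V \<Longrightarrow> fin_dim W"
  unfolding fin_dim_def by blast

lemma fin_dim_basis:
  assumes "fin_dim V"
  obtains B where "B \<subseteq> V" "independent B" "finite B" "span B = V" "card B = dim V"
proof -
  obtain B where B: "B \<subseteq> V" "independent B" "V \<subseteq> span B" "card B = dim V"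
    using basis_exists by blast
  moreover have "finite B"
    using assms B independent_span_bound unfolding fin_dim_def by blast
  moreover have "span B = V"
    using B assms fin_dim_subspace span_minimal by blast
  ultimately show thesis using that by blast
qed

text \<open>A basis \<open>D\<close> of \<open>W\<close> together with \<open>B\<close> is a basis
  of \<open>U\<close>: in a linear relation over both, the part over \<open>B\<close> lies in
  \<open>W\<close>, so both parts vanish.\<close>

lemma dim_rel_basis:
  assumes W: "fin_dim W" and "subspace U" and WU: "W \<subseteq> U" and B: "rel_basis W U B"
  shows "dim U = dim W + card B"
proof -
  obtain D where D: "D \<subseteq> W" "independent D" "finite D" "span D = W" "card D = dim W"
    using fin_dim_basis[OF W] .
  have B1: "B \<subseteq> U" "finite B" using B by (auto simp: rel_basis_def)
  have ind: "c b = 0" if "(\<Sum>b\<in>B. c b *s b) \<in> W" "b \<in> B" for c b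
    using B that unfolding rel_basis_def by blast
  have disj: "B \<inter> D = {}"
  proof (rule ccontr)
    assume "B \<inter> D \<noteq> {}"
    then obtain b where b: "b \<in> B" "b \<in> D" by blast
    \<comment> \<open>The indicator of a common element \<open>b\<close> would be a nonzero
      coefficient family over \<open>B\<close> with sum in \<open>W\<close>.\<close>
    have "(\<Sum>x\<in>B. (if x = b then 1 else 0) *s x) = (\<Sum>x\<in>B. if x = b then b else 0)"
      by (intro sum.cong) auto
    also have "\<dots> = b" using b B1 by simp
    finally have "(\<Sum>x\<in>B. (if x = b then 1 else 0) *s x) \<in> W" using b D by auto
    from ind[OF this b(1)] show False by simp
  qed
  have spn: "span (B \<union> D) = U"
  proof
    show "span (B \<union> D) \<subseteq> U" using B1 D WU \<open>subspace U\<close> by (intro span_minimal) auto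
    show "U \<subseteq> span (B \<union> D)"
    proof
      fix u assume "u \<in> U"
      then obtain c where "u - (\<Sum>b\<in>B. c b *s b) \<in> W" using B unfolding rel_basis_def by blast
      then have "u - (\<Sum>b\<in>B. c b *s b) \<in> span (B \<union> D)"
        using D(4) span_mono[of D "B \<union> D"] by blast
      moreover have "(\<Sum>b\<in>B. c b *s b) \<in> span (B \<union> D)"
        by (intro span_sum span_scale span_base) auto
      ultimately show "u \<in> span (B \<union> D)" using span_add by fastforce
    qed
  qed
  have "independent (B \<union> D)"
  proof (rule independent_if_scalars_zero)
    show "finite (B \<union> D)" using B1 D by simp
    fix c x assume s0: "(\<Sum>x\<in>B \<union> D. c x *s x) = 0" and x: "x \<in> B \<union> D"
    have s: "(\<Sum>x\<in>B. c x *s x) + (\<Sum>x\<in>D. c x *s x) = 0"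
      using s0 sum.union_disjoint[OF B1(2) D(3) disj, of "\<lambda>x. c x *s x"] by simp
    have "(\<Sum>x\<in>D. c x *s x) \<in> W"
      using subspace_sum_scale[OF fin_dim_subspace[OF W] D(1)] .
    then have "(\<Sum>x\<in>B. c x *s x) \<in> W"
      using s subspace_neg[OF fin_dim_subspace[OF W]] by (simp add: eq_neg_iff_add_eq_0[symmetric])
    then have cB: "c b = 0" if "b \<in> B" for b using ind that by blast
    then have "(\<Sum>x\<in>D. c x *s x) = 0" using s by simp
    then have "c b = 0" if "b \<in> D" for b
      using D that dependent_finite[OF D(3)] by blast
    then show "c x = 0" using cB x by blast
  qed
  then have "dim U = card (B \<union> D)" using spn dim_span_eq_card_independent by blast
  then show ?thesis using card_Un_disjoint[OF B1(2) D(3) disj] D(5) by simp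
qed

text \<open>Extend a basis \<open>D\<close> of \<open>W\<close> to a basis \<open>E\<close> of
  \<open>U\<close>; the added vectors \<open>E - D\<close> form the relative basis.\<close>

lemma rel_basis_exists:
  assumes U: "fin_dim U" and W: "subspace W" "W \<subseteq> U"
  obtains B where "rel_basis W U B"
proof -
  obtain D where D: "D \<subseteq> W" "independent D" "finite D" "span D = W"
    using fin_dim_basis[OF fin_dim_subset[OF U W]] by metis
  obtain E where E: "D \<subseteq> E" "E \<subseteq> U" "independent E" "U \<subseteq> span E"
    using maximal_independent_subset_extend[of D U] D W by blast
  have fE: "finite E" using U E independent_span_bound unfolding fin_dim_def by blast
  have "rel_basis W U (E - D)"
    unfolding rel_basis_def
  proof (intro conjI allI ballI impI)
    show "E - D \<subseteq> U" "finite (E - D)" using E fE by auto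
    fix c b assume s: "(\<Sum>b\<in>E - D. c b *s b) \<in> W" and b: "b \<in> E - D"
    then obtain c' where c': "(\<Sum>b\<in>E - D. c b *s b) = (\<Sum>b\<in>D. c' b *s b)"
      using D span_finite[OF D(3)] by auto
    have "(\<Sum>x\<in>E. (if x \<in> D then - c' x else c x) *s x)
        = (\<Sum>x\<in>E - D. (if x \<in> D then - c' x else c x) *s x)
          + (\<Sum>x\<in>D. (if x \<in> D then - c' x else c x) *s x)"
      using sum.subset_diff[OF E(1) fE] by blast
    also have "\<dots> = (\<Sum>b\<in>E - D. c b *s b) + (\<Sum>x\<in>D. - (c' x *s x))"
      by (intro arg_cong2[where f="(+)"] sum.cong) auto
    also have "\<dots> = 0" using c' by (simp add: sum_negf)
    finally have "(if b \<in> D then - c' b else c b) = 0"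
      using b by (intro independentD[OF E(3) fE order_refl, of "\<lambda>x. if x \<in> D then - c' x else c x"]) auto
    then show "c b = 0" using b by auto
  next
    fix u assume "u \<in> U"
    then obtain c where c: "u = (\<Sum>x\<in>E. c x *s x)" using E span_finite[OF fE] by auto
    then have "u - (\<Sum>x\<in>E - D. c x *s x) = (\<Sum>x\<in>D. c x *s x)"
      using sum.subset_diff[OF E(1) fE, of "\<lambda>x. c x *s x"] by simp
    also have "\<dots> \<in> W" using subspace_sum_scale[OF W(1) D(1)] .
    finally show "\<exists>c. u - (\<Sum>b\<in>E - D. c b *s b) \<in> W" by blast
  qed
  then show thesis using that by blast
qed

lemma dim_mono_fin:
  assumes "fin_dim U" "subspace W" "W \<subseteq> U"
  shows "dim W \<le> dim U"
proof -
  obtain B where B: "rel_basis W U B" using rel_basis_exists assms by blast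
  show ?thesis
    using dim_rel_basis[OF fin_dim_subset[OF assms] fin_dim_subspace[OF assms(1)] assms(3) B] by simp
qed

lemma dim_eq_imp_eq:
  assumes U: "fin_dim U" "subspace W" "W \<subseteq> U" "dim U \<le> dim W"
  shows "W = U"
proof -
  obtain B where B: "rel_basis W U B" using rel_basis_exists U by blast
  have "card B = 0"
    using dim_rel_basis[OF fin_dim_subset[OF U(1-3)] fin_dim_subspace[OF U(1)] U(3) B] U(4) by simp
  then have "B = {}" using B unfolding rel_basis_def by simp
  then have "U \<subseteq> W" using B by (auto simp: rel_basis_def)
  then show ?thesis using U by blast
qed

text \<open>A basis of \<open>A\<close> modulo the intersection is also a basis of the sum modulo
  \<open>B\<close> (second isomorphism theorem).\<close>

lemma dim_sum_int:
  assumes A: "fin_dim A" and B: "fin_dim B"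
  shows "dim {x + y | x y. x \<in> A \<and> y \<in> B} + dim (A \<inter> B) = dim A + dim B"
proof -
  let ?S = "{x + y | x y. x \<in> A \<and> y \<in> B}"
  note sA = fin_dim_subspace[OF A] and sB = fin_dim_subspace[OF B]
  have sAB: "subspace (A \<inter> B)" using sA sB subspace_inter by blast
  obtain C where C: "rel_basis (A \<inter> B) A C" using rel_basis_exists[OF A sAB] by blast
  have dA: "dim A = dim (A \<inter> B) + card C"
    using dim_rel_basis[OF fin_dim_subset[OF A sAB] sA _ C] by blast
  have sS: "subspace ?S" using sA sB by (rule subspace_sums)
  have BS: "B \<subseteq> ?S" using sA subspace_0 by force
  have AS: "A \<subseteq> ?S" using sB subspace_0 by force
  have CA: "(\<Sum>b\<in>C. c b *s b) \<in> A" for c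
    using C sA subspace_sum_scale[of A C c] unfolding rel_basis_def by blast
  have "rel_basis B ?S C"
    unfolding rel_basis_def
  proof (intro conjI allI ballI impI)
    show "C \<subseteq> ?S" "finite C" using C AS unfolding rel_basis_def by blast+
    fix c b assume "(\<Sum>b\<in>C. c b *s b) \<in> B" "b \<in> C"
    then show "c b = 0" using C CA unfolding rel_basis_def by blast
  next
    fix u assume "u \<in> ?S"
    then obtain x y where u: "u = x + y" "x \<in> A" "y \<in> B" by blast
    then obtain c where "x - (\<Sum>b\<in>C. c b *s b) \<in> A \<inter> B"
      using C unfolding rel_basis_def by blast
    then have "x - (\<Sum>b\<in>C. c b *s b) + y \<in> B" using u sB subspace_add by blast
    moreover have "x - (\<Sum>b\<in>C. c b *s b) + y = u - (\<Sum>b\<in>C. c b *s b)" using u by simp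
    ultimately show "\<exists>c. u - (\<Sum>b\<in>C. c b *s b) \<in> B" by metis
  qed
  then have "dim ?S = dim B + card C" using dim_rel_basis[OF B sS BS] by blast
  then show ?thesis using dA by simp
qed

text \<open>\<open>T\<close> induces an injection of \<open>V\<close> modulo the preimage of
  \<open>L\<close> into \<open>W\<close> modulo \<open>L\<close>. In the duality argument
  \<open>L\<close> has codimension one in \<open>W\<close>, so that each application costs at most
  one dimension.\<close>

lemma dim_preimage:
  assumes V: "fin_dim V" and T: "module_hom scale scale T" and W: "fin_dim W"
    and TV: "T ` V \<subseteq> W" and L: "subspace L" "L \<subseteq> W"
  shows "dim V + dim L \<le> dim {q \<in> V. T q \<in> L} + dim W"
proof -
  interpret T: module_hom scale scale T by (rule T)
  let ?V = "{q \<in> V. T q \<in> L}"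
  note sV = fin_dim_subspace[OF V] and sW = fin_dim_subspace[OF W]
  have fL: "fin_dim L" using fin_dim_subset[OF W L] .
  have s: "subspace ?V"
    using sV L(1) by (auto simp: subspace_def T.add T.scale T.zero)
  obtain C where C: "rel_basis ?V V C" using rel_basis_exists[OF V s] by blast
  then have CV: "C \<subseteq> V" "finite C" by (auto simp: rel_basis_def)
  have CC: "(\<Sum>b\<in>C. c b *s b) \<in> V" for c
    using subspace_sum_scale[OF sV CV(1)] .
  have ind: "\<forall>b\<in>C. c b = 0" if "T (\<Sum>b\<in>C. c b *s b) \<in> L" for c
    using C that CC unfolding rel_basis_def by blast
  \<comment> \<open>Sums are taken over the image of \<open>C\<close> as a set, so no two elements
    may merge. Coefficients 1 and -1 on a merged pair would give a relation modulo the preimage of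
    \<open>L\<close>.\<close>
  have inj: "inj_on T C"
  proof (rule inj_onI, rule ccontr)
    fix x y assume xy: "x \<in> C" "y \<in> C" "T x = T y" "x \<noteq> y"
    let ?c = "\<lambda>z. if z = x then 1 else if z = y then - 1 else 0"
    have "(\<Sum>b\<in>C. ?c b *s b) = (\<Sum>b\<in>C. (if b = x then x else 0) + (if b = y then - y else 0))"
      using xy by (intro sum.cong) auto
    also have "\<dots> = x - y" using xy CV by (simp add: sum.distrib)
    finally have "T (\<Sum>b\<in>C. ?c b *s b) = 0" using xy T.diff by simp
    then have "T (\<Sum>b\<in>C. ?c b *s b) \<in> L" using L(1) subspace_0 by simp
    from ind[OF this] xy show False by (metis zero_neq_one)
  qed
  let ?S = "{x + y | x y. x \<in> L \<and> y \<in> span (T ` C)}"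
  have sS: "subspace ?S" using L(1) subspace_span subspace_sums by blast
  have TCW: "span (T ` C) \<subseteq> W" using TV CV sW by (intro span_minimal) auto
  have SW: "?S \<subseteq> W" using L TCW sW subspace_add by blast
  have LS: "L \<subseteq> ?S" using span_zero by force
  have "rel_basis L ?S (T ` C)"
    unfolding rel_basis_def
  proof (intro conjI allI ballI impI)
    have "span (T ` C) \<subseteq> ?S" using L(1) subspace_0 by force
    then show "T ` C \<subseteq> ?S" using span_superset by blast
    show "finite (T ` C)" using CV by simp
    fix c b assume s: "(\<Sum>b\<in>T ` C. c b *s b) \<in> L" and b: "b \<in> T ` C"
    have "(\<Sum>b\<in>T ` C. c b *s b) = T (\<Sum>b\<in>C. c (T b) *s b)"
      by (simp add: sum.reindex[OF inj] T.sum T.scale)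
    then show "c b = 0" using ind[of "\<lambda>b. c (T b)"] s b by auto
  next
    fix u assume "u \<in> ?S"
    then obtain x y where u: "u = x + y" "x \<in> L" "y \<in> span (T ` C)" by blast
    then obtain c where "y = (\<Sum>b\<in>T ` C. c b *s b)"
      using span_finite[of "T ` C"] CV by auto
    then show "\<exists>c. u - (\<Sum>b\<in>T ` C. c b *s b) \<in> L" using u by (metis add_diff_cancel_right')
  qed
  then have "dim ?S = dim L + card (T ` C)" using dim_rel_basis[OF fL sS LS] by blast
  moreover have "dim ?S \<le> dim W" using dim_mono_fin[OF W sS SW] .
  moreover have "dim V = dim ?V + card C"
    using dim_rel_basis[OF fin_dim_subset[OF V s] sV _ C] by blast
  ultimately show ?thesis using card_image[OF inj] by simp
qed

lemma dim_inj_image: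
  assumes V: "fin_dim V" and T: "module_hom scale scale T" and inj: "\<And>x. T x = 0 \<Longrightarrow> x = 0"
  shows "fin_dim (T ` V)" "dim (T ` V) = dim V"
proof -
  interpret T: module_hom scale scale T by (rule T)
  obtain B where B: "B \<subseteq> V" "independent B" "finite B" "span B = V" "card B = dim V"
    using fin_dim_basis[OF V] .
  have sp: "span (T ` B) = T ` V" using B(4) T.span_image by metis
  have "subspace (T ` V)" using subspace_span[of "T ` B"] sp by simp
  moreover have "finite (T ` B)" using B(3) by simp
  ultimately show "fin_dim (T ` V)" using sp unfolding fin_dim_def by blast
  have injT: "inj_on T X" for X
  proof (rule inj_onI)
    fix x y assume "T x = T y"
    then have "T (x - y) = 0" by (simp add: T.diff)
    then show "x = y" using inj[of "x - y"] by simp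
  qed
  have "independent (T ` B)"
    using T.independent_injective_image[OF B(2) injT] .
  then have "dim (T ` V) = card (T ` B)" using dim_span_eq_card_independent[of "T ` B"] sp by simp
  then show "dim (T ` V) = dim V" using B(5) card_image[OF injT] by simp
qed

end

section \<open>Graded pieces of the polynomial ring\<close>

lemma UNIV_3: "(UNIV :: 3 set) = {0, 1, 2}"
proof -
  have "x = 0 \<or> x = 1 \<or> x = 2" for x :: 3
  proof (induct x)
    case (of_int z)
    then have "z = 0 \<or> z = 1 \<or> z = 2" by auto
    then show ?case by auto
  qed
  then show ?thesis by auto
qed

lemma sum_UNIV_3: "(\<Sum>i\<in>UNIV. h (i::3)) = h 0 + h 1 + h 2"
  unfolding UNIV_3 by (simp add: add.assoc)

lemma prod_UNIV_3: "(\<Prod>i\<in>UNIV. h (i::3)) = h 0 * h 1 * h 2"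
  unfolding UNIV_3 by (simp add: mult.assoc)

lemma poly_mapping_eq_sum:
  fixes p :: "'a \<Rightarrow>\<^sub>0 'b::comm_monoid_add"
  shows "p = (\<Sum>m\<in>Poly_Mapping.keys p. Poly_Mapping.single m (Poly_Mapping.lookup p m))"
  by (rule poly_mapping_eqI) (simp add: lookup_sum lookup_single when_def in_keys_iff)

lemma poly_mapping_add_induct [case_names zero single add]:
  fixes p :: "'a \<Rightarrow>\<^sub>0 'b::comm_monoid_add"
  assumes "P 0" "\<And>m c. P (Poly_Mapping.single m c)" "\<And>p q. P p \<Longrightarrow> P q \<Longrightarrow> P (p + q)"
  shows "P p"
proof -
  have "P (\<Sum>m\<in>A. Poly_Mapping.single m (Poly_Mapping.lookup p m))" if "finite A" for A
    using that by (induction A rule: finite_induct) (auto intro: assms)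
  then show ?thesis using poly_mapping_eq_sum[of p] by (metis finite_keys)
qed

section \<open>Constants, forms and homogeneous components\<close>

abbreviation const :: "complex \<Rightarrow> poly3" where
  "const \<equiv> Poly_Mapping.single 0"

lemma const_simps [simp]: "const 0 = 0" "const 1 = 1"
  by (simp_all add: single_one)

lemma const_add: "const (a + b) = const a + const b"
  by (simp add: single_add)

lemma const_mult: "const (a * b) = const a * const b"
  by (simp add: mult_single)

interpretation vs: fin_vector_space scal
  by unfold_locales (simp_all add: scal_def const_add const_mult algebra_simps)

lemma scal_mult: "scal c p * q = scal c (p * q)" "p * scal c q = scal c (p * q)"
  by (simp_all add: scal_def ac_simps)

lemma mult_hom: "module_hom scal scal (\<lambda>p. q * p)"
  by unfold_locales (simp_all add: scal_mult distrib_left)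

lemma mono_degree_add: "mono_degree (m + n) = mono_degree m + mono_degree n"
  by (simp add: mono_degree_def lookup_add sum.distrib)

lemma mono_degree_zero [simp]: "mono_degree 0 = 0"
  by (simp add: mono_degree_def)

lemma mono_degree_single [simp]: "mono_degree (Poly_Mapping.single i n) = n"
  by (simp add: mono_degree_def lookup_single when_def)

lemma homog_single: "int (mono_degree m) = k \<Longrightarrow> Poly_Mapping.single m c \<in> homog k"
  by (auto simp: homog_def)

lemma homog_zero [simp]: "0 \<in> homog k"
  by (simp add: homog_def)

lemma homog_add: "p \<in> homog k \<Longrightarrow> q \<in> homog k \<Longrightarrow> p + q \<in> homog k"
  using keys_add[of p q] by (auto simp: homog_def)

lemma homog_mult: "p \<in> homog j \<Longrightarrow> q \<in> homog k \<Longrightarrow> p * q \<in> homog (j + k)"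
  using keys_mult[of p q] by (fastforce simp: homog_def mono_degree_add)

lemma homog_const: "const c \<in> homog 0"
  by (rule homog_single) simp

lemma homog_scal: "p \<in> homog k \<Longrightarrow> scal c p \<in> homog k"
  using homog_mult[OF homog_const, of p k c] by (simp add: scal_def)

lemma subspace_homog: "vs.subspace (homog k)"
  by (auto simp: vs.subspace_def homog_add homog_scal)

lemma homog_uminus: "p \<in> homog k \<Longrightarrow> - p \<in> homog k"
  using vs.subspace_neg[OF subspace_homog] .

lemma homog_diff: "p \<in> homog k \<Longrightarrow> q \<in> homog k \<Longrightarrow> p - q \<in> homog k"
  using vs.subspace_diff[OF subspace_homog] .

lemma homog_neg: "k < 0 \<Longrightarrow> homog k = {0}"
  by (auto simp: homog_def)

lemma homog_negD: "p \<in> homog k \<Longrightarrow> k < 0 \<Longrightarrow> p = 0"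
  using homog_neg by blast

lemma homog_var: "var i \<in> homog 1"
  unfolding var_def by (rule homog_single) simp

definition hcomp :: "int \<Rightarrow> poly3 \<Rightarrow> poly3" where
  "hcomp k p = (\<Sum>m\<in>Poly_Mapping.keys p.
     Poly_Mapping.single m (if int (mono_degree m) = k then Poly_Mapping.lookup p m else 0))"

lemma lookup_hcomp:
  "Poly_Mapping.lookup (hcomp k p) m = (if int (mono_degree m) = k then Poly_Mapping.lookup p m else 0)"
  by (simp add: hcomp_def lookup_sum lookup_single when_def in_keys_iff)

lemma hcomp_in_homog: "hcomp k p \<in> homog k"
  by (auto simp: homog_def in_keys_iff lookup_hcomp split: if_splits)

lemma hcomp_add: "hcomp k (p + q) = hcomp k p + hcomp k q"
  by (rule poly_mapping_eqI) (simp add: lookup_hcomp lookup_add)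

lemma hcomp_zero [simp]: "hcomp k 0 = 0"
  by (rule poly_mapping_eqI) (simp add: lookup_hcomp)

lemma hcomp_homog: "p \<in> homog j \<Longrightarrow> hcomp k p = (if j = k then p else 0)"
  by (rule poly_mapping_eqI) (auto simp: lookup_hcomp homog_def in_keys_iff)

text \<open>Both sides are additive in \<open>a\<close>, which may thus be taken to be a monomial.
  This is the device by which coefficients of ideal members are made homogeneous.\<close>

lemma hcomp_mult:
  assumes f: "f \<in> homog e"
  shows "hcomp k (a * f) = hcomp (k - e) a * f"
proof (induction a rule: poly_mapping_add_induct)
  case (single m c)
  have "Poly_Mapping.single m c * f \<in> homog (int (mono_degree m) + e)"
    using homog_mult homog_single f by blast
  moreover have "Poly_Mapping.single m c \<in> homog (int (mono_degree m))"
    by (simp add: homog_single)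
  ultimately show ?case by (auto simp: hcomp_homog)
qed (simp_all add: hcomp_add distrib_right)

text \<open>Every monomial of positive degree is divisible by one of the variables.\<close>

lemma homog_Suc_decomp:
  assumes p: "p \<in> homog (k + 1)" and k: "k \<ge> 0"
  shows "\<exists>a b c. a \<in> homog k \<and> b \<in> homog k \<and> c \<in> homog k \<and> p = var 0 * a + var 1 * b + var 2 * c"
proof -
  have mono: "\<exists>a b c. a \<in> homog k \<and> b \<in> homog k \<and> c \<in> homog k \<and>
      Poly_Mapping.single m z = var 0 * a + var 1 * b + var 2 * c"
    if m: "int (mono_degree m) = k + 1" for m z
  proof -
    have "\<exists>i. Poly_Mapping.lookup m i > 0"
    proof (rule ccontr)
      assume "\<not> ?thesis"
      then have "mono_degree m = 0" by (simp add: mono_degree_def)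
      then show False using m k by simp
    qed
    then obtain i where i: "Poly_Mapping.lookup m i > 0" by blast
    define n where "n = m - Poly_Mapping.single i 1"
    have mn: "m = Poly_Mapping.single i 1 + n"
      using i by (intro poly_mapping_eqI) (auto simp: n_def lookup_add lookup_minus lookup_single when_def)
    then have "mono_degree m = 1 + mono_degree n" by (simp add: mono_degree_add)
    then have h: "Poly_Mapping.single n z \<in> homog k" using m by (intro homog_single) simp
    have e: "Poly_Mapping.single m z = var i * Poly_Mapping.single n z"
      by (simp add: var_def mult_single mn)
    have "i = 0 \<or> i = 1 \<or> i = 2" using UNIV_3 by blast
    then consider "i = 0" | "i = 1" | "i = 2" by blast
    then show ?thesis
    proof cases
      case 1
      then show ?thesis using e h by (intro exI[of _ "Poly_Mapping.single n z"] exI[of _ 0]) auto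
    next
      case 2
      then show ?thesis using e h
        by (intro exI[of _ 0] exI[of _ "Poly_Mapping.single n z"] conjI) auto
    next
      case 3
      then show ?thesis using e h
        by (intro exI[of _ 0] exI[of _ "Poly_Mapping.single n z"] conjI) auto
    qed
  qed
  let ?g = "\<lambda>m. Poly_Mapping.single m (Poly_Mapping.lookup p m)"
  have "\<exists>a b c. a \<in> homog k \<and> b \<in> homog k \<and> c \<in> homog k \<and>
      (\<Sum>m\<in>A. ?g m) = var 0 * a + var 1 * b + var 2 * c"
    if "finite A" "A \<subseteq> Poly_Mapping.keys p" for A
    using that
  proof (induction A rule: finite_induct)
    case empty
    show ?case by (intro exI[of _ 0]) simp
  next
    case (insert m A)
    have "int (mono_degree m) = k + 1" using p insert.prems by (auto simp: homog_def)
    from mono[OF this, of "Poly_Mapping.lookup p m"] obtain a b c where 1: "a \<in> homog k" "b \<in> homog k" "c \<in> homog k"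
      "?g m = var 0 * a + var 1 * b + var 2 * c" by blast
    obtain a' b' c' where 2: "a' \<in> homog k" "b' \<in> homog k" "c' \<in> homog k"
      "(\<Sum>m\<in>A. ?g m) = var 0 * a' + var 1 * b' + var 2 * c'" using insert by auto
    show ?case using 1 2 insert
      by (intro exI[of _ "a + a'"] exI[of _ "b + b'"] exI[of _ "c + c'"])
        (simp add: homog_add algebra_simps)
  qed
  from this[of "Poly_Mapping.keys p"] show ?thesis using poly_mapping_eq_sum[of p] by simp
qed

section \<open>Hilbert function of the polynomial ring\<close>

definition hdim :: "int \<Rightarrow> int" where
  "hdim k = (if k < 0 then 0 else (k + 1) * (k + 2) div 2)"

text \<open>At -1 and -2 the product vanishes, so the polynomial formula extends to these two
  negative degrees and no further. Doubling keeps integer division out of later arithmetic.\<close>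

lemma two_hdim: "k \<ge> -2 \<Longrightarrow> 2 * hdim k = (k + 1) * (k + 2)"
proof -
  assume "k \<ge> -2"
  have "even ((k + 1) * (k + 2))" by simp
  moreover have "k = -2 \<or> k = -1" if "k < 0" using that \<open>k \<ge> -2\<close> by auto
  ultimately show ?thesis by (auto simp: hdim_def)
qed

text \<open>The first two exponents determine the third, so pairs with sum at most \<open>k\<close>
  are counted.\<close>

lemma card_monomials: "card {m::mono3. mono_degree m = k} = (k + 1) * (k + 2) div 2"
proof -
  define g :: "nat \<times> nat \<Rightarrow> mono3" where
    "g = (\<lambda>(a, b). Poly_Mapping.single 0 a + Poly_Mapping.single 1 b + Poly_Mapping.single 2 (k - a - b))"
  have lk: "Poly_Mapping.lookup (g (a, b)) 0 = a" "Poly_Mapping.lookup (g (a, b)) 1 = b"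
    "Poly_Mapping.lookup (g (a, b)) 2 = k - a - b" for a b
    by (simp_all add: g_def lookup_add lookup_single when_def)
  have "bij_betw g (Sigma {..k} (\<lambda>a. {..k - a})) {m. mono_degree m = k}"
  proof (rule bij_betw_byWitness[where f' = "\<lambda>m. (Poly_Mapping.lookup m 0, Poly_Mapping.lookup m 1)"])
    show "\<forall>a\<in>Sigma {..k} (\<lambda>a. {..k - a}). (Poly_Mapping.lookup (g a) 0, Poly_Mapping.lookup (g a) 1) = a"
      by (auto simp: lk simp del: One_nat_def)
    show "\<forall>m\<in>{m. mono_degree m = k}. g (Poly_Mapping.lookup m 0, Poly_Mapping.lookup m 1) = m"
    proof
      fix m :: mono3 assume "m \<in> {m. mono_degree m = k}"
      then have d: "Poly_Mapping.lookup m 0 + Poly_Mapping.lookup m 1 + Poly_Mapping.lookup m 2 = k"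
        by (simp add: mono_degree_def sum_UNIV_3)
      show "g (Poly_Mapping.lookup m 0, Poly_Mapping.lookup m 1) = m"
      proof (rule poly_mapping_eqI)
        fix i :: 3
        have "i = 0 \<or> i = 1 \<or> i = 2" using UNIV_3 by blast
        then show "Poly_Mapping.lookup (g (Poly_Mapping.lookup m 0, Poly_Mapping.lookup m 1)) i = Poly_Mapping.lookup m i"
          using d by (auto simp: lk)
      qed
    qed
    show "g ` Sigma {..k} (\<lambda>a. {..k - a}) \<subseteq> {m. mono_degree m = k}"
      by (auto simp: mono_degree_def sum_UNIV_3 lk)
    show "(\<lambda>m. (Poly_Mapping.lookup m 0, Poly_Mapping.lookup m 1)) ` {m. mono_degree m = k} \<subseteq> Sigma {..k} (\<lambda>a. {..k - a})"
      by (auto simp: mono_degree_def sum_UNIV_3)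
  qed
  then have "card {m::mono3. mono_degree m = k} = card (Sigma {..k} (\<lambda>a. {..k - a}))"
    using bij_betw_same_card by metis
  also have "\<dots> = (\<Sum>a\<le>k. Suc (k - a))" by simp
  also have "\<dots> = (\<Sum>a\<le>k. Suc a)"
    by (rule sum.reindex_bij_witness[of _ "\<lambda>i. k - i" "\<lambda>i. k - i"]) auto
  also have "\<dots> = (k + 1) * (k + 2) div 2" by (induction k) auto
  finally show ?thesis .
qed

lemma fin_dim_homog: "vs.fin_dim (homog k)" and dim_homog: "int (vs.dim (homog k)) = hdim k"
proof -
  have "vs.fin_dim (homog k) \<and> int (vs.dim (homog k)) = hdim k"
  proof (cases "k < 0")
    case True
    have "vs.dim {0} = 0" using vs.dim_span_eq_card_independent[of "{}"] vs.independent_empty by simp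
    moreover have "vs.fin_dim {0}" unfolding vs.fin_dim_def by (auto intro: exI[of _ "{0}"] vs.span_base)
    ultimately show ?thesis using True homog_neg by (simp add: hdim_def)
  next
    case False
    define n where "n = nat k"
    have k: "k = int n" using False n_def by simp
    let ?M = "{m::mono3. mono_degree m = n}"
    let ?B = "(\<lambda>m. Poly_Mapping.single m (1::complex)) ` ?M"
    \<comment> \<open>Infinite sets have cardinality 0, so the positive count proves
      finiteness.\<close>
    have fM: "finite ?M"
      using card_monomials[of n] by (intro card_ge_0_finite) (simp, linarith?)
    have inj: "inj_on (\<lambda>m. Poly_Mapping.single m (1::complex)) ?M"
      by (auto simp: inj_on_def) (metis keys_single singleton_inject zero_neq_one)
    have sp: "homog k \<subseteq> vs.span ?B"
    proof
      fix p assume p: "p \<in> homog k"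
      have "(\<Sum>m\<in>Poly_Mapping.keys p. scal (Poly_Mapping.lookup p m) (Poly_Mapping.single m 1)) \<in> vs.span ?B"
        using p k by (intro vs.span_sum vs.span_scale vs.span_base) (auto simp: homog_def)
      then show "p \<in> vs.span ?B"
        using poly_mapping_eq_sum[of p] by (simp add: scal_def mult_single)
    qed
    have BH: "?B \<subseteq> homog k" using k by (auto intro: homog_single)
    have ind: "vs.independent ?B"
    proof (rule vs.independent_if_scalars_zero)
      show "finite ?B" using fM by simp
      fix c x assume s: "(\<Sum>x\<in>?B. scal (c x) x) = 0" and "x \<in> ?B"
      then obtain m where m: "m \<in> ?M" "x = Poly_Mapping.single m 1" by blast
      have "0 = Poly_Mapping.lookup (\<Sum>x\<in>?B. scal (c x) x) m" using s by simp
      also have "\<dots> = (\<Sum>n\<in>?M. Poly_Mapping.lookup (scal (c (Poly_Mapping.single n 1)) (Poly_Mapping.single n 1)) m)"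
        by (simp add: sum.reindex[OF inj] lookup_sum)
      also have "\<dots> = (\<Sum>n\<in>?M. if n = m then c (Poly_Mapping.single n 1) else 0)"
        by (intro sum.cong) (auto simp: scal_def mult_single lookup_single when_def)
      also have "\<dots> = c x" using m fM by simp
      finally show "c x = 0" by simp
    qed
    have "vs.dim (homog k) = card ?B"
      using vs.basis_card_eq_dim[OF BH sp ind] by simp
    also have "\<dots> = (n + 1) * (n + 2) div 2" using card_image[OF inj] card_monomials by simp
    finally have "int (vs.dim (homog k)) = hdim k"
      using k by (simp add: hdim_def zdiv_int algebra_simps)
    moreover have "vs.fin_dim (homog k)"
      using sp fM subspace_homog unfolding vs.fin_dim_def by blast
    ultimately show ?thesis by simp
  qed
  then show "vs.fin_dim (homog k)" "int (vs.dim (homog k)) = hdim k" by simp_all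
qed

section \<open>Ideals and their Hilbert functions\<close>

definition is_ideal :: "poly3 set \<Rightarrow> bool" where
  "is_ideal X \<longleftrightarrow> 0 \<in> X \<and> (\<forall>p\<in>X. \<forall>q\<in>X. p + q \<in> X) \<and> (\<forall>p\<in>X. \<forall>a. a * p \<in> X)"

lemma is_idealI:
  assumes "0 \<in> X" "\<And>p q. p \<in> X \<Longrightarrow> q \<in> X \<Longrightarrow> p + q \<in> X" "\<And>a p. p \<in> X \<Longrightarrow> a * p \<in> X"
  shows "is_ideal X"
  using assms by (auto simp: is_ideal_def)

lemma ideal_zero: "is_ideal X \<Longrightarrow> 0 \<in> X"
  and ideal_add: "is_ideal X \<Longrightarrow> p \<in> X \<Longrightarrow> q \<in> X \<Longrightarrow> p + q \<in> X"
  and ideal_mult: "is_ideal X \<Longrightarrow> p \<in> X \<Longrightarrow> a * p \<in> X"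
  by (auto simp: is_ideal_def)

lemma ideal_mult2: "is_ideal X \<Longrightarrow> p \<in> X \<Longrightarrow> p * a \<in> X"
  using ideal_mult[of X p a] by (simp add: mult.commute)

lemma ideal_uminus: "is_ideal X \<Longrightarrow> p \<in> X \<Longrightarrow> - p \<in> X"
  using ideal_mult[of X p "- 1"] by simp

lemma ideal_diff: "is_ideal X \<Longrightarrow> p \<in> X \<Longrightarrow> q \<in> X \<Longrightarrow> p - q \<in> X"
  using ideal_add[of X p "- q"] ideal_uminus[of X q] by simp

lemma ideal_sum: "is_ideal X \<Longrightarrow> (\<And>i. i \<in> A \<Longrightarrow> g i \<in> X) \<Longrightarrow> sum g A \<in> X"
  by (induction A rule: infinite_finite_induct) (auto intro: ideal_add ideal_zero)

lemma subspace_ideal: "is_ideal X \<Longrightarrow> vs.subspace X"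
  by (auto simp: vs.subspace_def ideal_zero ideal_add ideal_mult scal_def)

lemma fin_dim_ideal: "is_ideal X \<Longrightarrow> vs.fin_dim (X \<inter> homog j)"
  using vs.fin_dim_subset[OF fin_dim_homog[of j]] vs.subspace_inter[OF subspace_ideal subspace_homog] by blast

text \<open>Products of forms of degrees \<open>i\<close> and \<open>j\<close> additively generate
  the forms of degree \<open>i + j\<close>. One variable is split off at a time, so \<open>Q\<close>
  must vary: the induction hypothesis is used for the set of all \<open>x\<close> with
  \<open>var n * x\<close> in \<open>Q\<close>.\<close>

lemma homog_add_induct:
  assumes p: "p \<in> homog (int i + j)" and j: "j \<ge> 0"
    and Q: "\<And>q q'. q \<in> homog (int i) \<Longrightarrow> q' \<in> homog j \<Longrightarrow> q * q' \<in> Q"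
    and add: "\<And>x y. x \<in> Q \<Longrightarrow> y \<in> Q \<Longrightarrow> x + y \<in> Q"
  shows "p \<in> Q"
  using p Q add
proof (induction i arbitrary: p Q)
  case 0
  have "1 * p \<in> Q" using 0 homog_const[of 1] by (intro 0(2)) simp_all
  then show ?case by simp
next
  case (Suc i)
  obtain a b c where abc: "a \<in> homog (int i + j)" "b \<in> homog (int i + j)" "c \<in> homog (int i + j)"
    "p = var 0 * a + var 1 * b + var 2 * c"
    using homog_Suc_decomp[of p "int i + j"] Suc.prems(1) j by (auto simp: algebra_simps)
  have *: "x \<in> {x. var n * x \<in> Q}" if "x \<in> homog (int i + j)" for x n
  proof (rule Suc.IH[OF that])
    fix q q' assume q: "q \<in> homog (int i)" "q' \<in> homog j"
    have "var n * q \<in> homog (int (Suc i))" using homog_mult[OF homog_var q(1)] by simp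
    then have "(var n * q) * q' \<in> Q" using Suc.prems(2) q by blast
    then show "q * q' \<in> {x. var n * x \<in> Q}" by (simp add: mult.assoc)
  qed (use Suc.prems(3) in \<open>auto simp: distrib_left\<close>)
  show ?case using abc * Suc.prems(3) by auto
qed

text \<open>The Hilbert function of the quotient by \<open>X\<close>, taken as an integer so that
  differences can be formed freely.\<close>

definition codim :: "poly3 set \<Rightarrow> int \<Rightarrow> int" where
  "codim X j = hdim j - int (vs.dim (X \<inter> homog j))"

lemma codim_nonneg: "is_ideal X \<Longrightarrow> codim X j \<ge> 0"
  using vs.dim_mono_fin[OF fin_dim_homog[of j], of "X \<inter> homog j"] fin_dim_ideal[of X j]
    dim_homog[of j] vs.fin_dim_subspace by (force simp: codim_def)

lemma codim_eq_imp:
  assumes "is_ideal X" "is_ideal Y" "X \<inter> homog j \<subseteq> Y" "codim X j \<le> codim Y j"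
  shows "X \<inter> homog j = Y \<inter> homog j"
  by (rule vs.dim_eq_imp_eq)
    (use assms vs.fin_dim_subspace[OF fin_dim_ideal[OF assms(1), of j]] fin_dim_ideal[OF assms(2), of j]
      in \<open>auto simp: codim_def\<close>)

lemma codim_0_imp: "is_ideal X \<Longrightarrow> codim X j \<le> 0 \<Longrightarrow> homog j \<subseteq> X"
  using vs.dim_eq_imp_eq[OF fin_dim_homog[of j], of "X \<inter> homog j"]
    vs.fin_dim_subspace[OF fin_dim_ideal[of X j]] dim_homog[of j] by (auto simp: codim_def)

lemma dim_image_mult:
  assumes "vs.fin_dim V" "(q::poly3) \<noteq> 0"
  shows "vs.fin_dim ((*) q ` V)" "vs.dim ((*) q ` V) = vs.dim V"
  using vs.dim_inj_image[OF assms(1) mult_hom[of q]] assms(2) by auto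

text \<open>The sum of \<open>X\<close> and the principal ideal of \<open>q\<close>. Iterated from
  \<open>{0}\<close> it gives ideals with two or three generators in explicit form.\<close>

definition ideal2 :: "poly3 set \<Rightarrow> poly3 \<Rightarrow> poly3 set" where
  "ideal2 X q = {x + q * a | x a. x \<in> X}"

lemma is_ideal_ideal2:
  assumes X: "is_ideal X" shows "is_ideal (ideal2 X q)"
proof (rule is_idealI)
  show "0 \<in> ideal2 X q" using ideal_zero[OF X] by (force simp: ideal2_def)
  fix p p' assume "p \<in> ideal2 X q" "p' \<in> ideal2 X q"
  then obtain x a x' a' where "p = x + q * a" "x \<in> X" "p' = x' + q * a'" "x' \<in> X"
    by (auto simp: ideal2_def)
  then have "p + p' = (x + x') + q * (a + a')" "x + x' \<in> X"
    using ideal_add[OF X] by (auto simp: algebra_simps)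
  then show "p + p' \<in> ideal2 X q" by (auto simp: ideal2_def)
next
  fix b p assume "p \<in> ideal2 X q"
  then obtain x a where "p = x + q * a" "x \<in> X" by (auto simp: ideal2_def)
  then have "b * p = b * x + q * (b * a)" "b * x \<in> X"
    by (simp add: algebra_simps, simp add: ideal_mult[OF X])
  then show "b * p \<in> ideal2 X q" by (auto simp: ideal2_def)
qed

lemma ideal2_superset: "X \<subseteq> ideal2 X q"
proof
  fix x assume "x \<in> X"
  then have "x + q * 0 \<in> ideal2 X q" unfolding ideal2_def by blast
  then show "x \<in> ideal2 X q" by simp
qed

lemma ideal2_self: "is_ideal X \<Longrightarrow> q * a \<in> ideal2 X q"
  using ideal_zero[of X] unfolding ideal2_def by (metis (mono_tags, lifting) add_0 mem_Collect_eq)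

definition graded :: "poly3 set \<Rightarrow> bool" where
  "graded X \<longleftrightarrow> (\<forall>p\<in>X. \<forall>k. hcomp k p \<in> X)"

lemma graded_ideal2: "graded X \<Longrightarrow> q \<in> homog i \<Longrightarrow> graded (ideal2 X q)"
  unfolding graded_def ideal2_def
  by (auto simp: hcomp_add hcomp_mult mult.commute[of q]) (metis hcomp_mult)

lemma ideal2_homog:
  assumes X: "graded X" "is_ideal X" and q: "q \<in> homog i"
  shows "ideal2 X q \<inter> homog j = {x + y | x y. x \<in> X \<inter> homog j \<and> y \<in> (*) q ` homog (j - i)}"
    (is "?L = ?R")
proof
  show "?L \<subseteq> ?R"
  proof
    fix p assume p: "p \<in> ?L"
    then obtain x a where "p = x + q * a" "x \<in> X" by (auto simp: ideal2_def)
    moreover have "p = hcomp j p" using p hcomp_homog[of p j j] by simp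
    ultimately have "p = hcomp j x + q * hcomp (j - i) a"
      using hcomp_mult[OF q, of j a] by (simp add: hcomp_add mult.commute)
    moreover have "hcomp j x \<in> X \<inter> homog j" using X \<open>x \<in> X\<close> hcomp_in_homog by (auto simp: graded_def)
    ultimately show "p \<in> ?R" using hcomp_in_homog by blast
  qed
  show "?R \<subseteq> ?L" using homog_mult[OF q, of _ "j - i"] by (auto simp: ideal2_def intro!: homog_add)
qed

text \<open>Multiplication by \<open>q\<close> embeds the quotient by the colon ideal, shifted by
  \<open>i\<close>, into the quotient by \<open>X\<close>, and the cokernel is the quotient by
  \<open>ideal2 X q\<close>. In terms of dimensions this is the formula for a sum of two
  subspaces.\<close>

lemma codim_ideal2:
  assumes X: "graded X" "is_ideal X" and q: "q \<in> homog i" "q \<noteq> 0"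
  shows "codim (ideal2 X q) j = codim X j - codim {p. q * p \<in> X} (j - i)"
proof -
  let ?A = "X \<inter> homog j" and ?B = "(*) q ` homog (j - i)"
  have int: "?A \<inter> ?B = (*) q ` ({p. q * p \<in> X} \<inter> homog (j - i))"
    using homog_mult[OF q(1), of _ "j - i"] by auto
  have Y: "is_ideal {p. q * p \<in> X}"
    using X(2) ideal_add[OF X(2)] ideal_mult[OF X(2)] ideal_zero[OF X(2)]
    by (intro is_idealI) (auto simp: distrib_left mult.left_commute)
  have "vs.dim (ideal2 X q \<inter> homog j) + vs.dim (?A \<inter> ?B) = vs.dim ?A + vs.dim ?B"
    using vs.dim_sum_int[OF fin_dim_ideal[OF X(2), of j] dim_image_mult(1)[OF fin_dim_homog[of "j - i"] q(2)]]
      ideal2_homog[OF X q(1)] by simp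
  moreover have "vs.dim ?B = vs.dim (homog (j - i))"
    using dim_image_mult(2)[OF fin_dim_homog q(2)] .
  moreover have "vs.dim (?A \<inter> ?B) = vs.dim ({p. q * p \<in> X} \<inter> homog (j - i))"
    using dim_image_mult(2)[OF fin_dim_ideal[OF Y] q(2)] int by simp
  ultimately show ?thesis using dim_homog[of "j - i"] by (simp add: codim_def)
qed

lemma is_ideal_colon: "is_ideal X \<Longrightarrow> is_ideal {p. q * p \<in> X}"
  using ideal_add ideal_mult ideal_zero
  by (intro is_idealI) (auto simp: distrib_left mult.left_commute)

lemma graded_colon:
  assumes X: "graded X" and q: "q \<in> homog i" shows "graded {p. q * p \<in> X}"
proof -
  have "q * hcomp k p \<in> X" if "q * p \<in> X" for p k
  proof -
    have "hcomp (k + i) (p * q) = hcomp k p * q" using hcomp_mult[OF q, of "k + i" p] by simp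
    then show ?thesis using X that by (metis graded_def mult.commute)
  qed
  then show ?thesis by (simp add: graded_def)
qed

lemma ideal_zero_set: "is_ideal {0}" "graded {0}"
  by (auto simp: is_ideal_def graded_def)

lemma dim_singleton_0: "vs.dim {0} = 0"
  using vs.dim_span_eq_card_independent[of "{}"] vs.independent_empty by simp

lemma codim_zero_set: "codim {0} j = hdim j"
proof -
  have "{0} \<inter> homog j = {0}" by auto
  then show ?thesis by (simp add: codim_def dim_singleton_0)
qed

section \<open>Three plane forms and Koszul relations\<close>

text \<open>Tests against the forms of one degree \<open>k\<close> instead of a power of the maximal
  ideal; for ideals the two notions agree by \<open>saturation_eq_sat\<close>.\<close>

definition sat :: "poly3 set \<Rightarrow> poly3 set" where
  "sat X = {p. \<exists>k. \<forall>q\<in>homog (int k). q * p \<in> X}"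

text \<open>A form of degree \<open>j\<close> is a sum of products with a factor of degree
  \<open>k\<close>, so a test passed in degree \<open>k\<close> is passed in all higher
  degrees.\<close>

lemma ideal_homog_mult:
  assumes X: "is_ideal X" and q: "\<forall>q\<in>homog (int k). q * p \<in> X" and "q \<in> homog j" "j \<ge> int k"
  shows "q * p \<in> X"
proof -
  have "q \<in> {q. q * p \<in> X}"
  proof (rule homog_add_induct)
    show "q \<in> homog (int k + (j - int k))" "j - int k \<ge> 0" using assms by simp_all
  next
    fix a b assume "a \<in> homog (int k)" "b \<in> homog (j - int k)"
    then have "b * (a * p) \<in> X" using q ideal_mult[OF X] by blast
    then show "a * b \<in> {q. q * p \<in> X}" by (simp add: ac_simps)
  qed (use ideal_add[OF X] in \<open>auto simp: distrib_right\<close>)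
  then show ?thesis by simp
qed

lemma is_ideal_sat:
  assumes X: "is_ideal X" shows "is_ideal (sat X)"
proof (rule is_idealI)
  show "0 \<in> sat X" using ideal_zero[OF X] by (simp add: sat_def)
  fix p p' assume "p \<in> sat X" "p' \<in> sat X"
  then obtain k k' where k: "\<forall>q\<in>homog (int k). q * p \<in> X" "\<forall>q\<in>homog (int k'). q * p' \<in> X"
    by (auto simp: sat_def)
  have "q * (p + p') \<in> X" if "q \<in> homog (int (max k k'))" for q
    using ideal_homog_mult[OF X k(1) that] ideal_homog_mult[OF X k(2) that] ideal_add[OF X]
    by (simp add: distrib_left)
  then show "p + p' \<in> sat X" unfolding sat_def by blast
next
  fix a p assume "p \<in> sat X"
  then show "a * p \<in> sat X"
    using ideal_mult[OF X] unfolding sat_def by (fastforce simp: mult.left_commute)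
qed

lemma sat_superset: "is_ideal X \<Longrightarrow> X \<subseteq> sat X"
  using ideal_mult unfolding sat_def by blast

lemma graded_sat: assumes "graded X" shows "graded (sat X)"
  unfolding graded_def
proof (intro ballI allI)
  fix p i assume "p \<in> sat X"
  then obtain k where k: "\<forall>q\<in>homog (int k). q * p \<in> X" by (auto simp: sat_def)
  have "q * hcomp i p \<in> X" if q: "q \<in> homog (int k)" for q
  proof -
    have "hcomp (i + int k) (p * q) = hcomp i p * q" using hcomp_mult[OF q, of "i + int k" p] by simp
    moreover have "p * q \<in> X" using bspec[OF k q] by (subst mult.commute)
    ultimately show ?thesis using assms by (metis graded_def mult.commute)
  qed
  then show "hcomp i p \<in> sat X" unfolding sat_def by blast
qed

text \<open>\<open>j0\<close> is a point where the gap to the bound \<open>c\<close> is smallest;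
  monotonicity keeps the function constant from there on.\<close>

lemma int_mono_bounded_eventually_const:
  fixes h :: "int \<Rightarrow> int"
  assumes mono: "\<And>j. h j \<le> h (j + 1)" and bd: "\<And>j. h j \<le> c"
  obtains b j0 where "\<And>j. j \<ge> j0 \<Longrightarrow> h j = b" "\<And>j. h j \<le> b"
proof -
  have le: "h i \<le> h j" if "i \<le> j" for i j
    using that by (induction j rule: int_ge_induct) (auto intro: order_trans[OF _ mono])
  define n where "n = (LEAST n. \<exists>j. nat (c - h j) = n)"
  have "\<exists>j. nat (c - h j) = n" unfolding n_def by (rule LeastI_ex) blast
  then obtain j0 where j0: "nat (c - h j0) = n" by blast
  have n: "n \<le> nat (c - h j)" for j unfolding n_def by (rule Least_le) blast
  have b: "h j \<le> h j0" for j using n[of j] j0 bd[of j] bd[of j0] by linarith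
  show thesis
  proof
    show "h j = h j0" if "j \<ge> j0" for j using b[of j] le[OF that] by linarith
    show "h j \<le> h j0" for j by (rule b)
  qed
qed

lemma in_ideal1: "p \<in> ideal2 {0} a \<longleftrightarrow> (\<exists>x. p = a * x)"
  by (simp add: ideal2_def)

lemma in_ideal2: "p \<in> ideal2 (ideal2 {0} a) b \<longleftrightarrow> (\<exists>x y. p = a * x + b * y)"
  unfolding ideal2_def[of _ b] by (auto simp: in_ideal1)

lemma in_ideal3: "p \<in> ideal2 (ideal2 (ideal2 {0} a) b) c \<longleftrightarrow> (\<exists>x y z. p = a * x + b * y + c * z)"
  unfolding ideal2_def[of _ c] using in_ideal2 by fastforce

text \<open>
  The linear forms \<open>l\<close>, \<open>u\<close>, \<open>v\<close> are coordinates of the plane, and \<open>l = u = 0\<close> is a point at which \<open>g1\<close>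
  does not vanish. With a power of \<open>u\<close> in the ideal \<open>(g1, g2, l)\<close> this makes \<open>l\<close>, \<open>g1\<close>, \<open>g2\<close> a regular
  sequence.
\<close>

locale three_forms =
  fixes g1 g2 g3 l u v :: poly3 and e r :: int
  assumes e1: "e \<ge> 1" and re: "r \<le> e" and er: "e + 1 \<le> 2 * r"
    and g: "g1 \<in> homog e" "g2 \<in> homog e" "g3 \<in> homog e"
    and luv: "l \<in> homog 1" "u \<in> homog 1" "v \<in> homog 1"
    and decomp: "\<And>p k. p \<in> homog (k + 1) \<Longrightarrow> k \<ge> 0 \<Longrightarrow>
      \<exists>a b c. a \<in> homog k \<and> b \<in> homog k \<and> c \<in> homog k \<and> p = l * a + u * b + v * c"
    and l0: "l \<noteq> 0"
    and prime_l: "\<And>a b. l dvd a * b \<Longrightarrow> l dvd a \<or> l dvd b"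
    and prime_lu: "\<And>a b. a * b \<in> ideal2 (ideal2 {0} l) u \<Longrightarrow>
      a \<in> ideal2 (ideal2 {0} l) u \<or> b \<in> ideal2 (ideal2 {0} l) u"
    and l_u: "\<not> l dvd u"
    and v_lu: "v \<notin> ideal2 (ideal2 {0} l) u"
    and g1_lu: "g1 \<notin> ideal2 (ideal2 {0} l) u"
    and base: "\<And>p. p \<in> homog e \<Longrightarrow> \<exists>c. p - scal c g1 \<in> ideal2 (ideal2 {0} l) u"
    and bez: "\<exists>N. u ^ N \<in> ideal2 (ideal2 (ideal2 {0} g1) g2) l"
    and syz: "\<And>a b c k. a \<in> homog k \<Longrightarrow> b \<in> homog k \<Longrightarrow> c \<in> homog k \<Longrightarrow> k < r \<Longrightarrow>
      a * g1 + b * g2 + c * g3 = 0 \<Longrightarrow> a = 0 \<and> b = 0 \<and> c = 0"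
begin

text \<open>\<open>L\<close> is the ideal whose quotient is the Gorenstein algebra \<open>A\<close>,
  and \<open>lu\<close> is the prime ideal of the point \<open>l = u = 0\<close>.\<close>

definition "K0 = ideal2 {0} g1"
definition "K = ideal2 K0 g2"
definition "J = ideal2 K g3"
definition "L = ideal2 K l"
definition "I = {c. g3 * c \<in> K}"
definition "S = sat J"
definition "lu = ideal2 (ideal2 {0} l) u"

lemma in_K0: "p \<in> K0 \<longleftrightarrow> (\<exists>a. p = g1 * a)"
  by (simp add: K0_def in_ideal1)

lemma in_K: "p \<in> K \<longleftrightarrow> (\<exists>a b. p = g1 * a + g2 * b)"
  by (simp add: K_def K0_def in_ideal2)

lemma in_J: "p \<in> J \<longleftrightarrow> (\<exists>a b c. p = g1 * a + g2 * b + g3 * c)"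
  by (simp add: J_def K_def K0_def in_ideal3)

lemma in_L: "p \<in> L \<longleftrightarrow> (\<exists>a b c. p = g1 * a + g2 * b + l * c)"
  by (simp add: L_def K_def K0_def in_ideal3)

lemma in_lu: "p \<in> lu \<longleftrightarrow> (\<exists>a b. p = l * a + u * b)"
  by (simp add: lu_def in_ideal2)

lemma is_ideal: "is_ideal K0" "is_ideal K" "is_ideal J" "is_ideal L" "is_ideal I" "is_ideal S" "is_ideal lu"
  unfolding K0_def K_def J_def L_def I_def S_def lu_def
  by (intro is_ideal_ideal2 is_ideal_colon is_ideal_sat ideal_zero_set)+

lemma graded: "graded K0" "graded K" "graded J" "graded L" "graded I" "graded S"
  unfolding K0_def K_def J_def L_def I_def S_def
  using g luv by (auto intro!: graded_ideal2 graded_colon graded_sat ideal_zero_set)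

lemma g1_0: "g1 \<noteq> 0"
  using g1_lu is_ideal(7) ideal_zero lu_def by metis

text \<open>A vanishing \<open>g2\<close> or \<open>g3\<close> would give a syzygy of degree 0,
  which is below \<open>r\<close>.\<close>

lemma g2_0: "g2 \<noteq> 0" and g3_0: "g3 \<noteq> 0"
  using syz[of 0 0 1 0] syz[of 0 0 0 1] homog_const[of 1] e1 er by auto

lemma l_g1: "\<not> l dvd g1"
proof
  assume "l dvd g1"
  then obtain h where "g1 = l * h + u * 0" by (auto elim: dvdE)
  then show False using g1_lu in_lu lu_def by metis
qed

text \<open>Modulo \<open>l\<close> and \<open>u\<close> the form \<open>g1\<close> is a non-zerodivisor, so the factors \<open>u\<close> can be removed one by one.\<close>

lemma cancel_u: "l dvd b * u ^ n - s * g1 \<Longrightarrow> \<exists>c. l dvd b - c * g1"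
proof (induction n arbitrary: s)
  case 0
  then show ?case by auto
next
  case (Suc n)
  obtain h where h: "b * u ^ Suc n - s * g1 = l * h" using Suc.prems by (elim dvdE)
  have "s * g1 = l * (- h) + u * (b * u ^ n)" using h by (simp add: algebra_simps)
  then have "s * g1 \<in> lu" using in_lu by blast
  then have "s \<in> lu" using prime_lu[of s g1] g1_lu by (auto simp: lu_def)
  then obtain a s' where s: "s = l * a + u * s'" using in_lu by blast
  have "u * (b * u ^ n - s' * g1) = l * (h + a * g1)" using h s by (simp add: algebra_simps)
  then have "l dvd u * (b * u ^ n - s' * g1)" by simp
  then show ?case using prime_l l_u Suc.IH by blast
qed

text \<open>Multiplying \<open>b\<close> by the expression of \<open>u ^ N\<close> in
  \<open>g1\<close>, \<open>g2\<close>, \<open>l\<close> and using the given relation shows that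
  \<open>b * u ^ N\<close> is a multiple of \<open>g1\<close> modulo \<open>l\<close>. The powers of
  \<open>u\<close> cancel by \<open>cancel_u\<close>; the statement on \<open>a\<close> follows
  since \<open>l\<close> is prime and does not divide \<open>g1\<close>.\<close>

lemma koszul_mod_l:
  assumes "l dvd a * g1 + b * g2"
  shows "\<exists>c. l dvd b - c * g1 \<and> l dvd a + c * g2"
proof -
  obtain N \<alpha> \<beta> h where N: "u ^ N = g1 * \<alpha> + g2 * \<beta> + l * h"
    using bez in_L unfolding L_def K_def K0_def by metis
  obtain k where k: "a * g1 + b * g2 = l * k" using assms by (elim dvdE)
  have "b * u ^ N - (\<alpha> * b - \<beta> * a) * g1 = b * l * h + \<beta> * (a * g1 + b * g2)"
    unfolding N by (simp add: algebra_simps)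
  also have "\<dots> = l * (b * h + \<beta> * k)" unfolding k by (simp add: algebra_simps)
  finally have "l dvd b * u ^ N - (\<alpha> * b - \<beta> * a) * g1" by simp
  then obtain c where c: "l dvd b - c * g1" using cancel_u by blast
  then obtain m where m: "b - c * g1 = l * m" by (elim dvdE)
  have "g1 * (a + c * g2) = (a * g1 + b * g2) - g2 * (b - c * g1)" by (simp add: algebra_simps)
  also have "\<dots> = l * (k - g2 * m)" unfolding k m by (simp add: algebra_simps)
  finally have "l dvd g1 * (a + c * g2)" by simp
  then show ?thesis using prime_l l_g1 c by blast
qed

lemma koszul_homog:
  assumes ab: "a \<in> homog k" "b \<in> homog k" and d: "l dvd a * g1 + b * g2"
  obtains c a' b' where "c \<in> homog (k - e)" "a' \<in> homog (k - 1)" "b' \<in> homog (k - 1)"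
    "b = c * g1 + l * b'" "a = l * a' - c * g2"
proof -
  obtain c b0 a0 where c: "b - c * g1 = l * b0" "a + c * g2 = l * a0"
    using koszul_mod_l[OF d] by (auto elim!: dvdE)
  have "hcomp k b = hcomp k (c * g1) + hcomp k (b0 * l)"
    using c(1) hcomp_add by (metis diff_add_cancel add.commute mult.commute)
  then have "b = hcomp (k - e) c * g1 + l * hcomp (k - 1) b0"
    using ab hcomp_mult[OF g(1)] hcomp_mult[OF luv(1)] by (simp add: hcomp_homog mult.commute)
  moreover have "hcomp k a + hcomp k (c * g2) = hcomp k (a0 * l)"
    using c(2) hcomp_add by (metis mult.commute)
  then have "a + hcomp (k - e) c * g2 = l * hcomp (k - 1) a0"
    using ab hcomp_mult[OF g(2)] hcomp_mult[OF luv(1)] by (simp add: hcomp_homog mult.commute)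
  then have "a = l * hcomp (k - 1) a0 - hcomp (k - e) c * g2" by (simp add: algebra_simps)
  ultimately show thesis using that hcomp_in_homog by blast
qed

text \<open>Modulo \<open>l\<close> the relation is a multiple of the Koszul relation; subtracting
  that multiple leaves \<open>l\<close> times a relation of degree one less. The induction on
  \<open>nat (k + 1)\<close> starts at negative degrees, where all forms vanish.\<close>

lemma koszul: "a \<in> homog k \<Longrightarrow> b \<in> homog k \<Longrightarrow> a * g1 + b * g2 = 0 \<Longrightarrow> b \<in> K0"
proof (induction "nat (k + 1)" arbitrary: a b k)
  case 0
  then have "b = 0" using homog_negD[of b k] by simp
  then show ?case using ideal_zero is_ideal(1) by blast
next
  case (Suc n)
  then have "l dvd a * g1 + b * g2" by simp
  then obtain c a' b' where c: "a' \<in> homog (k - 1)" "b' \<in> homog (k - 1)"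
    "b = c * g1 + l * b'" "a = l * a' - c * g2" using koszul_homog[OF Suc.prems(1,2)] by metis
  have "l * (a' * g1 + b' * g2) = 0" using Suc.prems(3) c(3,4) by (simp add: algebra_simps)
  then have "b' \<in> K0" using Suc.hyps(1)[of "k - 1" a' b'] Suc.hyps(2) c l0 by auto
  then obtain m where "b' = g1 * m" using in_K0 by blast
  then have "b = g1 * (c + l * m)" using c(3) by (simp add: algebra_simps)
  then show ?case using in_K0 by blast
qed

text \<open>By \<open>koszul_mod_l\<close> the coefficients of \<open>g1\<close> and
  \<open>g2\<close> can be changed by a Koszul relation so that both become divisible by
  \<open>l\<close>.\<close>

lemma l_nzd_K:
  assumes "l * p \<in> K" shows "p \<in> K"
proof -
  obtain a b where ab: "l * p = g1 * a + g2 * b" using assms in_K by blast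
  then have "l dvd a * g1 + b * g2" by (metis dvd_triv_left mult.commute)
  then obtain c b' a' where c: "b - c * g1 = l * b'" "a + c * g2 = l * a'"
    using koszul_mod_l[of a b] by (metis dvdE)
  have "l * p = g1 * (a + c * g2) + g2 * (b - c * g1)" using ab by (simp add: algebra_simps)
  also have "\<dots> = l * (g1 * a' + g2 * b')" unfolding c by (simp add: algebra_simps)
  finally show ?thesis using l0 in_K by auto
qed

lemma l_pow_nzd_K: "l ^ n * p \<in> K \<Longrightarrow> p \<in> K"
  by (induction n) (auto simp: mult.assoc intro: l_nzd_K)

lemma l_nzd_I: "l * p \<in> I \<Longrightarrow> p \<in> I"
  using l_nzd_K by (simp add: I_def mult.left_commute)

text \<open>By \<open>base\<close>, a form of degree \<open>e\<close> is a scalar multiple of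
  \<open>g1\<close> plus a multiple of \<open>u\<close> modulo \<open>l\<close>. A product of
  \<open>k\<close> such forms is therefore a multiple of \<open>u ^ k\<close> modulo
  \<open>l\<close> and \<open>g1\<close>.\<close>

lemma homog_e_L_power: "p \<in> homog (e * int k) \<Longrightarrow> p \<in> ideal2 (ideal2 (ideal2 {0} l) (u ^ k)) g1"
proof (induction k arbitrary: p)
  case 0
  have "p = 0 + 1 * p" by simp
  then have "p \<in> ideal2 (ideal2 {0} l) 1" using ideal2_self[OF is_ideal_ideal2[OF ideal_zero_set(1)], of 1 p l] by simp
  then show ?case using ideal2_superset by fastforce
next
  case (Suc k)
  let ?Q = "ideal2 (ideal2 (ideal2 {0} l) (u ^ Suc k)) g1"
  have iQ: "is_ideal ?Q" by (intro is_ideal_ideal2 ideal_zero_set)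
  show ?case
  proof (rule homog_add_induct)
    show "p \<in> homog (int (nat e) + e * int k)" using Suc.prems e1 by (simp add: algebra_simps)
    show "e * int k \<ge> 0" using e1 by simp
    show "x + y \<in> ?Q" if "x \<in> ?Q" "y \<in> ?Q" for x y using ideal_add[OF iQ that] .
    fix q q' assume q: "q \<in> homog (int (nat e))" and q': "q' \<in> homog (e * int k)"
    obtain c where "q - scal c g1 \<in> ideal2 (ideal2 {0} l) u" using base q e1 by auto
    then obtain a b where qe: "q - scal c g1 = l * a + u * b" by (auto simp: ideal2_def)
    obtain a' b' c' where q'e: "q' = l * a' + u ^ k * b' + g1 * c'"
      using Suc.IH[OF q'] by (auto simp: ideal2_def)
    have "q = l * a + u * b + const c * g1" using qe by (simp add: scal_def algebra_simps)
    then have "q * q' = l * (a * q' + (u * b) * a') + u ^ Suc k * (b * b') + g1 * (const c * q' + u * b * c')"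
      unfolding q'e by (simp add: algebra_simps)
    then show "q * q' \<in> ?Q" using in_ideal3 by blast
  qed
qed

text \<open>With \<open>u ^ N\<close> in \<open>L\<close>, all forms of degree \<open>e * N\<close>
  lie in \<open>L\<close>, hence all forms of higher degree too.\<close>

lemma finite_length: "\<exists>M::nat. \<forall>j\<ge>int M. homog j \<subseteq> L"
proof -
  obtain N where N: "u ^ N \<in> L" using bez unfolding L_def K_def K0_def by blast
  have *: "p \<in> L" if pe: "p \<in> homog (e * int N)" for p
  proof -
    obtain a b c where p: "p = l * a + u ^ N * b + g1 * c"
      using homog_e_L_power[OF pe] in_ideal3 by blast
    have "g1 * c = g1 * c + g2 * 0 + l * 0" "l * a = g1 * 0 + g2 * 0 + l * a" by simp_all
    then have "g1 * c \<in> L" "l * a \<in> L" using in_L by blast+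
    moreover have "u ^ N * b \<in> L" using N ideal_mult2 is_ideal(4) by blast
    ultimately show ?thesis unfolding p using ideal_add is_ideal(4) by blast
  qed
  have "p \<in> L" if "p \<in> homog j" "j \<ge> e * int N" for p j
    using ideal_homog_mult[OF is_ideal(4), of "nat (e * int N)" 1 p j] * that e1 by simp
  then show ?thesis using e1 by (intro exI[of _ "nat (e * int N)"]) auto
qed

lemma K_subset_J: "K \<subseteq> J"
  unfolding J_def by (rule ideal2_superset)

lemma J_subset_S: "J \<subseteq> S"
  unfolding S_def by (rule sat_superset[OF is_ideal(3)])

text \<open>A form \<open>q\<close> of large degree is \<open>g1 * a + g2 * b + l * c\<close>. The
  first two terms are in \<open>J\<close>, and the last one carries \<open>p\<close> into
  \<open>J\<close> after multiplication by a form of degree \<open>k\<close>, because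
  \<open>l * p\<close> is in \<open>S\<close>.\<close>

lemma l_nzd_S:
  assumes "l * p \<in> S" shows "p \<in> S"
proof -
  obtain k where k: "\<forall>q\<in>homog (int k). q * (l * p) \<in> J" using assms by (auto simp: S_def sat_def)
  obtain M where M: "\<forall>j\<ge>int M. homog j \<subseteq> L" using finite_length by blast
  have "x * p \<in> J" if x: "x \<in> homog (int (k + M))" for x
  proof -
    have "x \<in> {x. x * p \<in> J}"
    proof (rule homog_add_induct)
      show "x \<in> homog (int k + int M)" using x by simp
      fix t q assume t: "t \<in> homog (int k)" and "q \<in> homog (int M)"
      then obtain a b c where q: "q = g1 * a + g2 * b + l * c" using M in_L by blast
      have "g1 * a + g2 * b + g3 * 0 \<in> J" using in_J by blast
      then have "(t * p) * (g1 * a + g2 * b) \<in> J" using ideal_mult[OF is_ideal(3)] by simp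
      moreover have "c * (t * (l * p)) \<in> J" using k t ideal_mult[OF is_ideal(3)] by blast
      ultimately have "(t * p) * (g1 * a + g2 * b) + c * (t * (l * p)) \<in> J"
        by (rule ideal_add[OF is_ideal(3)])
      then show "t * q \<in> {x. x * p \<in> J}" unfolding q by (simp add: algebra_simps)
    qed (use ideal_add[OF is_ideal(3)] in \<open>auto simp: distrib_right\<close>)
    then show ?thesis by simp
  qed
  then show ?thesis unfolding S_def sat_def by blast
qed

section \<open>Hilbert functions of the quotients by K, J, L and I\<close>

lemma codim_cong: "X \<inter> homog j = Y \<inter> homog j \<Longrightarrow> codim X j = codim Y j"
  by (simp add: codim_def)

text \<open>For a non-zerodivisor of degree 1 the colon ideal is \<open>X\<close> itself, so the new
  Hilbert function is the first difference of the old one.\<close>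

lemma codim_plus_l:
  assumes X: "graded X" "is_ideal X" and n: "\<And>p. l * p \<in> X \<Longrightarrow> p \<in> X"
  shows "codim (ideal2 X l) j = codim X j - codim X (j - 1)"
proof -
  have "{p. l * p \<in> X} = X" using n ideal_mult[OF X(2)] by blast
  then show ?thesis using codim_ideal2[OF X luv(1) l0] by simp
qed

lemma codim_mono_step:
  assumes X: "graded X" "is_ideal X" and n: "\<And>p. l * p \<in> X \<Longrightarrow> p \<in> X"
  shows "codim X j \<le> codim X (j + 1)"
  using codim_plus_l[OF assms, of "j + 1"] codim_nonneg[OF is_ideal_ideal2[OF X(2)], of l "j + 1"] by simp

text \<open>The Hilbert function of a complete intersection of two forms of degree \<open>e\<close>,
  by two uses of \<open>codim_ideal2\<close>.\<close>

lemma codim_K: "codim K j = hdim j - 2 * hdim (j - e) + hdim (j - 2 * e)"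
proof -
  have "{p. g1 * p \<in> {0}} = {0}" using g1_0 by auto
  then have K0: "codim K0 j = hdim j - hdim (j - e)" for j
    using codim_ideal2[OF ideal_zero_set(2,1) g(1) g1_0, of j] by (simp add: K0_def codim_zero_set)
  \<comment> \<open>A relation between \<open>g1\<close> and \<open>g2\<close> is a Koszul relation,
    so \<open>g2\<close> is a non-zerodivisor modulo \<open>g1\<close>. This is argued degree by
    degree because \<open>koszul\<close> speaks of forms.\<close>
  have "{p. g2 * p \<in> K0} \<inter> homog k = K0 \<inter> homog k" for k
  proof (intro equalityI subsetI)
    fix p assume "p \<in> {p. g2 * p \<in> K0} \<inter> homog k"
    then obtain a where p: "g2 * p = a * g1" "p \<in> homog k" using in_K0 by (auto simp: mult.commute)
    have "hcomp (k + e) (p * g2) = hcomp k a * g1"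
      using hcomp_mult[OF g(1), of "k + e" a] p(1) by (simp add: mult.commute)
    moreover have "hcomp (k + e) (p * g2) = p * g2"
      using hcomp_mult[OF g(2), of "k + e" p] p(2) by (simp add: hcomp_homog)
    ultimately have "(- hcomp k a) * g1 + p * g2 = 0" by simp
    then show "p \<in> K0 \<inter> homog k"
      using koszul[OF homog_uminus[OF hcomp_in_homog] p(2)] p(2) by blast
  qed (use ideal_mult is_ideal(1) in auto)
  then have "codim {p. g2 * p \<in> K0} k = codim K0 k" for k by (rule codim_cong)
  then show ?thesis
    using codim_ideal2[OF graded(1) is_ideal(1) g(2) g2_0, of j] K0
    by (simp add: K_def)
qed

lemma codim_J: "codim J j = codim K j - codim I (j - e)"
  unfolding J_def I_def using codim_ideal2[OF graded(2) is_ideal(2) g(3) g3_0] .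

lemma codim_L: "codim L j = codim K j - codim K (j - 1)"
  unfolding L_def using codim_plus_l[OF graded(2) is_ideal(2) l_nzd_K] .

text \<open>The Bezout number of two curves of degree \<open>e\<close>. From
  \<open>2 * e - 2\<close> on, all three arguments of \<open>hdim\<close> are at least -2, where
  \<open>two_hdim\<close> applies.\<close>

lemma codim_K_large: "j \<ge> 2 * e - 2 \<Longrightarrow> codim K j = e\<^sup>2"
  using two_hdim[of j] two_hdim[of "j - e"] two_hdim[of "j - 2 * e"] e1
  by (simp add: codim_K power2_eq_square algebra_simps)

text \<open>An element of \<open>I\<close> is the coefficient of \<open>g3\<close> in a syzygy;
  passing to homogeneous components makes it a syzygy of degree \<open>k\<close>, which is below
  \<open>r\<close>.\<close>

lemma I_small:
  assumes "c \<in> I" "c \<in> homog k" "k < r" shows "c = 0"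
proof -
  obtain a b where ab: "g3 * c = g1 * a + g2 * b" using assms(1) in_K by (auto simp: I_def)
  have "hcomp (k + e) (c * g3) = hcomp k a * g1 + hcomp k b * g2"
    using ab hcomp_mult[OF g(1), of "k + e" a] hcomp_mult[OF g(2), of "k + e" b]
    by (simp add: mult.commute hcomp_add)
  moreover have "hcomp (k + e) (c * g3) = c * g3"
    using hcomp_mult[OF g(3), of "k + e" c] assms(2) by (simp add: hcomp_homog)
  ultimately have "(- hcomp k a) * g1 + (- hcomp k b) * g2 + c * g3 = 0" by simp
  then show "c = 0"
    using syz[OF homog_uminus[OF hcomp_in_homog] homog_uminus[OF hcomp_in_homog] assms(2,3)] by blast
qed

lemma codim_I_small:
  assumes "k < r" shows "codim I k = hdim k"
proof -
  have "I \<inter> homog k = {0} \<inter> homog k" using I_small assms ideal_zero[OF is_ideal(5)] by auto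
  then show ?thesis using codim_cong codim_zero_set by metis
qed

end

section \<open>Duality and the Jacobian module\<close>

lemma codim_full: "homog j \<subseteq> X \<Longrightarrow> codim X j = 0"
  using dim_homog[of j] by (simp add: codim_def Int_absorb1)

lemma codim_neg: "is_ideal X \<Longrightarrow> j < 0 \<Longrightarrow> codim X j = 0"
  using homog_neg ideal_zero by (intro codim_full) auto

lemma codim_rel_basis:
  assumes X: "is_ideal X"
  obtains B where "vs.rel_basis (X \<inter> homog j) (homog j) B" "int (card B) = codim X j"
proof -
  have s: "vs.subspace (X \<inter> homog j)" using fin_dim_ideal[OF X] vs.fin_dim_subspace by blast
  then obtain B where B: "vs.rel_basis (X \<inter> homog j) (homog j) B"
    using vs.rel_basis_exists[OF fin_dim_homog s] by blast
  have "vs.dim (homog j) = vs.dim (X \<inter> homog j) + card B"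
    using vs.dim_rel_basis[OF fin_dim_ideal[OF X] subspace_homog _ B] by blast
  then have "int (card B) = codim X j" using dim_homog[of j] by (simp add: codim_def)
  then show thesis using that B by blast
qed

lemma power_homog: "q \<in> homog 1 \<Longrightarrow> q ^ n \<in> homog (int n)"
proof (induction n)
  case 0
  then show ?case using homog_const[of 1] by simp
next
  case (Suc n)
  then show ?case using homog_mult[of q 1 "q ^ n" "int n"] by (simp add: add.commute)
qed

context three_forms
begin

lemma codim_I_mono: "i \<le> j \<Longrightarrow> codim I i \<le> codim I j"
  by (induction j rule: int_ge_induct)
    (auto intro: order_trans[OF _ codim_mono_step[OF graded(5) is_ideal(5) l_nzd_I]])

lemma codim_S_mono: "i \<le> j \<Longrightarrow> codim S i \<le> codim S j"
  by (induction j rule: int_ge_induct)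
    (auto intro: order_trans[OF _ codim_mono_step[OF graded(6) is_ideal(6) l_nzd_S]])

text \<open>The eventual value of the Hilbert function of the quotient by \<open>J\<close>, which is
  the Tjurina number. The second conjunct is the residual bound: \<open>J\<close> and
  \<open>I\<close> share the \<open>e\<^sup>2\<close> points of \<open>K\<close>. Existence is shown
  in the next lemma.\<close>

definition "tau = (SOME t. (\<exists>j0. \<forall>j\<ge>j0. codim J j = t) \<and> (\<forall>j. codim I j \<le> e\<^sup>2 - t))"

text \<open>\<open>codim I\<close> is nondecreasing because \<open>l\<close> is a non-zerodivisor
  modulo \<open>I\<close>, and it is bounded by \<open>codim K\<close>, so it is eventually
  constant. Then \<open>codim_J\<close> determines the eventual value for \<open>J\<close>.\<close>

lemma codim_J_eventually: "\<exists>j0. \<forall>j\<ge>j0. codim J j = tau"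
  and codim_I_le: "codim I j \<le> e\<^sup>2 - tau"
proof -
  have bd: "codim I j \<le> e\<^sup>2" for j
  proof -
    \<comment> \<open>The bound \<open>e - 2\<close> brings \<open>?k + e\<close> into the range of
      \<open>codim_K_large\<close>.\<close>
    let ?k = "max j (e - 2)"
    have "codim I j \<le> codim I ?k" by (rule codim_I_mono) simp
    also have "\<dots> \<le> codim K (?k + e)"
      using codim_J[of "?k + e"] codim_nonneg[OF is_ideal(3), of "?k + e"] by simp
    also have "\<dots> = e\<^sup>2" using codim_K_large[of "?k + e"] by linarith
    finally show ?thesis .
  qed
  obtain b j0 where b: "\<And>j. j \<ge> j0 \<Longrightarrow> codim I j = b" "\<And>j. codim I j \<le> b"
    using int_mono_bounded_eventually_const[of "codim I" "e\<^sup>2"] bd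
      codim_mono_step[OF graded(5) is_ideal(5) l_nzd_I] by metis
  have "codim J j = e\<^sup>2 - b" if "j \<ge> max (j0 + e) (2 * e - 2)" for j
    using codim_J[of j] b(1)[of "j - e"] codim_K_large[of j] that by simp
  then have "\<exists>t. (\<exists>j0. \<forall>j\<ge>j0. codim J j = t) \<and> (\<forall>j. codim I j \<le> e\<^sup>2 - t)"
    using b(2) by (intro exI[of _ "e\<^sup>2 - b"] conjI exI[of _ "max (j0 + e) (2 * e - 2)"]) auto
  then have "(\<exists>j0. \<forall>j\<ge>j0. codim J j = tau) \<and> (\<forall>j. codim I j \<le> e\<^sup>2 - tau)"
    unfolding tau_def by (rule someI_ex)
  then show "\<exists>j0. \<forall>j\<ge>j0. codim J j = tau" "codim I j \<le> e\<^sup>2 - tau" by blast+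
qed

text \<open>In large degrees \<open>J\<close> and \<open>l\<close> together contain every form,
  since \<open>L\<close> does. As \<open>codim J\<close> is constant there, multiplication by
  \<open>l\<close> is injective modulo \<open>J\<close>; some power of \<open>l\<close> carries any
  element of \<open>S\<close> into \<open>J\<close>.\<close>

lemma S_eq_J_large: "\<exists>j0. \<forall>j\<ge>j0. S \<inter> homog j = J \<inter> homog j"
proof -
  obtain j0 where j0: "\<forall>j\<ge>j0. codim J j = tau" using codim_J_eventually by blast
  obtain M where M: "\<forall>j\<ge>int M. homog j \<subseteq> L" using finite_length by blast
  define j1 where "j1 = max j0 (int M)"
  have LJ: "L \<subseteq> ideal2 J l" unfolding L_def using K_subset_J by (auto simp: ideal2_def)
  have step: "p \<in> J" if p: "l * p \<in> J" "p \<in> homog j" "j \<ge> j1" for p j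
  proof -
    have "homog (j + 1) \<subseteq> L" using M that by (simp add: j1_def)
    then have "codim (ideal2 J l) (j + 1) = 0" using LJ by (intro codim_full) blast
    then have "codim {p. l * p \<in> J} j = codim J (j + 1)"
      using codim_ideal2[OF graded(3) is_ideal(3) luv(1) l0, of "j + 1"] by simp
    then have "codim J j \<le> codim {p. l * p \<in> J} j" using j0 that by (simp add: j1_def)
    then have "J \<inter> homog j = {p. l * p \<in> J} \<inter> homog j"
      using ideal_mult[OF is_ideal(3)] by (intro codim_eq_imp is_ideal_colon is_ideal(3)) auto
    then show ?thesis using p by blast
  qed
  have pow: "l ^ n * p \<in> J \<Longrightarrow> p \<in> homog j \<Longrightarrow> j \<ge> j1 \<Longrightarrow> p \<in> J" for n p j
  proof (induction n arbitrary: p j)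
    case (Suc n)
    have "l * p \<in> homog (j + 1)" using homog_mult[OF luv(1) Suc.prems(2)] by (simp add: add.commute)
    moreover have "l ^ n * (l * p) \<in> J" using Suc.prems(1) by (simp add: ac_simps)
    ultimately have "l * p \<in> J" using Suc.IH[of "l * p" "j + 1"] Suc.prems(3) by simp
    then show ?case using step Suc.prems by blast
  qed simp
  have "p \<in> J" if p: "p \<in> S" "p \<in> homog j" "j \<ge> j1" for p j
  proof -
    obtain k where "\<forall>q\<in>homog (int k). q * p \<in> J" using p(1) by (auto simp: S_def sat_def)
    then show ?thesis using pow p power_homog[OF luv(1)] by blast
  qed
  then show ?thesis using J_subset_S by blast
qed

lemma codim_S_le: "codim S j \<le> tau"
proof -
  obtain j0 where j0: "\<forall>j\<ge>j0. codim J j = tau" using codim_J_eventually by blast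
  obtain j1 where j1: "\<forall>j\<ge>j1. S \<inter> homog j = J \<inter> homog j" using S_eq_J_large by blast
  let ?k = "max j (max j0 j1)"
  have "codim S j \<le> codim S ?k" by (rule codim_S_mono) simp
  also have "\<dots> = codim J ?k" using j1 by (intro codim_cong) simp
  also have "\<dots> = tau" using j0 by simp
  finally show ?thesis .
qed

text \<open>Some \<open>l ^ k * p\<close> is an element of \<open>K\<close> plus a multiple of
  \<open>g3\<close>. Multiplication by \<open>c\<close> carries both into \<open>K\<close>, and then
  \<open>l ^ k\<close> is cancelled modulo \<open>K\<close>.\<close>

lemma S_mult_I: "p \<in> S \<Longrightarrow> c \<in> I \<Longrightarrow> p * c \<in> K"
proof -
  assume p: "p \<in> S" and c: "c \<in> I"
  obtain k where "\<forall>q\<in>homog (int k). q * p \<in> J" using p by (auto simp: S_def sat_def)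
  then have "l ^ k * p \<in> J" using power_homog[OF luv(1)] by blast
  then obtain x a where xa: "l ^ k * p = x + g3 * a" "x \<in> K" by (auto simp: J_def ideal2_def)
  have "l ^ k * (p * c) = (l ^ k * p) * c" by (simp add: mult.assoc)
  also have "\<dots> = c * x + a * (g3 * c)" unfolding xa(1) by (simp add: algebra_simps)
  also have "\<dots> \<in> K"
    using c xa(2) ideal_mult[OF is_ideal(2)] ideal_add[OF is_ideal(2)] by (simp add: I_def)
  finally show ?thesis by (rule l_pow_nzd_K)
qed

section \<open>Gorenstein duality modulo the line\<close>

lemma L_homog:
  assumes "p \<in> L" "p \<in> homog j"
  obtains a b c where "a \<in> homog (j - e)" "b \<in> homog (j - e)" "c \<in> homog (j - 1)"
    "p = g1 * a + g2 * b + l * c"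
proof -
  obtain a b c where "p = g1 * a + g2 * b + l * c" using assms(1) in_L by blast
  then have "hcomp j p = g1 * hcomp (j - e) a + g2 * hcomp (j - e) b + l * hcomp (j - 1) c"
    using hcomp_mult[OF g(1), of j a] hcomp_mult[OF g(2), of j b] hcomp_mult[OF luv(1), of j c]
    by (simp add: hcomp_add mult.commute)
  then show thesis using that assms(2) hcomp_in_homog by (metis hcomp_homog)
qed

text \<open>Writing \<open>u * q\<close> and \<open>v * q\<close> in \<open>L\<close> and comparing
  \<open>v * (u * q)\<close> with \<open>u * (v * q)\<close> gives a relation of \<open>g1\<close>
  and \<open>g2\<close> modulo \<open>l\<close>. In these degrees it has no Koszul part, so modulo
  \<open>l\<close> the coefficients \<open>a\<close> and \<open>b\<close> are multiples of
  \<open>u\<close>, and \<open>u\<close> can be cancelled.\<close>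

lemma socle:
  assumes q: "q \<in> homog k" "k < 2 * e - 2" and uL: "u * q \<in> L" and vL: "v * q \<in> L"
  shows "q \<in> L"
proof -
  have uh: "u * q \<in> homog (k + 1)" and vh: "v * q \<in> homog (k + 1)"
    using homog_mult[OF luv(2) q(1)] homog_mult[OF luv(3) q(1)] by (simp_all add: add.commute)
  obtain a b c where 1: "a \<in> homog (k + 1 - e)" "b \<in> homog (k + 1 - e)"
    "u * q = g1 * a + g2 * b + l * c" using L_homog[OF uL uh] by blast
  obtain a' b' c' where 2: "a' \<in> homog (k + 1 - e)" "b' \<in> homog (k + 1 - e)"
    "v * q = g1 * a' + g2 * b' + l * c'" using L_homog[OF vL vh] by blast
  have h: "v * x - u * y \<in> homog (k + 2 - e)" if "x \<in> homog (k + 1 - e)" "y \<in> homog (k + 1 - e)" for x y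
    using homog_diff[OF homog_mult[OF luv(3) that(1)], of "u * y"] homog_mult[OF luv(2) that(2)]
    by (simp add: algebra_simps)
  have "(v * a - u * a') * g1 + (v * b - u * b') * g2
      = v * (g1 * a + g2 * b + l * c) - u * (g1 * a' + g2 * b' + l * c') + l * (u * c' - v * c)"
    by (simp add: algebra_simps)
  also have "\<dots> = l * (u * c' - v * c)"
    unfolding 1(3)[symmetric] 2(3)[symmetric] by (simp add: algebra_simps)
  finally have d: "l dvd (v * a - u * a') * g1 + (v * b - u * b') * g2" by simp
  obtain m a1 b1 where m: "m \<in> homog (k + 2 - e - e)"
    "v * b - u * b' = m * g1 + l * b1" "v * a - u * a' = l * a1 - m * g2"
    using koszul_homog[OF h[OF 1(1) 2(1)] h[OF 1(2) 2(2)] d] by metis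
  \<comment> \<open>The degree \<open>k + 2 - 2 * e\<close> is negative exactly because
    \<open>k\<close> is below the socle degree.\<close>
  have m0: "m = 0" using homog_negD[OF m(1)] q(2) by simp
  have "v * b = l * b1 + u * b'" "v * a = l * a1 + u * a'" using m m0 by (simp_all add: algebra_simps)
  then have "v * b \<in> lu" "v * a \<in> lu" using in_lu by blast+
  then have "b \<in> lu" "a \<in> lu" using prime_lu v_lu lu_def by metis+
  then obtain b2 b3 a2 a3 where ab: "b = l * b2 + u * b3" "a = l * a2 + u * a3" using in_lu by metis
  have "u * (q - g1 * a3 - g2 * b3) = u * q - u * (g1 * a3 + g2 * b3)" by (simp add: algebra_simps)
  also have "\<dots> = l * (g1 * a2 + g2 * b2 + c)" unfolding 1(3) ab by (simp add: algebra_simps)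
  finally have "l dvd u * (q - g1 * a3 - g2 * b3)" by simp
  then have "l dvd q - g1 * a3 - g2 * b3" using prime_l l_u by blast
  then obtain c3 where "q - g1 * a3 - g2 * b3 = l * c3" by (elim dvdE)
  then have "q = g1 * a3 + g2 * b3 + l * c3" by (simp add: algebra_simps)
  then show ?thesis using in_L by blast
qed

text \<open>For each linear form \<open>w\<close> the product \<open>w * q\<close> satisfies the
  hypothesis one degree closer to the socle, hence lies in \<open>L\<close>; \<open>socle\<close>
  then gives \<open>q\<close> itself.\<close>

lemma pairing_nondegenerate:
  assumes "q \<in> homog (2 * e - 2 - int n)" "\<And>p. p \<in> homog (int n) \<Longrightarrow> p * q \<in> L"
  shows "q \<in> L"
  using assms
proof (induction n arbitrary: q)
  case 0
  have "1 * q \<in> L" using homog_const[of 1] by (intro 0) simp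
  then show ?case by simp
next
  case (Suc n)
  have w: "w * q \<in> L" if w: "w \<in> homog 1" for w
  proof (rule Suc.IH)
    show "w * q \<in> homog (2 * e - 2 - int n)" using homog_mult[OF w Suc.prems(1)] by (simp add: algebra_simps)
    fix p assume "p \<in> homog (int n)"
    then have "p * w \<in> homog (int (Suc n))" using homog_mult[of p "int n" w 1] w by (simp add: add.commute)
    then show "p * (w * q) \<in> L" using Suc.prems(2) by (simp add: mult.assoc[symmetric])
  qed
  show ?case using socle[OF Suc.prems(1) _ w[OF luv(2)] w[OF luv(3)]] by simp
qed

text \<open>The first difference of \<open>codim K\<close> involves \<open>hdim (- 3)\<close>, which
  is evaluated by definition since the polynomial formula fails there.\<close>

lemma codim_L_socle: "codim L (2 * e - 2) = 1"
  using codim_L[of "2 * e - 2"] two_hdim[of "2 * e - 2"] two_hdim[of "2 * e - 3"]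
    two_hdim[of "e - 2"] two_hdim[of "e - 3"] two_hdim[of "- 2"] e1
  by (simp add: codim_K hdim_def[of "- 3"] algebra_simps)

text \<open>In \<open>A\<close> the images of \<open>S\<close> and \<open>I\<close> annihilate each
  other. The elements of \<open>ideal2 I l\<close> in degree \<open>2 * e - 2 - j\<close> pair
  trivially with \<open>ideal2 S l\<close>, so orthogonality to a basis \<open>B\<close> of the
  forms of degree \<open>j\<close> modulo \<open>ideal2 S l\<close> puts them into \<open>L\<close>.
  Each vector of \<open>B\<close> imposes at most one condition, the socle being
  one-dimensional.\<close>

lemma duality_inequality:
  assumes j: "0 \<le> j" "j \<le> 2 * e - 2"
  shows "codim L (2 * e - 2 - j) \<le> codim (ideal2 S l) j + codim (ideal2 I l) (2 * e - 2 - j)"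
proof -
  let ?U = "ideal2 S l" and ?V = "ideal2 I l" and ?s = "2 * e - 2"
  have iU: "is_ideal ?U" and iV: "is_ideal ?V" using is_ideal_ideal2 is_ideal by blast+
  obtain B where B: "vs.rel_basis (?U \<inter> homog j) (homog j) B" "int (card B) = codim ?U j"
    using codim_rel_basis[OF iU] .
  have BH: "B \<subseteq> homog j" "finite B" using B(1) by (auto simp: vs.rel_basis_def)
  have UV: "p * q \<in> L" if pq: "p \<in> ?U" "q \<in> ?V" for p q
  proof -
    obtain x a y b where "p = x + l * a" "x \<in> S" "q = y + l * b" "y \<in> I"
      using pq unfolding ideal2_def by blast
    then have "p * q = x * y + l * (a * y + x * b + a * l * b)" "x * y \<in> K"
      using S_mult_I by (simp_all add: algebra_simps)
    then show ?thesis by (auto simp: L_def ideal2_def)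
  qed
  let ?W = "\<lambda>C. {q \<in> ?V \<inter> homog (?s - j). \<forall>b\<in>C. b * q \<in> L}"
  have sub: "vs.subspace (?W C)" for C
  proof -
    have "?W C = ?V \<inter> homog (?s - j) \<inter> (\<Inter>b\<in>C. {q. b * q \<in> L})" by auto
    moreover have "vs.subspace \<dots>"
      by (intro vs.subspace_inter subspace_homog subspace_ideal[OF iV] vs.subspace_Inter)
        (auto intro: subspace_ideal is_ideal_colon is_ideal(4))
    ultimately show ?thesis by simp
  qed
  have fin: "vs.fin_dim (?W C)" for C
    using vs.fin_dim_subset[OF fin_dim_ideal[OF iV] sub] by blast
  have "vs.dim (?V \<inter> homog (?s - j)) \<le> vs.dim (?W C) + card C" if "finite C" "C \<subseteq> homog j" for C
    using that
  proof (induction C rule: finite_induct)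
    case empty
    then show ?case by (simp add: Int_def)
  next
    case (insert b C)
    have im: "(*) b ` ?W C \<subseteq> homog ?s"
      using homog_mult[of b j _ "?s - j"] insert.prems by auto
    have sL: "vs.subspace (L \<inter> homog ?s)" using fin_dim_ideal[OF is_ideal(4)] vs.fin_dim_subspace by blast
    have "vs.dim (?W C) + vs.dim (L \<inter> homog ?s)
        \<le> vs.dim {q \<in> ?W C. b * q \<in> L \<inter> homog ?s} + vs.dim (homog ?s)"
      using vs.dim_preimage[OF fin mult_hom fin_dim_homog im sL] by blast
    moreover have "{q \<in> ?W C. b * q \<in> L \<inter> homog ?s} = ?W (insert b C)" using im by auto
    moreover have "vs.dim (homog ?s) = vs.dim (L \<inter> homog ?s) + 1"
      using codim_L_socle dim_homog[of ?s] by (simp add: codim_def)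
    ultimately have "vs.dim (?W C) \<le> vs.dim (?W (insert b C)) + 1" by simp
    then show ?case using insert by simp
  qed
  from this[OF BH(2,1)] have d: "vs.dim (?V \<inter> homog (?s - j)) \<le> vs.dim (?W B) + card B" .
  have "?W B \<subseteq> L \<inter> homog (?s - j)"
  proof
    fix q assume q: "q \<in> ?W B"
    have "p * q \<in> L" if p: "p \<in> homog (int (nat j))" for p
    proof -
      have "p \<in> homog j" using p j by simp
      \<comment> \<open>\<open>p\<close> is split into a part in \<open>?U\<close>, annihilated by
        \<open>q\<close> through \<open>UV\<close>, and a combination of \<open>B\<close>,
        annihilated by the choice of \<open>q\<close>.\<close>
      then obtain c where c: "p - (\<Sum>b\<in>B. scal (c b) b) \<in> ?U \<inter> homog j"
        using vs.rel_basisD[OF B(1)] by blast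
      then have "(p - (\<Sum>b\<in>B. scal (c b) b)) * q \<in> L" using UV q by blast
      moreover have "(\<Sum>b\<in>B. scal (c b) b) * q = (\<Sum>b\<in>B. const (c b) * (b * q))"
        by (simp add: sum_distrib_right scal_def mult.assoc)
      moreover have "(\<Sum>b\<in>B. const (c b) * (b * q)) \<in> L"
        using q ideal_mult[OF is_ideal(4)] by (intro ideal_sum[OF is_ideal(4)]) blast
      ultimately have "(p - (\<Sum>b\<in>B. scal (c b) b)) * q + (\<Sum>b\<in>B. scal (c b) b) * q \<in> L"
        using ideal_add[OF is_ideal(4)] by simp
      then show ?thesis by (simp add: distrib_right[symmetric])
    qed
    then show "q \<in> L \<inter> homog (?s - j)" using pairing_nondegenerate[of q "nat j"] q j by simp
  qed
  then have "vs.dim (?W B) \<le> vs.dim (L \<inter> homog (?s - j))"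
    using vs.dim_mono_fin[OF fin_dim_ideal[OF is_ideal(4)] sub] by blast
  then show ?thesis using d B(2) by (simp add: codim_def)
qed

text \<open>The duality inequalities telescope: each one says that \<open>T\<close> does not
  decrease, and \<open>T (- 1) = 0\<close>. Nonnegativity at \<open>?s - r\<close> bounds
  \<open>codim S\<close> from below by \<open>tau\<close>, and \<open>codim_S_le\<close> is the
  opposite bound.\<close>

lemma codim_S_large:
  assumes "j \<ge> 2 * e - 2 - r" shows "codim S j = tau"
proof -
  let ?s = "2 * e - 2"
  txt \<open>\<open>T n\<close> sums the defects of the duality inequality up to degree \<open>n\<close>.\<close>
  define T where "T n = codim S n + codim I ?s - codim I (?s - n - 1)
    - (codim K ?s - codim K (?s - n - 1))" for n
  have cS: "codim (ideal2 S l) j = codim S j - codim S (j - 1)" for j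
    using codim_plus_l[OF graded(6) is_ideal(6) l_nzd_S] .
  have cI: "codim (ideal2 I l) j = codim I j - codim I (j - 1)" for j
    using codim_plus_l[OF graded(5) is_ideal(5) l_nzd_I] .
  have step: "T (n - 1) \<le> T n" if "0 \<le> n" "n \<le> ?s" for n
    using duality_inequality[OF that] cS[of n] cI[of "?s - n"] codim_L[of "?s - n"]
    by (simp add: T_def algebra_simps)
  have T0: "n \<le> ?s \<Longrightarrow> 0 \<le> T n" if "n \<ge> - 1" for n
    using that
  proof (induction n rule: int_ge_induct)
    case base
    show ?case by (simp add: T_def codim_neg[OF is_ideal(6)])
  next
    case (step n)
    then show ?case using \<open>0 \<le> n + 1 \<Longrightarrow> n + 1 \<le> ?s \<Longrightarrow> T (n + 1 - 1) \<le> T (n + 1)\<close> by simp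
  qed
  \<comment> \<open>For \<open>n = ?s - r\<close> the lower ends of both telescoping sums are at
    \<open>r - 1\<close>. They cancel, since neither \<open>I\<close> nor \<open>K\<close> has
    nonzero forms in degrees below \<open>r\<close>.\<close>
  have "codim I (r - 1) = codim K (r - 1)"
    using re er e1 by (simp add: codim_I_small codim_K hdim_def)
  moreover have "0 \<le> T (?s - r)" using T0[of "?s - r"] re er e1 by simp
  ultimately have "codim K ?s - codim I ?s \<le> codim S (?s - r)" by (simp add: T_def)
  then have "tau \<le> codim S (?s - r)" using codim_K_large[of ?s] codim_I_le[of ?s] by simp
  then show ?thesis using codim_S_mono[OF assms] codim_S_le[of j] by simp
qed

text \<open>Here \<open>j - e < r\<close>, so there are no syzygies to correct for, and
  \<open>j - 2 * e\<close> is negative.\<close>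

lemma codim_J_small: "j \<le> e + r - 1 \<Longrightarrow> codim J j = hdim j - 3 * hdim (j - e)"
  using re by (simp add: codim_J codim_I_small codim_K hdim_def[of "j - 2 * e"])

text \<open>\<open>codim S\<close> takes the same value at \<open>j - 1\<close> and
  \<open>j\<close>, so \<open>S\<close> and \<open>l\<close> together contain all forms of degree
  \<open>j\<close>. An element of \<open>S\<close> of degree \<open>j + 1\<close> is then an element
  of \<open>J\<close> plus \<open>l * Q\<close>, and \<open>Q\<close> lies in \<open>S\<close>,
  hence in \<open>J\<close>.\<close>

lemma S_eq_J_step_up:
  assumes j: "j \<ge> 2 * e - 1 - r" and eq: "S \<inter> homog j = J \<inter> homog j"
  shows "S \<inter> homog (j + 1) = J \<inter> homog (j + 1)"
proof -
  have "codim (ideal2 S l) j = 0"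
    using codim_plus_l[OF graded(6) is_ideal(6) l_nzd_S, of j] codim_S_large j by simp
  then have full: "homog j \<subseteq> ideal2 S l" using codim_0_imp[OF is_ideal_ideal2[OF is_ideal(6)]] by simp
  have split: "\<exists>s b'. s \<in> J \<and> b' \<in> homog (j - 1) \<and> b = s + l * b'" if "b \<in> homog j" for b
  proof -
    have "b \<in> ideal2 S l \<inter> homog j" using full that by blast
    then show ?thesis unfolding ideal2_homog[OF graded(6) is_ideal(6) luv(1)] using eq by blast
  qed
  have "p \<in> J" if p: "p \<in> S" "p \<in> homog (j + 1)" for p
  proof -
    obtain a b c where abc: "a \<in> homog j" "b \<in> homog j" "c \<in> homog j" "p = l * a + u * b + v * c"
      using decomp[OF p(2)] j re er by auto
    obtain s b' where b: "s \<in> J" "b' \<in> homog (j - 1)" "b = s + l * b'" using split abc by blast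
    obtain t c' where c: "t \<in> J" "c' \<in> homog (j - 1)" "c = t + l * c'" using split abc by blast
    define Q where "Q = a + u * b' + v * c'"
    have Qh: "Q \<in> homog j" unfolding Q_def
      using homog_add[OF homog_add[OF abc(1), of "u * b'"], of "v * c'"]
        homog_mult[OF luv(2) b(2)] homog_mult[OF luv(3) c(2)] by simp
    have st: "u * s + v * t \<in> J" using b c ideal_mult[OF is_ideal(3)] ideal_add[OF is_ideal(3)] by blast
    have pe: "p = (u * s + v * t) + l * Q" unfolding abc(4) b(3) c(3) Q_def by (simp add: algebra_simps)
    then have "l * Q = p - (u * s + v * t)" by simp
    also have "\<dots> \<in> S" using ideal_diff[OF is_ideal(6) p(1)] st J_subset_S by blast
    finally have "Q \<in> J" using l_nzd_S Qh eq by blast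
    then show ?thesis unfolding pe using st ideal_mult[OF is_ideal(3)] ideal_add[OF is_ideal(3)] by blast
  qed
  then show ?thesis using J_subset_S by blast
qed

lemma J_homog:
  assumes "p \<in> J" "p \<in> homog j"
  obtains a b c where "a \<in> homog (j - e)" "b \<in> homog (j - e)" "c \<in> homog (j - e)"
    "p = g1 * a + g2 * b + g3 * c"
proof -
  obtain a b c where "p = g1 * a + g2 * b + g3 * c" using assms(1) in_J by blast
  then have "hcomp j p = g1 * hcomp (j - e) a + g2 * hcomp (j - e) b + g3 * hcomp (j - e) c"
    using hcomp_mult[OF g(1), of j a] hcomp_mult[OF g(2), of j b] hcomp_mult[OF g(3), of j c]
    by (simp add: hcomp_add mult.commute)
  then show thesis using that assms(2) hcomp_in_homog by (metis hcomp_homog)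
qed

text \<open>Both \<open>l * p\<close> and \<open>u * p\<close> lie in \<open>J\<close>. Their cross
  relation is a syzygy of degree \<open>j + 2 - e\<close>, below \<open>r\<close>, so it vanishes;
  the coefficients of \<open>l * p\<close> are thus divisible by \<open>l\<close>, which
  cancels.\<close>

lemma S_eq_J_step_down:
  assumes j: "j < e + r - 2" and eq: "S \<inter> homog (j + 1) = J \<inter> homog (j + 1)"
  shows "S \<inter> homog j = J \<inter> homog j"
proof -
  have "p \<in> J" if p: "p \<in> S" "p \<in> homog j" for p
  proof -
    have w: "w * p \<in> homog (j + 1)" "w * p \<in> J" if "w \<in> homog 1" for w
      using homog_mult[OF that p(2)] ideal_mult[OF is_ideal(6) p(1), of w] eq
      by (auto simp: add.commute)
    obtain a b c where 1: "a \<in> homog (j + 1 - e)" "b \<in> homog (j + 1 - e)" "c \<in> homog (j + 1 - e)"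
      "l * p = g1 * a + g2 * b + g3 * c" using J_homog[OF w(2,1)[OF luv(1)]] .
    obtain a' b' c' where 2: "a' \<in> homog (j + 1 - e)" "b' \<in> homog (j + 1 - e)" "c' \<in> homog (j + 1 - e)"
      "u * p = g1 * a' + g2 * b' + g3 * c'" using J_homog[OF w(2,1)[OF luv(2)]] .
    have h: "u * x - l * y \<in> homog (j + 2 - e)" if "x \<in> homog (j + 1 - e)" "y \<in> homog (j + 1 - e)" for x y
      using homog_diff[OF homog_mult[OF luv(2) that(1)], of "l * y"] homog_mult[OF luv(1) that(2)]
      by (simp add: algebra_simps)
    have "(u * a - l * a') * g1 + (u * b - l * b') * g2 + (u * c - l * c') * g3
        = u * (g1 * a + g2 * b + g3 * c) - l * (g1 * a' + g2 * b' + g3 * c')"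
      by (simp add: algebra_simps)
    also have "\<dots> = 0" unfolding 1(4)[symmetric] 2(4)[symmetric] by (simp add: algebra_simps)
    finally have "u * a - l * a' = 0 \<and> u * b - l * b' = 0 \<and> u * c - l * c' = 0"
      using syz[OF h[OF 1(1) 2(1)] h[OF 1(2) 2(2)] h[OF 1(3) 2(3)]] j by simp
    then have "l dvd u * a" "l dvd u * b" "l dvd u * c" by simp_all
    then have "l dvd a" "l dvd b" "l dvd c" using prime_l l_u by blast+
    then obtain a1 b1 c1 where "a = l * a1" "b = l * b1" "c = l * c1" by (elim dvdE)
    then have "l * p = l * (g1 * a1 + g2 * b1 + g3 * c1)" using 1(4) by (simp add: algebra_simps)
    then show ?thesis using l0 in_J by auto
  qed
  then show ?thesis using J_subset_S by blast
qed

text \<open>The hypothesis \<open>max\<close> says that \<open>codim J\<close> equals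
  \<open>tau\<close> at \<open>e + r - 1\<close>. Since \<open>J\<close> is contained in
  \<open>S\<close>, equal Hilbert functions there make the two ideals agree in that degree.\<close>

theorem codim_J_minus_codim_S:
  assumes max: "tau = hdim (e + r - 1) - 3 * hdim (r - 1)"
  shows "2 * e - 1 - r \<le> j \<Longrightarrow> j \<le> e + r - 2 \<Longrightarrow> codim J j - codim S j = hdim j - 3 * hdim (j - e) - tau"
    and "\<not> (2 * e - 1 - r \<le> j \<and> j \<le> e + r - 2) \<Longrightarrow> codim J j - codim S j = 0"
proof -
  show "codim J j - codim S j = hdim j - 3 * hdim (j - e) - tau"
    if "2 * e - 1 - r \<le> j" "j \<le> e + r - 2"
    using codim_S_large[of j] codim_J_small[of j] that by simp
  have eqI: "S \<inter> homog j = J \<inter> homog j" if "codim J j = tau" "j \<ge> 2 * e - 2 - r" for j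
    using codim_eq_imp[OF is_ideal(3,6), of j] J_subset_S codim_S_large[of j] that by auto
  have up: "S \<inter> homog j = J \<inter> homog j" if "j \<ge> e + r - 1" for j
    using that
  proof (induction j rule: int_ge_induct)
    case base
    show ?case using codim_J_small[of "e + r - 1"] max er by (intro eqI) simp_all
  next
    case (step j)
    then show ?case using er by (intro S_eq_J_step_up) simp_all
  qed
  \<comment> \<open>The degree is the mirror image of \<open>e + r - 1\<close> under the symmetry of
    the formula in \<open>codim_J_small\<close>. From \<open>r \<le> e\<close> the argument
    \<open>e - 2 - r\<close> is at least -2.\<close>
  have sym: "codim J (2 * e - 2 - r) = tau"
  proof -
    have "2 * codim J (2 * e - 2 - r) = 2 * tau"
      using codim_J_small[of "2 * e - 2 - r"] max er e1 re
        two_hdim[of "2 * e - 2 - r"] two_hdim[of "e - 2 - r"] two_hdim[of "e + r - 1"] two_hdim[of "r - 1"]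
      by (simp add: algebra_simps)
    then show ?thesis by simp
  qed
  have down: "S \<inter> homog j = J \<inter> homog j" if "j \<le> 2 * e - 2 - r" for j
    using that
  proof (induction j rule: int_le_induct)
    case base
    show ?case using sym by (intro eqI) simp_all
  next
    case (step j)
    then show ?case using er S_eq_J_step_down[of "j - 1"] by simp
  qed
  show "codim J j - codim S j = 0" if "\<not> (2 * e - 1 - r \<le> j \<and> j \<le> e + r - 2)"
  proof -
    have "j \<ge> e + r - 1 \<or> j \<le> 2 * e - 2 - r" using that by linarith
    then have "S \<inter> homog j = J \<inter> homog j" using up[of j] down[of j] by blast
    then show ?thesis using codim_cong[of S j J] by simp
  qed
qed

end

section \<open>Substitutions, derivatives and squarefree polynomials\<close>

definition ring_map :: "('a::comm_ring_1 \<Rightarrow> 'b::comm_ring_1) \<Rightarrow> bool" where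
  "ring_map h \<longleftrightarrow> h 1 = 1 \<and> (\<forall>x y. h (x + y) = h x + h y) \<and> (\<forall>x y. h (x * y) = h x * h y)"

lemma ring_mapD:
  assumes "ring_map h"
  shows "h 1 = 1" "h (x + y) = h x + h y" "h (x * y) = h x * h y" "h 0 = 0"
    "h (x - y) = h x - h y" "h (x ^ n) = h x ^ n" "h (- x) = - h x"
proof -
  show 1: "h 1 = 1" and a: "h (x + y) = h x + h y" and m: "h (x * y) = h x * h y" for x y
    using assms by (auto simp: ring_map_def)
  show z: "h 0 = 0" using a[of 0 0] by simp
  show "h (x - y) = h x - h y" using a[of "x - y" y] by (simp add: algebra_simps)
  show "h (- x) = - h x" using a[of "- x" x] z by (simp add: eq_neg_iff_add_eq_0)
  show "h (x ^ n) = h x ^ n" by (induction n) (simp_all add: 1 m)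
qed

lemma ring_map_comp: "ring_map g \<Longrightarrow> ring_map h \<Longrightarrow> ring_map (\<lambda>x. g (h x))"
  by (simp add: ring_map_def)

text \<open>For a ring homomorphism \<open>h\<close> this is the homomorphism that extends
  \<open>h\<close> on constants and sends \<open>var i\<close> to \<open>a i\<close>.\<close>

definition ev :: "(complex \<Rightarrow> 'a::comm_ring_1) \<Rightarrow> (3 \<Rightarrow> 'a) \<Rightarrow> poly3 \<Rightarrow> 'a" where
  "ev h a p = (\<Sum>m\<in>Poly_Mapping.keys p. h (Poly_Mapping.lookup p m) * (\<Prod>i\<in>UNIV. a i ^ Poly_Mapping.lookup m i))"

lemma ev_superset:
  assumes "ring_map h" "finite A" "Poly_Mapping.keys p \<subseteq> A"
  shows "ev h a p = (\<Sum>m\<in>A. h (Poly_Mapping.lookup p m) * (\<Prod>i\<in>UNIV. a i ^ Poly_Mapping.lookup m i))"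
  unfolding ev_def using assms
  by (intro sum.mono_neutral_left) (auto simp: in_keys_iff ring_mapD(4))

lemma ev_single: "ring_map h \<Longrightarrow> ev h a (Poly_Mapping.single m c) = h c * (\<Prod>i\<in>UNIV. a i ^ Poly_Mapping.lookup m i)"
  by (auto simp: ev_def ring_mapD(4))

lemma ev_add:
  assumes h: "ring_map h"
  shows "ev h a (p + q) = ev h a p + ev h a q"
proof -
  let ?A = "Poly_Mapping.keys p \<union> Poly_Mapping.keys q"
  have "finite ?A" "Poly_Mapping.keys (p + q) \<subseteq> ?A" using keys_add[of p q] by auto
  then show ?thesis
    using ev_superset[OF h, of ?A] by (simp add: lookup_add ring_mapD(2)[OF h] distrib_right sum.distrib)
qed

lemma ring_map_ev:
  assumes h: "ring_map h" shows "ring_map (ev h a)"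
  unfolding ring_map_def
proof (intro conjI allI)
  have "ev h a (Poly_Mapping.single 0 1) = 1" using ev_single[OF h, of a 0 1] h by (simp add: ring_mapD)
  then show "ev h a 1 = 1" by simp
  show "ev h a (p + q) = ev h a p + ev h a q" for p q by (rule ev_add[OF h])
  fix p q
  have z: "ev h a 0 = 0" by (simp add: ev_def)
  have s: "ev h a (Poly_Mapping.single m c * q) = ev h a (Poly_Mapping.single m c) * ev h a q" for m c
  proof (induction q rule: poly_mapping_add_induct)
    case (single n d)
    show ?case
      by (simp add: mult_single ev_single[OF h] ring_mapD(3)[OF h] lookup_add power_add prod.distrib ac_simps)
  next
    case (add p q)
    then show ?case by (simp add: distrib_left ev_add[OF h])
  qed (simp add: z)
  show "ev h a (p * q) = ev h a p * ev h a q"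
    by (induction p rule: poly_mapping_add_induct) (simp_all add: z s distrib_right ev_add[OF h])
qed

lemma ev_const: "ring_map h \<Longrightarrow> ev h a (const c) = h c"
  by (simp add: ev_single)

lemma ev_var:
  assumes "ring_map h" shows "ev h a (var i) = a i"
proof -
  have "(\<Prod>j\<in>UNIV. a j ^ Poly_Mapping.lookup (Poly_Mapping.single i 1) j) = (\<Prod>j\<in>UNIV. if j = i then a i else 1)"
    by (intro prod.cong) (auto simp: lookup_single when_def)
  then show ?thesis using assms by (simp add: var_def ev_single ring_mapD(1))
qed

lemma single_eq_prod:
  "Poly_Mapping.single m c = const c * (var 0 ^ Poly_Mapping.lookup m 0 * var 1 ^ Poly_Mapping.lookup m 1 * var 2 ^ Poly_Mapping.lookup m 2)"
proof -
  have v: "var i ^ n = Poly_Mapping.single (Poly_Mapping.single i n) 1" for i n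
    by (induction n) (simp_all add: var_def mult_single single_add[symmetric])
  have "m = Poly_Mapping.single 0 (Poly_Mapping.lookup m 0) + Poly_Mapping.single 1 (Poly_Mapping.lookup m 1)
    + Poly_Mapping.single 2 (Poly_Mapping.lookup m 2)" (is "m = ?m")
  proof (rule poly_mapping_eqI)
    fix i :: 3
    have "i = 0 \<or> i = 1 \<or> i = 2" using UNIV_3 by blast
    then show "Poly_Mapping.lookup m i = Poly_Mapping.lookup ?m i"
      by (auto simp: lookup_add lookup_single when_def)
  qed
  then show ?thesis unfolding v by (simp add: mult_single)
qed

text \<open>Constants and variables generate the ring. With equality for \<open>R\<close> this is
  uniqueness of homomorphisms, and with congruence modulo an ideal it yields
  \<open>poly3_hom_cong\<close>.\<close>

lemma poly3_hom_rel:
  assumes H: "ring_map H" "ring_map H'"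
    and add: "\<And>x x' y y'. R x x' \<Longrightarrow> R y y' \<Longrightarrow> R (x + y) (x' + y')"
    and mult: "\<And>x x' y y'. R x x' \<Longrightarrow> R y y' \<Longrightarrow> R (x * y) (x' * y')"
    and c: "\<And>c. R (H (const c)) (H' (const c))" and v: "\<And>i. R (H (var i)) (H' (var i))"
  shows "R (H p) (H' p)"
proof (induction p rule: poly_mapping_add_induct)
  case zero
  then show ?case using c[of 0] by simp
next
  case (single m z)
  have pw: "R (H (var i ^ n)) (H' (var i ^ n))" for i n
  proof (induction n)
    case 0
    then show ?case using c[of 1] by simp
  next
    case (Suc n)
    then show ?case using mult[OF v Suc.IH] by (simp add: ring_mapD(3)[OF H(1)] ring_mapD(3)[OF H(2)])
  qed
  show ?case unfolding single_eq_prod[of m z] ring_mapD(3)[OF H(1)] ring_mapD(3)[OF H(2)]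
    by (intro mult c pw)
next
  case (add p q)
  then show ?case unfolding ring_mapD(2)[OF H(1)] ring_mapD(2)[OF H(2)] by (rule assms(3))
qed

lemma poly3_hom_eq:
  assumes H: "ring_map H" "ring_map H'"
    and "\<And>c. H (const c) = H' (const c)" "\<And>i. H (var i) = H' (var i)"
  shows "H p = H' p"
  by (rule poly3_hom_rel[OF H, of "(=)"]) (simp_all only: assms(3,4))

lemma poly3_hom_cong:
  assumes H: "ring_map H" and X: "is_ideal X"
    and c: "\<And>c. H (const c) = const c" and v: "\<And>i. var i - H (var i) \<in> X"
  shows "p - H p \<in> X"
proof -
  have "ring_map (\<lambda>p::poly3. p)" by (simp add: ring_map_def)
  from poly3_hom_rel[OF this H, of "\<lambda>x y. x - y \<in> X"]
  show ?thesis
  proof this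
    fix x x' y y' assume xy: "x - x' \<in> X" "y - y' \<in> X"
    have "(x - x') + (y - y') \<in> X" using ideal_add[OF X xy] .
    then show "x + y - (x' + y') \<in> X" by (simp add: algebra_simps)
    have "y * (x - x') + x' * (y - y') \<in> X"
      using ideal_add[OF X ideal_mult[OF X xy(1)] ideal_mult[OF X xy(2)]] .
    then show "x * y - x' * y' \<in> X" by (simp add: algebra_simps)
  qed (use c v ideal_zero[OF X] in simp_all)
qed

text \<open>The univariate counterpart of \<open>ev\<close>; iterating it gives homomorphisms out of
  nested polynomial rings.\<close>

definition plift :: "('a::comm_ring_1 \<Rightarrow> 'b::comm_ring_1) \<Rightarrow> 'b \<Rightarrow> 'a poly \<Rightarrow> 'b" where
  "plift h a q = poly (map_poly h q) a"

lemma plift_pCons: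
  assumes "ring_map h" shows "plift h a (pCons c q) = h c + a * plift h a q"
proof (cases "c = 0 \<and> q = 0")
  case True
  then show ?thesis using assms by (simp add: plift_def ring_mapD(4))
next
  case False
  then have "map_poly h (pCons c q) = pCons (h c) (map_poly h q)" using assms by (intro map_poly_pCons) (auto simp: ring_mapD(4))
  then show ?thesis by (simp add: plift_def)
qed

lemma plift_const [simp]: "ring_map h \<Longrightarrow> plift h a [:c:] = h c"
  by (simp add: plift_pCons) (simp add: plift_def)

lemma plift_X [simp]: "ring_map h \<Longrightarrow> plift h a [:0, 1:] = a"
  by (simp add: plift_pCons ring_mapD) (simp add: plift_def)

lemma ring_map_plift:
  assumes h: "ring_map h" shows "ring_map (plift h a)"
proof -
  have z: "plift h a 0 = 0" by (simp add: plift_def)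
  have add: "plift h a (p + q) = plift h a p + plift h a q" for p q
    by (induction p q rule: poly_induct2)
      (simp_all add: z plift_pCons[OF h] ring_mapD(2)[OF h] algebra_simps)
  have sm: "plift h a (smult c q) = h c * plift h a q" for c q
    by (induction q) (simp_all add: z plift_pCons[OF h] ring_mapD(3)[OF h] algebra_simps)
  have "plift h a (p * q) = plift h a p * plift h a q" for p q
    by (induction p) (simp_all add: z add sm plift_pCons[OF h] ring_mapD(4)[OF h] algebra_simps)
  moreover have "plift h a 1 = 1" using plift_const[OF h, of a 1] ring_mapD(1)[OF h] by (simp add: one_pCons)
  ultimately show ?thesis using add by (simp add: ring_map_def)
qed

lemma poly_hom_eq:
  assumes H: "ring_map H" "ring_map H'"
    and c: "\<And>c. H [:c:] = H' [:c:]" and x: "H [:0, 1:] = H' [:0, 1:]"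
  shows "H q = H' q"
proof (induction q)
  case 0
  then show ?case using H by (simp add: ring_mapD(4))
next
  case (pCons c q)
  have eq: "pCons c q = [:c:] + [:0, 1:] * q" by simp
  show ?case
    by (simp only: eq ring_mapD(2,3)[OF H(1)] ring_mapD(2,3)[OF H(2)] assms(3) x pCons(2))
qed

lemma ring_map_pC: "ring_map (\<lambda>c. [:c:])"
  by (simp add: ring_map_def one_pCons)

lemma ring_map_const: "ring_map const"
  by (simp add: ring_map_def const_add const_mult)

lemma ring_map_poly: "ring_map (\<lambda>p. poly p c)"
  by (simp add: ring_map_def)

lemma ring_map_id: "ring_map (\<lambda>x. x)"
  by (simp add: ring_map_def)

section \<open>Partial derivatives and Euler's formula\<close>

lemma lookup_pdiff:
  "Poly_Mapping.lookup (pdiff i p) n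
   = of_nat (Suc (Poly_Mapping.lookup n i)) * Poly_Mapping.lookup p (n + Poly_Mapping.single i 1)"
proof -
  let ?n = "n + Poly_Mapping.single i 1"
  let ?e = "Poly_Mapping.single i (1::nat)"
  have "Poly_Mapping.lookup (pdiff i p) n
    = (\<Sum>m\<in>Poly_Mapping.keys p. if m = ?n then of_nat (Poly_Mapping.lookup m i) * Poly_Mapping.lookup p m else 0)"
    unfolding pdiff_def lookup_sum
  proof (intro sum.cong refl)
    fix m assume "m \<in> Poly_Mapping.keys p"
    show "Poly_Mapping.lookup (Poly_Mapping.single (m - ?e) (of_nat (Poly_Mapping.lookup m i) * Poly_Mapping.lookup p m)) n
      = (if m = ?n then of_nat (Poly_Mapping.lookup m i) * Poly_Mapping.lookup p m else 0)"
    proof (cases "Poly_Mapping.lookup m i = 0")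
      case True
      then have "m \<noteq> ?n" by (auto simp: lookup_add)
      then show ?thesis using True by simp
    next
      case False
      have "m = (m - ?e) + ?e"
        using False by (intro poly_mapping_eqI) (auto simp: lookup_add lookup_minus lookup_single when_def)
      then have "m - ?e = n \<longleftrightarrow> m = ?n" by (metis add_diff_cancel_right')
      then show ?thesis by (simp add: lookup_single when_def)
    qed
  qed
  also have "\<dots> = of_nat (Suc (Poly_Mapping.lookup n i)) * Poly_Mapping.lookup p ?n"
    by (simp add: in_keys_iff lookup_add)
  finally show ?thesis .
qed

lemma pdiff_add: "pdiff i (p + q) = pdiff i p + pdiff i q"
  by (rule poly_mapping_eqI) (simp add: lookup_pdiff lookup_add algebra_simps)

lemma pdiff_zero [simp]: "pdiff i 0 = 0"
  by (simp add: pdiff_def)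

lemma pdiff_single:
  "pdiff i (Poly_Mapping.single m c)
   = Poly_Mapping.single (m - Poly_Mapping.single i 1) (of_nat (Poly_Mapping.lookup m i) * c)"
  by (simp add: pdiff_def)

lemma pdiff_homog:
  assumes "p \<in> homog k" shows "pdiff i p \<in> homog (k - 1)"
  unfolding homog_def
proof (intro CollectI ballI)
  fix n assume "n \<in> Poly_Mapping.keys (pdiff i p)"
  then have "n + Poly_Mapping.single i 1 \<in> Poly_Mapping.keys p"
    by (auto simp: in_keys_iff lookup_pdiff)
  then have "int (mono_degree (n + Poly_Mapping.single i 1)) = k" using assms by (auto simp: homog_def)
  then show "int (mono_degree n) = k - 1" by (simp add: mono_degree_add)
qed

text \<open>The operator acts diagonally on monomials, with the exponents as eigenvalues; summing
  over the variables gives Euler's formula.\<close>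

lemma lookup_var_mult:
  "Poly_Mapping.lookup (var i * pdiff i p) m = of_nat (Poly_Mapping.lookup m i) * Poly_Mapping.lookup p m"
proof (induction p rule: poly_mapping_add_induct)
  case (single n c)
  show ?case
  proof (cases "Poly_Mapping.lookup n i = 0")
    case True
    then show ?thesis by (auto simp: pdiff_single lookup_single when_def)
  next
    case False
    have "Poly_Mapping.single i 1 + (n - Poly_Mapping.single i 1) = n"
      using False by (intro poly_mapping_eqI) (auto simp: lookup_add lookup_minus lookup_single when_def)
    then show ?thesis by (simp add: pdiff_single var_def mult_single lookup_single when_def)
  qed
qed (simp_all add: pdiff_add distrib_left lookup_add)

lemma euler:
  assumes "p \<in> homog (int d)"
  shows "var 0 * pdiff 0 p + var 1 * pdiff 1 p + var 2 * pdiff 2 p = scal (of_nat d) p"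
proof (rule poly_mapping_eqI)
  fix m
  have sc: "Poly_Mapping.lookup (scal c p) m = c * Poly_Mapping.lookup p m" for c
    unfolding scal_def mult_map_scale_conv_mult[symmetric] by (simp add: Poly_Mapping.map.rep_eq when_def)
  have "Poly_Mapping.lookup (var 0 * pdiff 0 p + var 1 * pdiff 1 p + var 2 * pdiff 2 p) m
    = of_nat (mono_degree m) * Poly_Mapping.lookup p m"
    by (simp add: lookup_add lookup_var_mult mono_degree_def sum_UNIV_3 algebra_simps)
  also have "\<dots> = of_nat d * Poly_Mapping.lookup p m"
    using assms by (cases "m \<in> Poly_Mapping.keys p") (auto simp: homog_def in_keys_iff)
  finally show "Poly_Mapping.lookup (var 0 * pdiff 0 p + var 1 * pdiff 1 p + var 2 * pdiff 2 p) m
    = Poly_Mapping.lookup (scal (of_nat d) p) m" by (simp add: sc)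
qed

lemma ev_homog:
  assumes h: "ring_map h" and p: "p \<in> homog (int d)"
  shows "ev h (\<lambda>i. h (c i) * w) p = h (ev (\<lambda>x. x) c p) * w ^ d"
proof -
  have hs: "h (sum g A) = (\<Sum>x\<in>A. h (g x))" for g :: "mono3 \<Rightarrow> complex" and A
    by (induction A rule: infinite_finite_induct) (simp_all add: ring_mapD[OF h])
  have hp: "h (\<Prod>i\<in>UNIV. g i) = (\<Prod>i\<in>UNIV. h (g i))" for g :: "3 \<Rightarrow> complex"
    by (simp add: prod_UNIV_3 ring_mapD[OF h])
  have "ev h (\<lambda>i. h (c i) * w) p
    = (\<Sum>m\<in>Poly_Mapping.keys p. h (Poly_Mapping.lookup p m * (\<Prod>i\<in>UNIV. c i ^ Poly_Mapping.lookup m i)) * w ^ d)"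
    unfolding ev_def
  proof (intro sum.cong refl)
    fix m assume "m \<in> Poly_Mapping.keys p"
    then have "mono_degree m = d" using p by (auto simp: homog_def)
    then have "w ^ d = (\<Prod>i\<in>UNIV. w ^ Poly_Mapping.lookup m i)"
      by (simp add: mono_degree_def sum_UNIV_3 prod_UNIV_3 power_add[symmetric])
    then show "h (Poly_Mapping.lookup p m) * (\<Prod>i\<in>UNIV. (h (c i) * w) ^ Poly_Mapping.lookup m i)
      = h (Poly_Mapping.lookup p m * (\<Prod>i\<in>UNIV. c i ^ Poly_Mapping.lookup m i)) * w ^ d"
      by (simp add: ring_mapD[OF h] hp power_mult_distrib prod.distrib mult.assoc)
  qed
  then show ?thesis by (simp add: ev_def hs sum_distrib_right)
qed

section \<open>A Bezout identity for a squarefree polynomial and its derivative\<close>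

lemma degree_prod_mset_0:
  "(\<forall>p\<in>#A. degree (p::'a::idom poly) = 0) \<Longrightarrow> degree (prod_mset A) = 0"
proof (induction A)
  case (add p A)
  then show ?case using degree_mult_le[of p "prod_mset A"] by simp
qed simp

lemma prime_factor_pos_degree:
  fixes M :: "'a::{factorial_ring_gcd, semiring_gcd_mult_normalize} poly"
  assumes "degree M > 0"
  obtains p where "prime_elem p" "degree p > 0" "p dvd M"
proof -
  have M0: "M \<noteq> 0" using assms by auto
  have "\<exists>p\<in>#prime_factorization M. degree p > 0"
  proof (rule ccontr)
    assume "\<not> ?thesis"
    then have "degree (prod_mset (prime_factorization M)) = 0" by (intro degree_prod_mset_0) auto
    moreover have "M dvd prod_mset (prime_factorization M)"
      using prod_mset_prime_factorization_weak[OF M0] by (metis dvd_refl normalize_dvd_iff dvd_normalize_iff)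
    moreover have "prod_mset (prime_factorization M) \<noteq> 0" by auto
    ultimately show False using dvd_imp_degree_le[of M "prod_mset (prime_factorization M)"] assms by simp
  qed
  then obtain p where p: "p \<in># prime_factorization M" "degree p > 0" by blast
  have "prime p" using p(1) by (rule in_prime_factors_imp_prime)
  then have "prime_elem p" by (rule prime_imp_prime_elem)
  moreover have "p dvd M" using p(1) by (rule in_prime_factors_imp_dvd)
  ultimately show thesis using that p(2) by blast
qed

text \<open>Take a nonzero \<open>M\<close> of least degree in the ideal of \<open>F\<close> and its
  derivative. If \<open>M\<close> were not constant, a prime factor \<open>p\<close> of positive
  degree would divide both \<open>F\<close> and its derivative, and then \<open>p\<^sup>2\<close>
  would divide \<open>F\<close>.\<close>

lemma squarefree_bezout_pderiv:
  fixes F :: "'a::{factorial_ring_gcd, semiring_gcd_mult_normalize, semiring_char_0} poly"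
  assumes F0: "F \<noteq> 0" and sf: "\<And>p. prime_elem p \<Longrightarrow> \<not> p\<^sup>2 dvd F"
  obtains \<alpha> \<beta> D where "D \<noteq> 0" "\<alpha> * F + \<beta> * pderiv F = [:D:]"
proof -
  define Q where "Q = {\<alpha> * F + \<beta> * pderiv F | \<alpha> \<beta>. True}"
  have "F = 1 * F + 0 * pderiv F" by simp
  then have "F \<in> Q" unfolding Q_def by blast
  then have ex: "\<exists>n. \<exists>M\<in>Q. M \<noteq> 0 \<and> degree M = n" using F0 by blast
  from LeastI_ex[OF ex] obtain M where M: "M \<in> Q" "M \<noteq> 0" and "degree M = (LEAST n. \<exists>M\<in>Q. M \<noteq> 0 \<and> degree M = n)"
    by blast
  then have least: "degree M \<le> degree N" if "N \<in> Q" "N \<noteq> 0" for N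
    unfolding \<open>degree M = _\<close> using that by (intro Least_le) blast
  obtain \<alpha> \<beta> where ab: "M = \<alpha> * F + \<beta> * pderiv F" using M by (auto simp: Q_def)
  show thesis
  proof (cases "degree M = 0")
    case True
    then show ?thesis using that M ab by (metis degree_eq_zeroE pCons_0_0)
  next
    case False
    then obtain p where p: "prime_elem p" "degree p > 0" "p dvd M" using prime_factor_pos_degree by blast
    \<comment> \<open>The coefficients need not be invertible, so pseudo-division by
      \<open>M\<close> is used. Its remainder lies in \<open>Q\<close> and vanishes by minimality;
      the factor \<open>a\<close> is a nonzero constant and so not divisible by
      \<open>p\<close>.\<close>
    have pdiv: "p dvd G" if G: "\<And>a q. smult a G - M * q \<in> Q" for G
    proof -
      obtain a q where a: "a \<noteq> 0" "smult a G = M * q + pseudo_mod G M"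
        using pseudo_mod(1)[OF M(2)] by blast
      have "pseudo_mod G M = smult a G - M * q" using a(2) by simp
      then have "pseudo_mod G M = 0"
        using least[of "pseudo_mod G M"] G pseudo_mod(2)[OF M(2), of G] by (metis leD)
      then have "p dvd [:a:] * G" using a p(3) by simp
      moreover have "\<not> p dvd [:a:]"
        using dvd_imp_degree_le[of p "[:a:]"] a(1) p(2) by auto
      ultimately show "p dvd G" using p(1) prime_elem_dvd_mult_iff by blast
    qed
    have "smult a F - M * q = ([:a:] - \<alpha> * q) * F + (- \<beta> * q) * pderiv F" for a q
      unfolding ab by (simp add: algebra_simps)
    then have "smult a F - M * q \<in> Q" for a q unfolding Q_def by blast
    then have "p dvd F" by (rule pdiv)
    have "smult a (pderiv F) - M * q = (- \<alpha> * q) * F + ([:a:] - \<beta> * q) * pderiv F" for a q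
      unfolding ab by (simp add: algebra_simps)
    then have "smult a (pderiv F) - M * q \<in> Q" for a q unfolding Q_def by blast
    then have "p dvd pderiv F" by (rule pdiv)
    obtain q where q: "F = p * q" using \<open>p dvd F\<close> by (elim dvdE)
    have "p dvd pderiv p * q"
      using \<open>p dvd pderiv F\<close> unfolding q pderiv_mult
      by (metis dvd_add_right_iff dvd_triv_left mult.commute)
    \<comment> \<open>In characteristic zero the derivative of \<open>p\<close> is nonzero and has
      smaller degree.\<close>
    moreover have "\<not> p dvd pderiv p"
      using dvd_imp_degree_le[of p "pderiv p"] p(2) pderiv_eq_0_iff[of p] degree_pderiv[of p] by auto
    ultimately have "p dvd q" using p(1) prime_elem_dvd_mult_iff by blast
    then have "p\<^sup>2 dvd F" unfolding q power2_eq_square by simp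
    then show ?thesis using sf p(1) by blast
  qed
qed

section \<open>A line on which the curve is reduced\<close>

text \<open>Nested polynomials make unique factorisation, pseudo-division and differentiation in the
  outermost variable z available for \<open>squarefree_bezout_pderiv\<close>.\<close>

type_synonym poly_xyz = "complex poly poly poly"

definition vec3 :: "'a \<Rightarrow> 'a \<Rightarrow> 'a \<Rightarrow> 3 \<Rightarrow> 'a" where
  "vec3 a b c i = (if i = 0 then a else if i = 1 then b else c)"

lemma vec3_simps [simp]: "vec3 a b c 0 = a" "vec3 a b c 1 = b" "vec3 a b c 2 = c"
  by (simp_all add: vec3_def)

lemma all_3: "(\<forall>i::3. P i) \<longleftrightarrow> P 0 \<and> P 1 \<and> P 2"
  using UNIV_3 by (metis UNIV_I insertE singletonD)

definition const_xyz :: "complex \<Rightarrow> poly_xyz" where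
  "const_xyz c = [:[:[:c:]:]:]"

abbreviation (input) "xvar \<equiv> [:[:[:0, 1:]:]:] :: poly_xyz"
abbreviation (input) "yvar \<equiv> [:[:0, 1:]:] :: poly_xyz"
abbreviation (input) "zvar \<equiv> [:0, 1:] :: poly_xyz"

lemma ring_map_const_xyz: "ring_map const_xyz"
  by (simp add: ring_map_def const_xyz_def one_pCons)

text \<open>A change of coordinates that moves the point \<open>(P0 : P1 : 1)\<close> to
  \<open>(0 : 0 : 1)\<close>, so that lines through this point become lines in the direction of
  z.\<close>

definition to_xyz :: "complex \<Rightarrow> complex \<Rightarrow> poly3 \<Rightarrow> poly_xyz" where
  "to_xyz P0 P1 = ev const_xyz (vec3 (xvar + const_xyz P0 * zvar) (yvar + const_xyz P1 * zvar) zvar)"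

lemma ring_map_to_xyz: "ring_map (to_xyz P0 P1)"
  unfolding to_xyz_def by (rule ring_map_ev[OF ring_map_const_xyz])

lemma to_xyz_simps [simp]:
  "to_xyz P0 P1 (const c) = const_xyz c"
  "to_xyz P0 P1 (var 0) = xvar + const_xyz P0 * zvar"
  "to_xyz P0 P1 (var 1) = yvar + const_xyz P1 * zvar"
  "to_xyz P0 P1 (var 2) = zvar"
  by (simp_all only: to_xyz_def ev_const[OF ring_map_const_xyz] ev_var[OF ring_map_const_xyz] vec3_simps)

definition subst_xyz :: "poly3 \<Rightarrow> poly3 \<Rightarrow> poly3 \<Rightarrow> poly_xyz \<Rightarrow> poly3" where
  "subst_xyz a b c = plift (plift (plift const a) b) c"

lemma ring_map_subst: "ring_map (subst_xyz a b c)" "ring_map (plift (plift const a) b)" "ring_map (plift const a)"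
  unfolding subst_xyz_def by (intro ring_map_plift ring_map_const)+

lemma subst_xyz_simps [simp]:
  "subst_xyz a b c [:D:] = plift (plift const a) b D"
  "subst_xyz a b c (const_xyz z) = const z"
  "subst_xyz a b c xvar = a" "subst_xyz a b c yvar = b" "subst_xyz a b c zvar = c"
  by (simp_all add: subst_xyz_def const_xyz_def ring_map_subst ring_map_const)

lemma subst_to_xyz:
  "subst_xyz (var 0 - const P0 * var 2) (var 1 - const P1 * var 2) (var 2) (to_xyz P0 P1 p) = p"
proof -
  let ?S = "subst_xyz (var 0 - const P0 * var 2) (var 1 - const P1 * var 2) (var 2)"
  show ?thesis
  proof (rule poly3_hom_eq[of "\<lambda>p. ?S (to_xyz P0 P1 p)" "\<lambda>p. p"])
    show "ring_map (\<lambda>p. ?S (to_xyz P0 P1 p))"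
      by (rule ring_map_comp[OF ring_map_subst(1) ring_map_to_xyz])
    have "\<forall>i. ?S (to_xyz P0 P1 (var i)) = var i"
      unfolding all_3 by (simp only: to_xyz_simps ring_mapD(2,3)[OF ring_map_subst(1)] subst_xyz_simps(2-5)) simp
    then show "?S (to_xyz P0 P1 (var i)) = var i" for i by blast
    show "?S (to_xyz P0 P1 (const c)) = const c" for c
      by (simp only: to_xyz_simps subst_xyz_simps(2-5))
  qed (rule ring_map_id)
qed

text \<open>With \<open>subst_to_xyz\<close> this makes \<open>to_xyz\<close> an isomorphism. The
  nesting is peeled from the inside: first x, then y, then z.\<close>

lemma to_subst_xyz:
  "to_xyz P0 P1 (subst_xyz (var 0 - const P0 * var 2) (var 1 - const P1 * var 2) (var 2) q) = q"
proof -
  let ?T = "to_xyz P0 P1" and ?a = "var 0 - const P0 * var 2" and ?b = "var 1 - const P1 * var 2"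
  note T = ring_map_to_xyz[of P0 P1]
  have a: "?T ?a = xvar" and b: "?T ?b = yvar"
    by (simp_all only: ring_mapD(3,5)[OF T] to_xyz_simps) (simp_all add: const_xyz_def)
  have 1: "?T (plift const ?a q) = [:[:q:]:]" for q
  proof (rule poly_hom_eq[of "\<lambda>q. ?T (plift const ?a q)" "\<lambda>q. [:[:q:]:]"])
    show "?T (plift const ?a [:c:]) = [:[:[:c:]:]:]" for c
      by (simp add: ring_map_const) (simp add: const_xyz_def)
    show "?T (plift const ?a [:0, 1:]) = xvar" using a by (simp add: ring_map_const)
  qed (intro ring_map_comp[OF T ring_map_subst(3)] ring_map_comp[OF ring_map_pC ring_map_pC])+
  have 2: "?T (plift (plift const ?a) ?b q) = [:q:]" for q
  proof (rule poly_hom_eq[of "\<lambda>q. ?T (plift (plift const ?a) ?b q)" "\<lambda>q. [:q:]"])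
    show "?T (plift (plift const ?a) ?b [:c:]) = [:[:c:]:]" for c
      using 1[of c] by (simp add: ring_map_subst)
    show "?T (plift (plift const ?a) ?b [:0, 1:]) = yvar" using b by (simp add: ring_map_subst)
  qed (intro ring_map_comp[OF T ring_map_subst(2)] ring_map_pC)+
  show ?thesis
  proof (rule poly_hom_eq[of "\<lambda>q. ?T (subst_xyz ?a ?b (var 2) q)" "\<lambda>q. q"])
    show "?T (subst_xyz ?a ?b (var 2) [:c:]) = [:c:]" for c
      using 2[of c] by simp
    show "?T (subst_xyz ?a ?b (var 2) zvar) = zvar" by (simp only: subst_xyz_simps to_xyz_simps)
  qed (intro ring_map_comp[OF T ring_map_subst(1)] ring_map_id)+
qed

lemma poly_ex_nonzero: "(p::complex poly) \<noteq> 0 \<Longrightarrow> \<exists>c. c \<noteq> 0 \<and> poly p c \<noteq> 0"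
proof -
  assume "p \<noteq> 0"
  \<comment> \<open>The extra factor excludes the value 0 for \<open>c\<close>.\<close>
  then have "p * [:0, 1:] \<noteq> 0" by simp
  then obtain c where "poly (p * [:0, 1:]) c \<noteq> 0" using poly_all_0_iff_0 by blast
  then show ?thesis by auto
qed

lemma plift_ex_nonzero:
  fixes h :: "'a::comm_ring_1 \<Rightarrow> complex"
  assumes h: "ring_map h" and q: "h (lead_coeff q) \<noteq> 0"
  shows "\<exists>c. c \<noteq> 0 \<and> plift h c q \<noteq> 0"
proof -
  have "coeff (map_poly h q) (degree q) \<noteq> 0"
    using q by (simp add: coeff_map_poly ring_mapD(4)[OF h])
  then have "map_poly h q \<noteq> 0" by (metis coeff_0)
  then show ?thesis unfolding plift_def by (rule poly_ex_nonzero)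
qed

lemma poly_xy_ex_nonzero:
  fixes D :: "complex poly poly"
  assumes "D \<noteq> 0"
  obtains c0 c1 where "c0 \<noteq> 0" "plift (\<lambda>p. poly p c0) c1 D \<noteq> 0"
proof -
  obtain c0 where c0: "c0 \<noteq> 0" "poly (lead_coeff D) c0 \<noteq> 0"
    using poly_ex_nonzero[of "lead_coeff D"] assms by auto
  then show thesis using plift_ex_nonzero[OF ring_map_poly c0(2)] that by blast
qed

text \<open>The variables are specialised one after another, each time keeping a leading coefficient
  nonzero. As \<open>c2\<close> is nonzero, homogeneity allows rescaling the last coordinate to
  1.\<close>

lemma homog_nonzero_point:
  assumes f: "f \<in> homog (int d)" "f \<noteq> 0"
  obtains P0 P1 where "ev (\<lambda>x. x) (vec3 P0 P1 1) f \<noteq> 0"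
proof -
  define F where "F = to_xyz 0 0 f"
  have "F \<noteq> 0"
    using subst_to_xyz[of 0 0 f] f(2) ring_mapD(4)[OF ring_map_subst(1)] by (auto simp: F_def)
  then have "lead_coeff F \<noteq> 0" by simp
  then obtain c0 c1 where c01: "plift (\<lambda>p. poly p c0) c1 (lead_coeff F) \<noteq> 0"
    using poly_xy_ex_nonzero by metis
  note h2 = ring_map_plift[OF ring_map_poly, of c0 c1]
  obtain c2 where c2: "c2 \<noteq> 0" "plift (plift (\<lambda>p. poly p c0) c1) c2 F \<noteq> 0"
    using plift_ex_nonzero[OF h2 c01] by blast
  let ?E = "plift (plift (\<lambda>p. poly p c0) c1) c2"
  note h3 = ring_map_plift[OF h2, of c2]
  have k: "?E (const_xyz c) = c" "?E xvar = c0" "?E yvar = c1" "?E zvar = c2" for c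
    by (simp_all add: const_xyz_def h2 ring_map_poly)
  have "?E (to_xyz 0 0 f) = ev (\<lambda>x. x) (vec3 c0 c1 c2) f"
  proof (rule poly3_hom_eq[of "\<lambda>p. ?E (to_xyz 0 0 p)"])
    show "?E (to_xyz 0 0 (const c)) = ev (\<lambda>x. x) (vec3 c0 c1 c2) (const c)" for c
      using k(1) by (simp add: ev_const ring_map_id)
    have "\<forall>i. ?E (to_xyz 0 0 (var i)) = ev (\<lambda>x. x) (vec3 c0 c1 c2) (var i)"
      unfolding all_3
      by (simp only: to_xyz_simps ring_mapD(2,3)[OF h3] k ev_var[OF ring_map_id] vec3_simps) simp
    then show "?E (to_xyz 0 0 (var i)) = ev (\<lambda>x. x) (vec3 c0 c1 c2) (var i)" for i by blast
  qed (intro ring_map_comp[OF h3 ring_map_to_xyz] ring_map_ev ring_map_id)+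
  moreover have "vec3 c0 c1 c2 = (\<lambda>i. vec3 (c0 / c2) (c1 / c2) 1 i * c2)"
    using c2(1) by (auto simp: vec3_def)
  ultimately have "ev (\<lambda>x. x) (vec3 (c0 / c2) (c1 / c2) 1) f * c2 ^ d \<noteq> 0"
    using c2(2) ev_homog[OF ring_map_id f(1), of "vec3 (c0 / c2) (c1 / c2) 1" c2] by (simp add: F_def)
  then show thesis using that by auto
qed

text \<open>The chain rule: the derivative in z corresponds to the derivative of \<open>p\<close> in
  the direction \<open>(P0, P1, 1)\<close>, which gives the polar of the curve at that
  point.\<close>

lemma pderiv_to_xyz:
  "pderiv (to_xyz P0 P1 p)
   = to_xyz P0 P1 (const P0 * pdiff 0 p + const P1 * pdiff 1 p + pdiff 2 p)"
proof (induction p rule: poly_mapping_add_induct)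
  case zero
  then show ?case by (simp add: ring_mapD(4)[OF ring_map_to_xyz])
next
  case (add p q)
  then show ?case
    by (simp add: pdiff_add ring_mapD(2,3)[OF ring_map_to_xyz] pderiv_add distrib_left)
next
  case (single m c)
  let ?A = "xvar + const_xyz P0 * zvar" and ?B = "yvar + const_xyz P1 * zvar"
  let ?a = "Poly_Mapping.lookup m 0" and ?b = "Poly_Mapping.lookup m 1" and ?c = "Poly_Mapping.lookup m 2"
  have T: "to_xyz P0 P1 (Poly_Mapping.single n z) = const_xyz z * (?A ^ Poly_Mapping.lookup n 0
    * ?B ^ Poly_Mapping.lookup n 1 * zvar ^ Poly_Mapping.lookup n 2)" for n z
    unfolding to_xyz_def ev_single[OF ring_map_const_xyz] prod_UNIV_3 vec3_simps ..
  have pA: "pderiv ?A = const_xyz P0" "pderiv ?B = const_xyz P1" "pderiv zvar = 1" "pderiv (const_xyz z) = 0" for z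
    by (simp_all add: const_xyz_def pderiv_add pderiv_pCons one_pCons)
  have pp: "pderiv (w ^ n) = of_nat n * w ^ (n - 1) * pderiv w" for w :: poly_xyz and n
    by (cases n) (simp_all add: pderiv_power_Suc of_nat_poly del: power_Suc of_nat_Suc)
  have cn: "const_xyz (of_nat n) = of_nat n" for n
    by (induction n) (simp_all add: ring_mapD[OF ring_map_const_xyz])
  have lk: "Poly_Mapping.lookup (m - Poly_Mapping.single i 1) j
    = (if i = j then Poly_Mapping.lookup m j - 1 else Poly_Mapping.lookup m j)" for i j
    by (simp add: lookup_minus lookup_single when_def)
  show ?case
    unfolding pdiff_single ring_mapD(2,3)[OF ring_map_to_xyz] T to_xyz_simps(1) lk
      ring_mapD(3)[OF ring_map_const_xyz] cn pderiv_mult pp pA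
    by (simp add: algebra_simps)
qed

text \<open>A square factor is carried back by the inverse substitution, where its root is a unit;
  then \<open>p\<close> would be a unit.\<close>

lemma squarefree_to_xyz:
  assumes f: "squarefree f" and p: "prime_elem p"
  shows "\<not> p\<^sup>2 dvd to_xyz P0 P1 f"
proof
  let ?S = "subst_xyz (var 0 - const P0 * var 2) (var 1 - const P1 * var 2) (var 2)"
  assume "p\<^sup>2 dvd to_xyz P0 P1 f"
  then obtain q where "to_xyz P0 P1 f = p\<^sup>2 * q" by (elim dvdE)
  then have "f = (?S p)\<^sup>2 * ?S q"
    using subst_to_xyz[of P0 P1 f] ring_mapD(3,6)[OF ring_map_subst(1)] by metis
  then have "(?S p)\<^sup>2 dvd f" by simp
  then have "?S p dvd 1" using f by (simp add: squarefree_def)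
  then obtain w where "1 = ?S p * w" by (elim dvdE)
  then have "to_xyz P0 P1 1 = to_xyz P0 P1 (?S p) * to_xyz P0 P1 w"
    using ring_mapD(3)[OF ring_map_to_xyz, of P0 P1 "?S p" w] by metis
  then have "1 = p * to_xyz P0 P1 w" by (simp add: to_subst_xyz ring_mapD(1)[OF ring_map_to_xyz])
  then show False using p by (metis dvd_triv_left prime_elem_def)
qed

lemma hcomp_plift_const:
  assumes u: "u \<in> homog 1"
  shows "hcomp (int k) (plift const u q) = const (coeff q k) * u ^ k"
proof (induction q arbitrary: k)
  case 0
  show ?case by (simp add: plift_def)
next
  case (pCons c q)
  have "hcomp (int k) (plift const u (pCons c q))
    = hcomp (int k) (const c) + hcomp (int k - 1) (plift const u q) * u"
    using hcomp_mult[OF u, of "int k" "plift const u q"]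
    by (simp add: plift_pCons[OF ring_map_const] hcomp_add mult.commute)
  also have "\<dots> = const (coeff (pCons c q) k) * u ^ k"
  proof (cases k)
    case 0
    have "hcomp (- 1) (plift const u q) = 0" using homog_negD[OF hcomp_in_homog] by simp
    then show ?thesis using 0 by (simp add: hcomp_homog[OF homog_const])
  next
    case (Suc n)
    then have "hcomp (int k - 1) (plift const u q) = const (coeff q n) * u ^ n" using pCons.IH[of n] by simp
    then show ?thesis using Suc by (simp add: hcomp_homog[OF homog_const] ac_simps)
  qed
  finally show ?case .
qed

text \<open>Choose \<open>P\<close> off the curve. The Bezout identity in z produces
  \<open>D\<close> in x and y, and the line through \<open>P\<close> is taken so that
  \<open>D\<close> does not vanish identically on it. Restricted to this line, \<open>D\<close> is a
  polynomial in \<open>u\<close> lying in the ideal \<open>?L\<close>, and a homogeneous component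
  of it is a nonzero multiple of a power of \<open>u\<close>.\<close>

lemma exists_good_line:
  assumes f: "f \<in> homog (int d)" "f \<noteq> 0" "squarefree f" "d \<ge> 1"
  obtains P0 P1 \<kappa> N where "ev (\<lambda>x. x) (vec3 P0 P1 1) f \<noteq> 0"
    "(var 0 - const P0 * var 2) ^ N \<in> ideal2 (ideal2 (ideal2 {0}
       (const P0 * pdiff 0 f + const P1 * pdiff 1 f + pdiff 2 f)) (pdiff 0 f + const \<kappa> * pdiff 1 f))
       (var 1 - const P1 * var 2 - const \<kappa> * (var 0 - const P0 * var 2))"
proof -
  obtain P0 P1 where P: "ev (\<lambda>x. x) (vec3 P0 P1 1) f \<noteq> 0" using homog_nonzero_point[OF f(1,2)] .
  let ?T = "to_xyz P0 P1"
  let ?u = "var 0 - const P0 * var 2"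
  let ?g1 = "const P0 * pdiff 0 f + const P1 * pdiff 1 f + pdiff 2 f"
  have T0: "?T f \<noteq> 0"
    using subst_to_xyz[of P0 P1 f] f(2) ring_mapD(4)[OF ring_map_subst(1)] by metis
  obtain \<alpha> \<beta> D where D: "D \<noteq> 0" "\<alpha> * ?T f + \<beta> * pderiv (?T f) = [:D:]"
    using squarefree_bezout_pderiv[OF T0 squarefree_to_xyz[OF f(3)]] .
  obtain c0 c1 where c: "c0 \<noteq> 0" "plift (\<lambda>p. poly p c0) c1 D \<noteq> 0" using poly_xy_ex_nonzero[OF D(1)] .
  \<comment> \<open>In the shifted coordinates the line \<open>y = \<kappa> * x\<close> passes
    through \<open>(c0, c1)\<close>, where \<open>D\<close> is nonzero.\<close>
  define \<kappa> where "\<kappa> = c1 / c0"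
  let ?l = "var 1 - const P1 * var 2 - const \<kappa> * ?u"
  let ?g2 = "pdiff 0 f + const \<kappa> * pdiff 1 f"
  let ?L = "ideal2 (ideal2 (ideal2 {0} ?g1) ?g2) ?l"
  have uh: "?u \<in> homog 1"
    using homog_diff[OF homog_var, of "const P0 * var 2" 0] homog_mult[OF homog_const homog_var, of P0 2] by simp
  have lh: "?l \<in> homog 1"
    using homog_diff[OF homog_diff[OF homog_var, of "const P1 * var 2" 1], of "const \<kappa> * ?u"]
      homog_mult[OF homog_const homog_var, of P1 2] homog_mult[OF homog_const uh, of \<kappa>] by simp
  have ph: "const c * pdiff i f \<in> homog (int d - 1)" for c i
    using homog_mult[OF homog_const pdiff_homog[OF f(1)]] by simp
  have g1h: "?g1 \<in> homog (int d - 1)" and g2h: "?g2 \<in> homog (int d - 1)"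
    using homog_add[OF homog_add[OF ph ph] pdiff_homog[OF f(1)]] homog_add[OF pdiff_homog[OF f(1)] ph] by blast+
  have iL: "is_ideal ?L" by (intro is_ideal_ideal2 ideal_zero_set)
  have gL: "graded ?L" using g1h g2h lh by (intro graded_ideal2 ideal_zero_set)
  have inL: "?g1 * x + ?g2 * y + ?l * z \<in> ?L" for x y z using in_ideal3 by blast
  have lL: "?l * x \<in> ?L" for x using inL[of 0 0 x] by simp
  have g1L: "?g1 \<in> ?L" using inL[of 1 0 0] by simp
  \<comment> \<open>Euler's formula rewritten in the new generators.\<close>
  have fL: "f \<in> ?L"
  proof -
    have "scal (of_nat d) f = ?g1 * var 2 + ?g2 * ?u + ?l * pdiff 1 f"
      unfolding euler[OF f(1), symmetric] by (simp add: algebra_simps)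
    then have "const (1 / of_nat d) * scal (of_nat d) f \<in> ?L" using inL ideal_mult[OF iL] by metis
    moreover have "const (1 / of_nat d * of_nat d) = 1" using f(4) by simp
    then have "const (1 / of_nat d) * scal (of_nat d) f = f"
      unfolding const_mult scal_def mult.assoc[symmetric] by simp
    ultimately show ?thesis by simp
  qed
  \<comment> \<open>Setting \<open>y = \<kappa> * x\<close> after the change of coordinates is
    restriction to the line \<open>?l = 0\<close>; thus \<open>?S (?T p)\<close> agrees with
    \<open>p\<close> modulo \<open>?l\<close>.\<close>
  let ?S = "subst_xyz ?u (const \<kappa> * ?u) (var 2)"
  note S = ring_map_subst(1)[of ?u "const \<kappa> * ?u" "var 2"]
  have ST: "p - ?S (?T p) \<in> ideal2 {0} ?l" for p
  proof (rule poly3_hom_cong[of "\<lambda>p. ?S (?T p)"])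
    show "ring_map (\<lambda>p. ?S (?T p))" by (rule ring_map_comp[OF S ring_map_to_xyz])
    show "is_ideal (ideal2 {0} ?l)" by (intro is_ideal_ideal2 ideal_zero_set)
    show "?S (?T (const c)) = const c" for c by (simp only: to_xyz_simps subst_xyz_simps(2-5))
    have "?S (?T (var 0)) = var 0" "?S (?T (var 1)) = var 1 - ?l" "?S (?T (var 2)) = var 2"
      by (simp_all only: to_xyz_simps ring_mapD(2,3)[OF S] subst_xyz_simps(2-5)) simp_all
    then have "var 0 - ?S (?T (var 0)) = ?l * 0" "var 1 - ?S (?T (var 1)) = ?l * 1"
      "var 2 - ?S (?T (var 2)) = ?l * 0" by simp_all
    then have "\<forall>i. var i - ?S (?T (var i)) \<in> ideal2 {0} ?l" unfolding all_3 in_ideal1 by blast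
    then show "var i - ?S (?T (var i)) \<in> ideal2 {0} ?l" for i by blast
  qed
  have SL: "?S (?T p) \<in> ?L" if p: "p \<in> ?L" for p
  proof -
    obtain h where "p - ?S (?T p) = ?l * h" using ST[of p] in_ideal1 by blast
    then have "?S (?T p) = p - ?l * h" by (simp add: algebra_simps)
    then show ?thesis using ideal_diff[OF iL p lL] by simp
  qed
  \<comment> \<open>\<open>q\<close> is the restriction of \<open>D\<close> to the line, as a
    polynomial in one variable; its value at \<open>c0\<close> is that of \<open>D\<close> at
    \<open>(c0, c1)\<close>.\<close>
  define q where "q = plift (\<lambda>p. p) [:0, \<kappa>:] D"
  have "plift const ?u q = ?S [:D:]"
    unfolding q_def subst_xyz_simps(1)
  proof (rule poly_hom_eq[of "\<lambda>D. plift const ?u (plift (\<lambda>p. p) [:0, \<kappa>:] D)"])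
    show "ring_map (\<lambda>D. plift const ?u (plift (\<lambda>p. p) [:0, \<kappa>:] D))"
      by (rule ring_map_comp[OF ring_map_subst(3) ring_map_plift[OF ring_map_id]])
    show "ring_map (plift (plift const ?u) (const \<kappa> * ?u))" by (rule ring_map_subst)
    show "plift const ?u (plift (\<lambda>p. p) [:0, \<kappa>:] [:c:]) = plift (plift const ?u) (const \<kappa> * ?u) [:c:]" for c
      by (simp only: plift_const[OF ring_map_id] plift_const[OF ring_map_subst(3)])
    show "plift const ?u (plift (\<lambda>p. p) [:0, \<kappa>:] [:0, 1:]) = plift (plift const ?u) (const \<kappa> * ?u) [:0, 1:]"
      by (simp only: plift_X[OF ring_map_id] plift_X[OF ring_map_subst(3)] plift_pCons[OF ring_map_const]
          plift_const[OF ring_map_const]) (simp add: plift_def)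
  qed
  also have "\<dots> = ?S \<alpha> * ?S (?T f) + ?S \<beta> * ?S (?T ?g1)"
    unfolding D(2)[symmetric] pderiv_to_xyz ring_mapD(2,3)[OF S] ..
  also have "\<dots> \<in> ?L" by (intro ideal_add[OF iL] ideal_mult[OF iL] SL fL g1L)
  finally have qL: "plift const ?u q \<in> ?L" .
  have "poly q c0 = plift (\<lambda>p. poly p c0) c1 D"
    unfolding q_def
  proof (rule poly_hom_eq[of "\<lambda>D. poly (plift (\<lambda>p. p) [:0, \<kappa>:] D) c0"])
    show "ring_map (\<lambda>D. poly (plift (\<lambda>p. p) [:0, \<kappa>:] D) c0)"
      by (rule ring_map_comp[OF ring_map_poly ring_map_plift[OF ring_map_id]])
    show "ring_map (plift (\<lambda>p. poly p c0) c1)" by (rule ring_map_plift[OF ring_map_poly])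
    show "poly (plift (\<lambda>p. p) [:0, \<kappa>:] [:c:]) c0 = plift (\<lambda>p. poly p c0) c1 [:c:]" for c
      by (simp only: plift_const[OF ring_map_id] plift_const[OF ring_map_poly])
    show "poly (plift (\<lambda>p. p) [:0, \<kappa>:] [:0, 1:]) c0 = plift (\<lambda>p. poly p c0) c1 [:0, 1:]"
      using c(1) by (simp only: plift_X[OF ring_map_id] plift_X[OF ring_map_poly]) (simp add: \<kappa>_def)
  qed
  then have "q \<noteq> 0" using c(2) by auto
  \<comment> \<open>\<open>?L\<close> is graded, so it contains the component of degree
    \<open>N\<close>, whose coefficient is nonzero.\<close>
  define N where "N = degree q"
  have "const (coeff q N) * ?u ^ N \<in> ?L"
    using gL qL hcomp_plift_const[OF uh, of N q] unfolding graded_def by metis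
  then have "const (1 / coeff q N) * (const (coeff q N) * ?u ^ N) \<in> ?L" by (rule ideal_mult[OF iL])
  moreover have "const (1 / coeff q N) * (const (coeff q N) * ?u ^ N) = ?u ^ N"
    using \<open>q \<noteq> 0\<close> by (simp add: N_def mult.assoc[symmetric] const_mult[symmetric])
  ultimately show thesis using that[OF P, of N \<kappa>] by simp
qed

section \<open>The Jacobian ideal of a reduced curve\<close>

lemma is_ideal_ideal_gen: "is_ideal (ideal_gen B)"
  unfolding ideal_gen_def
  by (intro is_idealI module.span_zero[OF module_mult] module.span_add[OF module_mult]
      module.span_scale[OF module_mult])

lemma ideal_gen_superset: "B \<subseteq> ideal_gen B"
  unfolding ideal_gen_def by (rule module.span_superset[OF module_mult])

lemma ideal_gen_minimal:
  assumes "is_ideal T" "B \<subseteq> T" shows "ideal_gen B \<subseteq> T"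
  unfolding ideal_gen_def using assms
  by (intro module.span_minimal[OF module_mult]) (auto simp: module.subspace_def[OF module_mult] is_ideal_def)

lemma ideal_gen_3: "ideal_gen {a, b, c} = ideal2 (ideal2 (ideal2 {0} a) b) c"
proof
  have "a * 1 + b * 0 + c * 0 = a" "a * 0 + b * 1 + c * 0 = b" "a * 0 + b * 0 + c * 1 = c" by simp_all
  then have "{a, b, c} \<subseteq> ideal2 (ideal2 (ideal2 {0} a) b) c"
    using in_ideal3 by (metis empty_subsetI insert_subset)
  then show "ideal_gen {a, b, c} \<subseteq> ideal2 (ideal2 (ideal2 {0} a) b) c"
    by (intro ideal_gen_minimal is_ideal_ideal2 ideal_zero_set)
  note g = is_ideal_ideal_gen[of "{a, b, c}"] ideal_gen_superset[of "{a, b, c}"]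
  have "a * x + b * y + c * z \<in> ideal_gen {a, b, c}" for x y z
    using g(2) by (intro ideal_add[OF g(1)] ideal_mult2[OF g(1)]) auto
  then show "ideal2 (ideal2 (ideal2 {0} a) b) c \<subseteq> ideal_gen {a, b, c}"
    by (auto simp: in_ideal3)
qed

section \<open>Saturation, quotient dimensions and degrees of subschemes\<close>

lemma homog_subset_ideal_pow: "homog (int k) \<subseteq> ideal_pow max_ideal k"
proof (induction k)
  case (Suc k)
  let ?I = "ideal_pow max_ideal (Suc k)"
  have iI: "is_ideal ?I" by (simp add: is_ideal_ideal_gen)
  have m: "var 0 \<in> max_ideal" "var 1 \<in> max_ideal" "var 2 \<in> max_ideal"
    using ideal_gen_superset[of "{var 0, var 1, var 2}"] by (auto simp: max_ideal_def)
  have vI: "w * a \<in> ?I" if "w \<in> max_ideal" "a \<in> homog (int k)" for w a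
  proof -
    have "w * a \<in> {a * b | a b. a \<in> max_ideal \<and> b \<in> ideal_pow max_ideal k}" using that Suc.IH by blast
    then show ?thesis unfolding ideal_pow.simps by (rule subsetD[OF ideal_gen_superset])
  qed
  show ?case
  proof
    fix p assume "p \<in> homog (int (Suc k))"
    then obtain a b c where "a \<in> homog (int k)" "b \<in> homog (int k)" "c \<in> homog (int k)"
      "p = var 0 * a + var 1 * b + var 2 * c"
      using homog_Suc_decomp[of p "int k"] by (auto simp: add.commute)
    then show "p \<in> ?I" using vI m ideal_add[OF iI] by simp
  qed
qed simp

text \<open>A power of the maximal ideal is generated by the forms of the matching degree. The
  induction moves one variable at a time from \<open>q\<close> to \<open>p\<close>.\<close>

lemma ideal_pow_mult:
  assumes "is_ideal T" "\<forall>q\<in>homog (int k). q * p \<in> T" "q \<in> ideal_pow max_ideal k"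
  shows "q * p \<in> T"
  using assms
proof (induction k arbitrary: p q)
  case 0
  have "1 * p \<in> T" using 0(2) homog_const[of 1] by auto
  then show ?case using ideal_mult[OF 0(1)] by simp
next
  case (Suc k)
  note iT = Suc.prems(1)
  have col: "is_ideal {y. z * y \<in> T}" for z using is_ideal_colon[OF iT] .
  have ab: "a * b * p \<in> T" if a: "a \<in> max_ideal" and b: "b \<in> ideal_pow max_ideal k" for a b
  proof -
    have v: "b * (var i * p) \<in> T" for i
    proof (rule Suc.IH[OF iT _ b])
      show "\<forall>q\<in>homog (int k). q * (var i * p) \<in> T"
      proof
        fix q assume "q \<in> homog (int k)"
        then have "q * var i \<in> homog (int (Suc k))" using homog_mult[of q "int k" "var i" 1] homog_var by (simp add: add.commute)
        then show "q * (var i * p) \<in> T" using Suc.prems(2) by (metis mult.assoc)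
      qed
    qed
    have "{var 0, var 1, var 2} \<subseteq> {y. (b * p) * y \<in> T}"
      using v[of 0] v[of 1] v[of 2] by (auto simp: ac_simps)
    then have "max_ideal \<subseteq> {y. (b * p) * y \<in> T}" unfolding max_ideal_def by (rule ideal_gen_minimal[OF col])
    then show ?thesis using a by (auto simp: ac_simps)
  qed
  have "ideal_gen {a * b | a b. a \<in> max_ideal \<and> b \<in> ideal_pow max_ideal k} \<subseteq> {y. p * y \<in> T}"
  proof (rule ideal_gen_minimal[OF col])
    show "{a * b | a b. a \<in> max_ideal \<and> b \<in> ideal_pow max_ideal k} \<subseteq> {y. p * y \<in> T}"
      using ab by (auto simp: mult.commute[of p])
  qed
  then show ?case using Suc.prems(3) by (auto simp: mult.commute[of p])
qed

lemma saturation_eq_sat: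
  assumes "is_ideal T" shows "saturation T = sat T"
proof -
  have "(\<forall>q\<in>ideal_pow max_ideal k. q * p \<in> T) \<longleftrightarrow> (\<forall>q\<in>homog (int k). q * p \<in> T)" for k p
    using ideal_pow_mult[OF assms] homog_subset_ideal_pow by blast
  then show ?thesis by (simp add: saturation_def sat_def)
qed

text \<open>All relative bases have the same size by \<open>dim_rel_basis\<close>, so the
  description in \<open>quot_dim\<close> has a unique solution.\<close>

lemma quot_dim_eq:
  assumes U: "vs.fin_dim U" and W: "vs.subspace W" "W \<subseteq> U"
  shows "int (quot_dim U W) = int (vs.dim U) - int (vs.dim W)"
proof -
  have d: "vs.dim U = vs.dim W + card B" if "vs.rel_basis W U B" for B
    using vs.dim_rel_basis[OF vs.fin_dim_subset[OF U W] vs.fin_dim_subspace[OF U] W(2) that] .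
  obtain B where B: "vs.rel_basis W U B" using vs.rel_basis_exists[OF U W] .
  have "quot_dim U W = card B"
    unfolding quot_dim_def
  proof (rule the_equality)
    show "\<exists>B'. B' \<subseteq> U \<and> finite B' \<and> card B' = card B \<and>
      (\<forall>c. (\<Sum>b\<in>B'. scal (c b) b) \<in> W \<longrightarrow> (\<forall>b\<in>B'. c b = 0)) \<and>
      (\<forall>u\<in>U. \<exists>c. u - (\<Sum>b\<in>B'. scal (c b) b) \<in> W)"
      using B unfolding vs.rel_basis_def by blast
    fix n assume "\<exists>B'. B' \<subseteq> U \<and> finite B' \<and> card B' = n \<and>
      (\<forall>c. (\<Sum>b\<in>B'. scal (c b) b) \<in> W \<longrightarrow> (\<forall>b\<in>B'. c b = 0)) \<and>
      (\<forall>u\<in>U. \<exists>c. u - (\<Sum>b\<in>B'. scal (c b) b) \<in> W)"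
    then obtain B' where B': "vs.rel_basis W U B'" "card B' = n" unfolding vs.rel_basis_def by blast
    show "n = card B" using d[OF B] d[OF B'(1)] B'(2) by simp
  qed
  then show ?thesis using d[OF B] by simp
qed

lemma hilbert_fun_eq_codim:
  assumes "is_ideal T" shows "int (hilbert_fun T k) = codim T k"
proof -
  have "vs.subspace (T \<inter> homog k)" using fin_dim_ideal[OF assms] vs.fin_dim_subspace by blast
  then show ?thesis
    using quot_dim_eq[OF fin_dim_homog[of k], of "T \<inter> homog k"] dim_homog[of k]
    by (simp add: hilbert_fun_def codim_def)
qed

text \<open>A polynomial equal to a constant at infinitely many integers is that constant, so the
  Hilbert polynomial has degree 0.\<close>

lemma subscheme_degree_eventually_const:
  assumes T: "is_ideal T" and ev: "\<forall>k\<ge>k0. codim T k = c"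
  shows "subscheme_degree T = of_int c"
proof -
  have hf: "(of_nat (hilbert_fun T (int k)) :: rat) = of_int c" if "int k \<ge> k0" for k
    using hilbert_fun_eq_codim[OF T, of "int k"] ev that by (metis of_int_of_nat_eq)
  have large: "\<forall>\<^sub>F k in sequentially. int k \<ge> k0"
    using eventually_ge_at_top[of "nat k0"] by eventually_elim linarith
  have "hilbert_poly T = [:of_int c:]"
    unfolding hilbert_poly_def
  proof (rule the_equality)
    show "\<forall>\<^sub>F k in sequentially. poly [:of_int c:] (of_nat k) = (of_nat (hilbert_fun T (int k)) :: rat)"
      using large by eventually_elim (simp add: hf)
    fix P :: "rat poly"
    assume "\<forall>\<^sub>F k in sequentially. poly P (of_nat k) = of_nat (hilbert_fun T (int k))"
    with large have "\<forall>\<^sub>F k in sequentially. poly (P - [:of_int c:]) (of_nat k) = 0"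
      by eventually_elim (simp add: hf)
    then obtain n where n: "\<forall>k\<ge>n. poly (P - [:of_int c:]) (of_nat k) = 0"
      by (auto simp: eventually_sequentially)
    have "infinite (of_nat ` {n..} :: rat set)"
      by (simp add: finite_image_iff inj_on_def infinite_Ici)
    moreover have "of_nat ` {n..} \<subseteq> {x. poly (P - [:of_int c:]) x = 0}" using n by auto
    ultimately have "P - [:of_int c:] = 0" using poly_roots_finite infinite_super by blast
    then show "P = [:of_int c:]" by simp
  qed
  then show ?thesis by (simp add: subscheme_degree_def)
qed

section \<open>Jacobian syzygies and the choice of the three forms\<close>

lemma mdr_le:
  assumes f: "f \<in> homog (int d)" and d: "d \<ge> 1"
  shows "mdr f \<le> d - 1"
proof -
  have h: "pdiff i f \<in> homog (int (d - 1))" for i using pdiff_homog[OF f] d by (simp add: of_nat_diff)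
  have "jac_syz_deg f (d - 1) \<noteq> {(0, 0, 0)}"
  \<comment> \<open>The Koszul syzygy of the first two derivatives is nonzero unless both vanish; in
    that case any form of degree \<open>d - 1\<close> in the first place is a syzygy.\<close>
  proof (cases "pdiff 0 f = 0 \<and> pdiff 1 f = 0")
    case True
    let ?q = "var 0 ^ (d - 1)"
    have "var i \<noteq> 0" for i
      by (simp add: var_def) (metis lookup_single_eq lookup_zero zero_neq_one)
    then have "?q \<noteq> 0" by simp
    moreover have "?q \<in> homog (int (d - 1))" by (rule power_homog[OF homog_var])
    then have "(?q, 0, 0) \<in> jac_syz_deg f (d - 1)" using True by (simp add: jac_syz_deg_def jac_syz_def)
    ultimately show ?thesis by blast
  next
    case False
    have "(pdiff 1 f, - pdiff 0 f, 0) \<in> jac_syz_deg f (d - 1)"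
      using h homog_uminus by (simp add: jac_syz_deg_def jac_syz_def)
    then show ?thesis using False by auto
  qed
  then show ?thesis unfolding mdr_def by (rule Least_le)
qed

lemma syzygy_below_mdr:
  assumes "a \<in> homog k" "b \<in> homog k" "c \<in> homog k" "k < int (mdr f)"
    and "a * pdiff 0 f + b * pdiff 1 f + c * pdiff 2 f = 0"
  shows "a = 0 \<and> b = 0 \<and> c = 0"
proof (cases "k < 0")
  case True
  then show ?thesis using assms homog_negD by blast
next
  case False
  then obtain n where n: "k = int n" using nonneg_int_cases by (metis linorder_not_less)
  then have "jac_syz_deg f n = {(0, 0, 0)}"
    using not_less_Least[of n "\<lambda>k. jac_syz_deg f k \<noteq> {(0, 0, 0)}"] assms(4) by (simp add: mdr_def)
  moreover have "(a, b, c) \<in> jac_syz_deg f n" using assms n by (simp add: jac_syz_deg_def jac_syz_def)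
  ultimately show ?thesis by auto
qed

text \<open>The line of \<open>exists_good_line\<close> supplies \<open>l\<close>, \<open>u\<close>
  and the three combinations of the derivatives; the two triples are related by an invertible linear
  substitution, so they generate the same ideal.\<close>

lemma jacobian_three_forms:
  assumes C: "reduced_curve f d" and dr: "d \<le> 2 * mdr f"
  obtains g1 g2 g3 l u v where "three_forms g1 g2 g3 l u v (int d - 1) (int (mdr f))"
    "three_forms.J g1 g2 g3 = jac_ideal f"
proof -
  have f: "f \<in> homog (int d)" "f \<noteq> 0" "squarefree f" "d \<ge> 1"
    using C by (auto simp: reduced_curve_def)
  obtain P0 P1 \<kappa> N where P: "ev (\<lambda>x. x) (vec3 P0 P1 1) f \<noteq> 0"
    and N: "(var 0 - const P0 * var 2) ^ N \<in> ideal2 (ideal2 (ideal2 {0}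
       (const P0 * pdiff 0 f + const P1 * pdiff 1 f + pdiff 2 f)) (pdiff 0 f + const \<kappa> * pdiff 1 f))
       (var 1 - const P1 * var 2 - const \<kappa> * (var 0 - const P0 * var 2))"
    using exists_good_line[OF f] .
  define u where "u = var 0 - const P0 * var 2"
  define v where "v = var 2"
  define l where "l = var 1 - const P1 * v - const \<kappa> * u"
  define g1 where "g1 = const P0 * pdiff 0 f + const P1 * pdiff 1 f + pdiff 2 f"
  define g2 where "g2 = pdiff 0 f + const \<kappa> * pdiff 1 f"
  define g3 where "g3 = pdiff 1 f"
  have ph: "pdiff i f \<in> homog (int d - 1)" for i by (rule pdiff_homog[OF f(1)])
  have ch: "const c * p \<in> homog k" if "p \<in> homog k" for c p k
    using homog_mult[OF homog_const that] by simp
  have g: "g1 \<in> homog (int d - 1)" "g2 \<in> homog (int d - 1)" "g3 \<in> homog (int d - 1)"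
    unfolding g1_def g2_def g3_def by (intro homog_add ch ph)+
  have luv: "l \<in> homog 1" "u \<in> homog 1" "v \<in> homog 1"
    unfolding l_def u_def v_def by (intro homog_diff ch homog_var)+
  have var0: "var 0 = u + const P0 * v" and var1: "var 1 = l + const \<kappa> * u + const P1 * v"
    and var2: "var 2 = v"
    by (simp_all add: l_def u_def v_def)
  \<comment> \<open>\<open>\<pi>\<close> restricts to the line \<open>l = 0\<close> and
    \<open>\<rho>\<close> to the point \<open>P\<close>. Their kernels are the ideals of the line
    and of the point, which are therefore prime.\<close>
  define \<pi> where "\<pi> = ev const (vec3 (var 0) (var 1 - l) (var 2))"
  define \<rho> where "\<rho> = ev const (\<lambda>i. const (vec3 P0 P1 1 i) * v)"
  have r\<pi>: "ring_map \<pi>" and r\<rho>: "ring_map \<rho>"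
    unfolding \<pi>_def \<rho>_def by (intro ring_map_ev ring_map_const)+
  have \<pi>v: "\<pi> (const c) = const c" "\<pi> (var 0) = var 0" "\<pi> (var 1) = var 1 - l" "\<pi> (var 2) = var 2" for c
    by (simp_all only: \<pi>_def ev_const[OF ring_map_const] ev_var[OF ring_map_const] vec3_simps)
  have \<rho>v: "\<rho> (const c) = const c" "\<rho> (var 0) = const P0 * v" "\<rho> (var 1) = const P1 * v" "\<rho> (var 2) = const 1 * v" for c
    by (simp_all only: \<rho>_def ev_const[OF ring_map_const] ev_var[OF ring_map_const] vec3_simps)
  have \<pi>u: "\<pi> u = u" "\<pi> v = v"
    unfolding u_def v_def by (simp_all only: \<pi>v ring_mapD[OF r\<pi>])
  have \<pi>l: "\<pi> l = 0"
    unfolding l_def[unfolded v_def] ring_mapD(3,5)[OF r\<pi>] \<pi>v \<pi>u by (simp add: l_def v_def)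
  have \<rho>u: "\<rho> u = 0" "\<rho> v = v"
    unfolding u_def v_def ring_mapD(3,5)[OF r\<rho>] \<rho>v by (simp_all add: v_def)
  have \<rho>l: "\<rho> l = 0"
    unfolding l_def ring_mapD(3,5)[OF r\<rho>] \<rho>v \<rho>u by simp
  have l_dvd: "l dvd p \<longleftrightarrow> \<pi> p = 0" for p
  proof
    show "l dvd p \<Longrightarrow> \<pi> p = 0" by (auto simp: ring_mapD(3)[OF r\<pi>] \<pi>l elim!: dvdE)
    have "var 0 - \<pi> (var 0) = l * 0" "var 1 - \<pi> (var 1) = l * 1" "var 2 - \<pi> (var 2) = l * 0"
      using \<pi>v by simp_all
    then have v: "\<forall>i. var i - \<pi> (var i) \<in> ideal2 {0} l" unfolding all_3 in_ideal1 by blast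
    have "p - \<pi> p \<in> ideal2 {0} l"
      using spec[OF v] by (rule poly3_hom_cong[OF r\<pi> is_ideal_ideal2[OF ideal_zero_set(1)] \<pi>v(1)])
    then show "\<pi> p = 0 \<Longrightarrow> l dvd p" unfolding in_ideal1 by auto
  qed
  have in_lu: "p \<in> ideal2 (ideal2 {0} l) u \<longleftrightarrow> \<rho> p = 0" for p
  proof
    show "p \<in> ideal2 (ideal2 {0} l) u \<Longrightarrow> \<rho> p = 0"
      unfolding in_ideal2 by (auto simp: ring_mapD(2,3)[OF r\<rho>] \<rho>l \<rho>u)
    have "var 0 - \<rho> (var 0) = l * 0 + u * 1" "var 1 - \<rho> (var 1) = l * 1 + u * const \<kappa>"
      "var 2 - \<rho> (var 2) = l * 0 + u * 0"
      unfolding \<rho>v by (simp_all add: var0 var1 var2)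
    then have v: "\<forall>i. var i - \<rho> (var i) \<in> ideal2 (ideal2 {0} l) u" unfolding all_3 in_ideal2 by blast
    have "p - \<rho> p \<in> ideal2 (ideal2 {0} l) u"
      using spec[OF v] by (rule poly3_hom_cong[OF r\<rho> is_ideal_ideal2[OF is_ideal_ideal2[OF ideal_zero_set(1)]] \<rho>v(1)])
    then show "\<rho> p = 0 \<Longrightarrow> p \<in> ideal2 (ideal2 {0} l) u" by simp
  qed
  note E = ring_mapD(3,5)[OF ring_map_ev[OF ring_map_id]] ev_const[OF ring_map_id] ev_var[OF ring_map_id] vec3_simps
  have "ev (\<lambda>x. x) (vec3 1 0 0) u = 1" "ev (\<lambda>x. x) (vec3 0 1 0) l = 1" "ev (\<lambda>x. x) (vec3 0 0 1) v = 1"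
    unfolding l_def u_def v_def E by simp_all
  then have u0: "u \<noteq> 0" and l0: "l \<noteq> 0" and v0: "v \<noteq> 0"
    using ring_mapD(4)[OF ring_map_ev[OF ring_map_id]] by (metis zero_neq_one)+
  define pt where "pt p = ev (\<lambda>x. x) (vec3 P0 P1 1) p" for p
  have \<rho>h: "\<rho> p = const (pt p) * v ^ n" if "p \<in> homog (int n)" for p n
    unfolding \<rho>_def pt_def by (rule ev_homog[OF ring_map_const that])
  have ge: "\<rho> p = const (pt p) * v ^ (d - 1)" if "p \<in> homog (int d - 1)" for p
    using \<rho>h[of p "d - 1"] that f(4) by (simp add: of_nat_diff)
  \<comment> \<open>At \<open>P\<close> Euler's formula reduces to \<open>v * g1\<close>; since
    \<open>f\<close> does not vanish at \<open>P\<close>, neither does \<open>g1\<close>.\<close>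
  have eu: "scal (of_nat d) f = u * g2 + v * g1 + l * pdiff 1 f"
    unfolding euler[OF f(1), symmetric] g1_def g2_def var0 var1 var2 by (simp add: algebra_simps)
  have "\<rho> (scal (of_nat d) f) = v * \<rho> g1"
    unfolding eu ring_mapD(2,3)[OF r\<rho>] \<rho>u \<rho>l by simp
  moreover have "\<rho> (scal (of_nat d) f) = const (of_nat d) * (const (pt f) * v ^ d)"
    unfolding scal_def ring_mapD(3)[OF r\<rho>] \<rho>v \<rho>h[OF f(1)] ..
  moreover have "const z = 0 \<longleftrightarrow> z = 0" for z by (metis const_simps(1) lookup_single_eq)
  then have "const (of_nat d) * (const (pt f) * v ^ d) \<noteq> 0" using P v0 f(4) unfolding pt_def by simp
  ultimately have \<rho>g1: "\<rho> g1 \<noteq> 0" by auto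
  then have ptg1: "pt g1 \<noteq> 0" using ge[OF g(1)] by auto
  have tf: "three_forms g1 g2 g3 l u v (int d - 1) (int (mdr f))"
  proof
    show "int (mdr f) \<le> int d - 1" using mdr_le[OF f(1,4)] f(4) by linarith
    \<comment> \<open>For \<open>d = 1\<close> the bound \<open>mdr f \<le> d - 1\<close> would
      contradict \<open>d \<le> 2 * mdr f\<close>.\<close>
    show "1 \<le> int d - 1" using mdr_le[OF f(1,4)] f(4) dr by linarith
    show "int d - 1 + 1 \<le> 2 * int (mdr f)" using dr by linarith
  next
    fix p k assume pk: "p \<in> homog (k + 1)" "k \<ge> (0::int)"
    obtain a b c where abc: "a \<in> homog k" "b \<in> homog k" "c \<in> homog k"
      "p = var 0 * a + var 1 * b + var 2 * c" using homog_Suc_decomp[OF pk] by blast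
    have "p = l * b + u * (a + const \<kappa> * b) + v * (const P0 * a + const P1 * b + c)"
      unfolding abc(4) var0 var1 var2 by (simp add: algebra_simps)
    moreover have "a + const \<kappa> * b \<in> homog k" "const P0 * a + const P1 * b + c \<in> homog k"
      using abc by (auto intro!: homog_add ch)
    ultimately show "\<exists>a b c. a \<in> homog k \<and> b \<in> homog k \<and> c \<in> homog k \<and> p = l * a + u * b + v * c"
      using abc(2) by blast
  next
    fix a b assume "l dvd a * b"
    then show "l dvd a \<or> l dvd b" by (simp add: l_dvd ring_mapD(3)[OF r\<pi>])
  next
    fix a b assume "a * b \<in> ideal2 (ideal2 {0} l) u"
    then show "a \<in> ideal2 (ideal2 {0} l) u \<or> b \<in> ideal2 (ideal2 {0} l) u"
      by (simp add: in_lu ring_mapD(3)[OF r\<rho>])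
  next
    show "\<not> l dvd u" using u0 by (simp add: l_dvd \<pi>u)
    show "v \<notin> ideal2 (ideal2 {0} l) u" using v0 by (simp add: in_lu \<rho>u)
    show "g1 \<notin> ideal2 (ideal2 {0} l) u" using \<rho>g1 by (simp add: in_lu)
  next
    fix p assume p: "p \<in> homog (int d - 1)"
    have "\<rho> (p - scal (pt p / pt g1) g1) = 0"
      using ptg1 unfolding scal_def ring_mapD(3,5)[OF r\<rho>] \<rho>v ge[OF p] ge[OF g(1)]
      by (simp add: mult.assoc[symmetric] const_mult[symmetric])
    then show "\<exists>c. p - scal c g1 \<in> ideal2 (ideal2 {0} l) u" using in_lu by blast
  next
    show "\<exists>N. u ^ N \<in> ideal2 (ideal2 (ideal2 {0} g1) g2) l"
      using N unfolding u_def l_def v_def g1_def g2_def by blast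
  next
    fix a b c k assume abc: "a \<in> homog k" "b \<in> homog k" "c \<in> homog k" "k < int (mdr f)"
      and z: "a * g1 + b * g2 + c * g3 = 0"
    \<comment> \<open>Coefficients with respect to the original derivatives; the substitution is
      triangular, so their vanishing forces \<open>a\<close>, \<open>b\<close>, \<open>c\<close> to
      vanish.\<close>
    have "(const P0 * a + b) * pdiff 0 f + (const P1 * a + const \<kappa> * b + c) * pdiff 1 f + a * pdiff 2 f
        = a * g1 + b * g2 + c * g3"
      unfolding g1_def g2_def g3_def by (simp add: algebra_simps)
    then have "const P0 * a + b = 0 \<and> const P1 * a + const \<kappa> * b + c = 0 \<and> a = 0"
      using abc z by (intro syzygy_below_mdr[of _ k]) (auto intro!: homog_add ch)
    then show "a = 0 \<and> b = 0 \<and> c = 0" by auto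
  qed (use g luv l0 in auto)
  interpret three_forms g1 g2 g3 l u v "int d - 1" "int (mdr f)" by (rule tf)
  have "J = jac_ideal f"
    unfolding J_def K_def K0_def jac_ideal_def ideal_gen_3
  proof (intro equalityI subsetI)
    fix p assume "p \<in> ideal2 (ideal2 (ideal2 {0} g1) g2) g3"
    then obtain a b c where "p = g1 * a + g2 * b + g3 * c" unfolding in_ideal3 by blast
    then have "p = pdiff 0 f * (const P0 * a + b) + pdiff 1 f * (const P1 * a + const \<kappa> * b + c) + pdiff 2 f * a"
      unfolding g1_def g2_def g3_def by (simp add: algebra_simps)
    then show "p \<in> ideal2 (ideal2 (ideal2 {0} (pdiff 0 f)) (pdiff 1 f)) (pdiff 2 f)"
      unfolding in_ideal3 by blast
  next
    fix p assume "p \<in> ideal2 (ideal2 (ideal2 {0} (pdiff 0 f)) (pdiff 1 f)) (pdiff 2 f)"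
    then obtain a b c where "p = pdiff 0 f * a + pdiff 1 f * b + pdiff 2 f * c" unfolding in_ideal3 by blast
    then have "p = g1 * c + g2 * (a - const P0 * c)
        + g3 * (b - const P1 * c - const \<kappa> * (a - const P0 * c))"
      unfolding g1_def g2_def g3_def by (simp add: algebra_simps)
    then show "p \<in> ideal2 (ideal2 (ideal2 {0} g1) g2) g3" unfolding in_ideal3 by blast
  qed
  then show thesis using that tf by blast
qed

theorem proposition3p1:
  fixes f :: poly3 and d r :: nat
  assumes "reduced_curve f d"
    and "r = mdr f"
    and "of_nat r \<ge> (of_nat d / 2 :: rat)"
    and "maximal_tjurina f d"
  shows "\<forall>j::int.
     (2 * int d - 3 - int r \<le> j \<and> j \<le> int d - 3 + int r \<longrightarrow>
        (\<forall>d'::nat. d = 2 * d' + 1 \<longrightarrow>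
           (of_nat (jac_module_dim f j) :: rat) =
             of_int (3 * (int d')^2 - (j - 3 * int d' + 2) * (j - 3 * int d' + 1)) - tjurina f) \<and>
        (\<forall>d'::nat. d = 2 * d' \<longrightarrow>
           (of_nat (jac_module_dim f j) :: rat) =
             of_int (3 * (int d')^2 - 3 * int d' + 1 - (j - 3 * int d' + 3)^2) - tjurina f)) \<and>
     (\<not> (2 * int d - 3 - int r \<le> j \<and> j \<le> int d - 3 + int r) \<longrightarrow> jac_module_dim f j = 0)"
proof -
  have dr: "d \<le> 2 * mdr f" using assms(4) by (simp add: maximal_tjurina_def)
  obtain g1 g2 g3 l u v where tf: "three_forms g1 g2 g3 l u v (int d - 1) (int (mdr f))"
    and J: "three_forms.J g1 g2 g3 = jac_ideal f"
    using jacobian_three_forms[OF assms(1) dr] .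
  interpret three_forms g1 g2 g3 l u v "int d - 1" "int r" using tf assms(2) by simp
  note J = J[folded assms(2)]
  have d: "d \<ge> 1" using assms(1) by (simp add: reduced_curve_def)
  obtain j0 where "\<forall>j\<ge>j0. codim J j = tau" using codim_J_eventually by blast
  then have tj: "tjurina f = of_int tau"
    unfolding tjurina_def J[symmetric] by (rule subscheme_degree_eventually_const[OF is_ideal(3)])
  \<comment> \<open>The binomial coefficient is replaced by a doubled product over the integers;
    \<open>d \<le> 2 * r\<close> makes the truncated subtraction exact.\<close>
  define n where "n = 2 * r - d + 2"
  have n: "int n = 2 * int r - int d + 2" using dr assms(2) by (simp add: n_def of_nat_diff)
  have "even (n * (n - 1))" by (cases n) auto
  then have "2 * (n choose 2) = n * (n - 1)" by (simp add: choose_two)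
  then have "2 * int (n choose 2) = int n * int (n - 1)" by (metis of_nat_mult of_nat_numeral)
  moreover have "int (n - 1) = 2 * int r - int d + 1" using n by (simp add: n_def)
  ultimately have ch: "2 * int (n choose 2) = (2 * int r - int d + 2) * (2 * int r - int d + 1)"
    using n by simp
  have "(of_int tau :: rat) = (of_nat d - 1) * (of_nat d - of_nat r - 1) + of_nat r ^ 2 - of_nat (n choose 2)"
    using assms(2,4) tj by (simp add: maximal_tjurina_def n_def)
  also have "\<dots> = of_int ((int d - 1) * (int d - int r - 1) + int r ^ 2 - int (n choose 2))" by simp
  finally have tau: "tau = (int d - 1) * (int d - int r - 1) + int r ^ 2 - int (n choose 2)"
    by (simp only: of_int_eq_iff)
  \<comment> \<open>The maximal Tjurina value equals the explicit Hilbert function of the quotient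
    by \<open>J\<close> at \<open>e + r - 1\<close>, with \<open>e = d - 1\<close>.\<close>
  have "2 * tau = 2 * (hdim (int d - 1 + int r - 1) - 3 * hdim (int r - 1))"
    using tau ch two_hdim[of "int d - 1 + int r - 1"] two_hdim[of "int r - 1"] d
    by (simp add: algebra_simps power2_eq_square)
  then have max: "tau = hdim (int d - 1 + int r - 1) - 3 * hdim (int r - 1)" by simp
  have S: "saturation (jac_ideal f) = S"
    unfolding S_def J using saturation_eq_sat is_ideal(3) J by simp
  have nj: "int (jac_module_dim f j) = codim J j - codim S j" for j
    unfolding jac_module_dim_def S unfolding J[symmetric]
    using quot_dim_eq[OF fin_dim_ideal[OF is_ideal(6)], of "J \<inter> homog j" j] J_subset_S
      vs.fin_dim_subspace[OF fin_dim_ideal[OF is_ideal(3), of j]]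
    by (auto simp: codim_def)
  have in_range: "int (jac_module_dim f j) = hdim j - 3 * hdim (j - (int d - 1)) - tau"
    if "2 * int d - 3 - int r \<le> j" "j \<le> int d - 3 + int r" for j
    using codim_J_minus_codim_S(1)[OF max, of j] nj[of j] that by simp
  have out: "jac_module_dim f j = 0" if "\<not> (2 * int d - 3 - int r \<le> j \<and> j \<le> int d - 3 + int r)" for j
  proof -
    have "\<not> (2 * (int d - 1) - 1 - int r \<le> j \<and> j \<le> int d - 1 + int r - 2)" using that by arith
    then show ?thesis using codim_J_minus_codim_S(2)[OF max] nj[of j] by simp
  qed
  \<comment> \<open>In this range \<open>j - (d - 1)\<close> is at least -1, so both values of
    \<open>hdim\<close> are given by the polynomial formula.\<close>
  have two: "2 * int (jac_module_dim f j) = (j + 1) * (j + 2) - 3 * ((j - int d + 2) * (j - int d + 3)) - 2 * tau"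
    if "2 * int d - 3 - int r \<le> j" "j \<le> int d - 3 + int r" for j
    using in_range[OF that] two_hdim[of j] two_hdim[of "j - (int d - 1)"] that re d
    by (simp add: algebra_simps)
  have rat: "(of_nat (jac_module_dim f j) :: rat) = of_int x - tjurina f"
    if "int (jac_module_dim f j) = x - tau" for j x
    using that tj by (metis of_int_diff of_int_of_nat_eq)
  have odd: "int (jac_module_dim f j) = 3 * (int d')^2 - (j - 3 * int d' + 2) * (j - 3 * int d' + 1) - tau"
    if "2 * int d - 3 - int r \<le> j" "j \<le> int d - 3 + int r" "d = 2 * d' + 1" for j d'
    using two[OF that(1,2)] that(3) by (simp add: algebra_simps power2_eq_square)
  have even: "int (jac_module_dim f j) = 3 * (int d')^2 - 3 * int d' + 1 - (j - 3 * int d' + 3)^2 - tau"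
    if "2 * int d - 3 - int r \<le> j" "j \<le> int d - 3 + int r" "d = 2 * d'" for j d'
    using two[OF that(1,2)] that(3) by (simp add: algebra_simps power2_eq_square)
  show ?thesis using rat odd even out by blast
qed

end
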